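(* Let $2\le q\le n$, let $W$ be an algebraic irreducible $q$-dimensional subvariety of $\mathbf A^n_{\mathbb C}$, let $m$ be an integer with $0<m<q$, and let $\gamma_1,\dots,\gamma_d$ be $d$ disjoint pieces of $(q-m)$-dimensional analytic manifold with $\gamma_j\subset|W|_{\rm reg}$ for $j=1,\dots,d$. Assume that the $(n+m-q)$-dimensional subspace $$L_{0,0}:=\{\zeta\in\mathbb C^n:\ \zeta_k=0,\ k=1,\dots,q-m\}$$ intersects each $\gamma_j$ transversally, respectively at the point $p_{j0}$, $j=1,\dots,d$. Suppose that there are strictly positive rational numbers $\delta_1,\dots,\delta_m$ and polynomials $P_1,\dots,P_m\in\mathbb C[X_1,\dots,X_n]$ with $\deg P_j=d_j\ge\delta_j$, $j=1,\dots,m$, such that: (i) $|W|\cap V(P)$ is a $(q-m)$-dimensional variety in $\mathbb C^n$ which interpolates (i.e. contains) the pieces $\gamma_j$ and satisfies $|W|\cap V(P)\cap L_{0,0}=\{p_{10},\dots,p_{d0}\}$; (ii) there exist strictly positive constants $\kappa,K$ such that $$\zeta\in|W|,\ \|\zeta\|\ge K\ \Longrightarrow\ \sum_{j=1}^m\frac{|P_j(\zeta)|}{\|\zeta\|^{\delta_j}}+\sum_{k=1}^{q-m}\frac{|\zeta_k|}{\|\zeta\|}\ge\kappa .$$ Then, for $(\alpha,\beta)$ close to $(0,0)$ in $(\mathbb C^{n+m-q})^{q-m}\times\mathbb C^{q-m}$, the affine $(n+m-q)$-dimensional subspace $$L_{\alpha,\beta}:=\Big\{\zeta\in\mathbb C^n:\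 \zeta_k=\sum_{r=1}^{n+m-q}\alpha_{k,r}\,\zeta_{q-m+r}+\beta_k,\ k=1,\dots,q-m\Big\}$$ intersects each $\gamma_j$ transversally, respectively at a point $p_j(\alpha,\beta)$, $j=1,\dots,d$ (these points being necessarily distinct and close to the $p_{j0}$), and one has $$\sum_{j=1}^d\zeta_l[p_j(\alpha,\beta)]=\sum_{\substack{\underline k\in\mathbb N^{q-m}\\ |\underline k|\le\rho+1}}h^{(l)}_{\underline k}(\alpha)\,\beta_1^{k_1}\cdots\beta_{q-m}^{k_{q-m}},\qquad l=q-m+1,\dots,n,$$ where the $h^{(l)}_{\underline k}$ are germs of holomorphic functions of $\alpha$ at the origin and $\rho:=\sum_{j=1}^m(d_j-\delta_j)$.
   Context: $V(P)=\{\zeta\in\mathbb C^n:P_1(\zeta)=\cdots=P_m(\zeta)=0\}$; $|W|$ is the set of points of $W$ in $\mathbb C^n$ and $|W|_{\rm reg}$ its set of regular points. A "piece of manifold" is a (germ-like, small) locally closed complex submanifold of $\mathbb C^n$. For a point $p\in\mathbb C^n$, $\zeta_l[p]$ denotes its $l$-th affine coordinate. For $\underline k\in\mathbb N^{q-m}$, $|\underline k|=k_1+\cdots+k_{q-m}$.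
   Formalization: Added hypothesis: near each p_{j0} the set |W|∩V(P) coincides with γ_j (no other branch passes through p_{j0}); without it the claim fails, e.g. for one branch at the node of y²+y³=x² with L_{0,0}={x=0}. *)

theory Defs
  imports "HOL-Analysis.Analysis" "HOL-Library.Poly_Mapping"
begin

section \<open>Polynomials and algebraic subsets of affine space\<close>

text \<open>The affine space is \<^typ>\<open>complex ^ 'i\<close> for a finite index type \<^typ>\<open>'i\<close>;
  a polynomial maps each exponent vector to its coefficient, with finite support.\<close>

type_synonym 'i cpoly = "('i \<Rightarrow>\<^sub>0 nat) \<Rightarrow>\<^sub>0 complex"

definition poly_eval :: "('i::finite) cpoly \<Rightarrow> complex ^ 'i \<Rightarrow> complex" where
  "poly_eval P x = (\<Sum>e\<in>Poly_Mapping.keys P.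
     Poly_Mapping.lookup P e * (\<Prod>i\<in>UNIV. x $ i ^ Poly_Mapping.lookup e i))"

text \<open>The zero polynomial gets degree 0.\<close>

definition total_degree :: "('i::finite) cpoly \<Rightarrow> nat" where
  "total_degree P = Max (insert 0
     ((\<lambda>e. \<Sum>i\<in>UNIV. Poly_Mapping.lookup e i) ` Poly_Mapping.keys P))"

definition zero_locus :: "('i::finite) cpoly set \<Rightarrow> (complex ^ 'i) set" where
  "zero_locus F = {x. \<forall>P\<in>F. poly_eval P x = 0}"

definition algebraic_set :: "(complex ^ ('i::finite)) set \<Rightarrow> bool" where
  "algebraic_set V \<longleftrightarrow> (\<exists>F. V = zero_locus F)"

definition irreducible_algebraic_set :: "(complex ^ ('i::finite)) set \<Rightarrow> bool" where
  "irreducible_algebraic_set V \<longleftrightarrow> algebraic_set V \<and> V \<noteq> {} \<and>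
     (\<forall>A B. algebraic_set A \<longrightarrow> algebraic_set B \<longrightarrow> V = A \<union> B \<longrightarrow> V = A \<or> V = B)"

definition irreducible_chain :: "(complex ^ ('i::finite)) set \<Rightarrow> nat \<Rightarrow> (nat \<Rightarrow> (complex ^ 'i) set) \<Rightarrow> bool" where
  "irreducible_chain V k Z \<longleftrightarrow>
     (\<forall>i\<le>k. irreducible_algebraic_set (Z i) \<and> Z i \<subseteq> V) \<and> (\<forall>i<k. Z i \<subset> Z (Suc i))"

text \<open>Krull dimension of the Zariski topology on \<open>V\<close>.\<close>

definition algebraic_variety_of_dim :: "nat \<Rightarrow> (complex ^ ('i::finite)) set \<Rightarrow> bool" where
  "algebraic_variety_of_dim r V \<longleftrightarrow> algebraic_set V \<and>
     (\<exists>Z. irreducible_chain V r Z) \<and> (\<forall>k Z. irreducible_chain V k Z \<longrightarrow> k \<le> r)"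


section \<open>Holomorphic functions of several variables and complex submanifolds\<close>

definition holomorphic_several :: "(complex ^ ('i::finite) \<Rightarrow> complex) \<Rightarrow> (complex ^ 'i) set \<Rightarrow> bool" where
  "holomorphic_several f S \<longleftrightarrow> open S \<and>
     (\<forall>x\<in>S. \<exists>D. (f has_derivative D) (at x) \<and> (\<forall>c v. D (c *s v) = c * D v))"

definition holomorphic_map :: "(complex ^ ('i::finite) \<Rightarrow> complex ^ ('j::finite)) \<Rightarrow> (complex ^ 'i) set \<Rightarrow> bool" where
  "holomorphic_map f S \<longleftrightarrow> (\<forall>j. holomorphic_several (\<lambda>x. f x $ j) S)"

text \<open>Locally closed complex submanifold of pure dimension \<open>r\<close>: near each of its points some
  biholomorphic chart of the ambient space straightens \<open>M\<close> to a coordinate subspace.\<close>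

definition complex_submanifold :: "nat \<Rightarrow> (complex ^ ('i::finite)) set \<Rightarrow> bool" where
  "complex_submanifold r M \<longleftrightarrow>
     (\<forall>p\<in>M. \<exists>U V (\<phi> :: complex ^ 'i \<Rightarrow> complex ^ 'i) \<psi> I.
        p \<in> U \<and> homeomorphism U V \<phi> \<psi> \<and> holomorphic_map \<phi> U \<and> holomorphic_map \<psi> V \<and>
        card I = r \<and> \<phi> ` (M \<inter> U) = V \<inter> {z. \<forall>i. i \<notin> I \<longrightarrow> z $ i = 0})"

definition regular_points :: "(complex ^ ('i::finite)) set \<Rightarrow> (complex ^ 'i) set" where
  "regular_points W = {p \<in> W. \<exists>U r. open U \<and> p \<in> U \<and> complex_submanifold r (W \<inter> U)}"

text \<open>Velocities at \<open>p\<close> of differentiable curves in \<open>M\<close>; for a complex submanifold this is the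
  complex tangent space.\<close>

definition tangent_vectors :: "(complex ^ ('i::finite)) set \<Rightarrow> complex ^ 'i \<Rightarrow> (complex ^ 'i) set" where
  "tangent_vectors M p = {v. \<exists>c :: real \<Rightarrow> complex ^ 'i.
     c 0 = p \<and> (\<forall>\<^sub>F t in nhds 0. c t \<in> M) \<and> (c has_vector_derivative v) (at 0)}"

definition transversal_at :: "(complex ^ ('i::finite)) set \<Rightarrow> (complex ^ 'i) set \<Rightarrow> complex ^ 'i \<Rightarrow> bool" where
  "transversal_at M N p \<longleftrightarrow> p \<in> M \<inter> N \<and>
     {u + v |u v. u \<in> tangent_vectors M p \<and> v \<in> tangent_vectors N p} = UNIV"


section \<open>The family of affine subspaces\<close>

text \<open>The coordinates of the ambient space are indexed by \<^typ>\<open>'a + 'b\<close>, where \<open>Inl\<close> gives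
  the first \<open>q - m\<close> of them and \<open>Inr\<close> the remaining \<open>n + m - q\<close>. The matrix
  \<open>\<alpha>\<close> is a single vector with entries \<open>\<alpha> $ (k, r)\<close>.\<close>

definition affine_plane ::
  "complex ^ ('a \<times> 'b) \<Rightarrow> complex ^ 'a \<Rightarrow> (complex ^ ('a::finite + 'b::finite)) set" where
  "affine_plane \<alpha> \<beta> =
     {\<zeta>. \<forall>k. \<zeta> $ Inl k = (\<Sum>r\<in>UNIV. \<alpha> $ (k, r) * \<zeta> $ Inr r) + \<beta> $ k}"

end

theory Submission
  imports Defs "HOL-Complex_Analysis.Complex_Analysis"
    "HOL-Computational_Algebra.Fundamental_Theorem_Algebra"
begin

no_notation fps_nth (infixl "$" 75)

text \<open>
  Let \<open>V = W \<inter> V(P)\<close>. On \<open>V\<close> the growth condition says that the first \<open>q - m\<close> coordinates dominate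
  the norm at infinity, so the points of \<open>V\<close> on the plane with parameters \<open>(\<alpha>, \<beta>)\<close> have norm
  \<open>O(1 + \<parallel>\<beta>\<parallel>)\<close>, uniformly in small \<open>\<alpha>\<close>. Near \<open>(0, 0)\<close> these points are exactly the \<open>p\<^sub>j(\<alpha>, \<beta>)\<close>.
  Along a complex line \<open>\<beta> = t v\<close> they form an algebraic family \<open>X\<close> over the \<open>t\<close>-line with fibres bounded
  by \<open>O(1 + \<bar>t\<bar>)\<close>. Each coordinate of \<open>X\<close> satisfies a polynomial equation over \<open>\<complex>[t]\<close>
  by the Nullstellensatz, so off a finite set of \<open>t\<close> the non-isolated points of \<open>X\<close> are locally a
  union of disjoint holomorphic graphs. The sum of their coordinates is single-valued and of linear
  growth, hence affine in \<open>t\<close> by Riemann and Liouville; near \<open>t = 0\<close> it is the sum of the \<open>p\<^sub>j\<close>. Thus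
  the trace is already a polynomial of degree at most \<open>1 \<le> \<rho> + 1\<close> in \<open>\<beta>\<close>, no multiplicities
  or residues being needed.
\<close>

section \<open>Generically simple roots\<close>

text \<open>Summing over the fibre as a set is legitimate only where distinct fibre points move as
  distinct holomorphic functions of t. A polynomial equation for each coordinate does not give this
  by itself, since its roots may be multiple for every t; hence the passage to a squarefree part,
  taken once over \<complex>[t] so that only finitely many t are lost. The equations come from the
  linear bound alone: a coordinate bounded over the unit disc omits uncountably many values there,
  whereas polynomial functions form a space of countable dimension. The same clash, of uncountably
  many inverses with countable dimension, proves the Nullstellensatz, and no dimension theory
  enters. What remains is to pass from lines to all \<beta>: along a line the slope is a directional
  derivative at \<beta> = 0, which is linear in the direction.\<close>

abbreviation poly2 :: "complex poly poly \<Rightarrow> complex \<Rightarrow> complex poly" where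
  "poly2 F t \<equiv> map_poly (\<lambda>p. poly p t) F"

text \<open>\<open>F\<close> is a polynomial in y over \<complex>[t]. Substituting the constant
  \<open>[:y:]\<close> first turns product formulas over \<complex>[t] into values of
  \<open>poly2\<close>.\<close>

lemma poly2_eq: "poly (poly2 F t) y = poly (poly F [:y:]) t"
  by (induction F) (simp_all add: map_poly_pCons)

text \<open>Euclid's algorithm with pseudo-division, since coefficients in a domain cannot be
  divided. The powers of leading coefficients collect in \<open>s\<close>: the Bezout identity for
  \<open>H\<close> is exact, but \<open>H\<close> divides \<open>F\<close> and \<open>G\<close> only
  after scaling by \<open>s\<close>. Over the fraction field \<open>H\<close> is thus a gcd.\<close>

lemma pseudo_gcd:
  fixes F G :: "'a::idom poly"
  shows "\<exists>H u v A B s. s \<noteq> 0 \<and> u * F + v * G = H \<and> smult s F = A * H \<and> smult s G = B * H"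
proof (induction "if G = 0 then 0 else Suc (degree G)" arbitrary: F G rule: less_induct)
  case less
  show ?case
  proof (cases "G = 0")
    case True
    then show ?thesis
      by (intro exI[of _ F] exI[of _ 1] exI[of _ 0] exI[of _ 1] exI[of _ 0] exI[of _ "1 :: 'a"]) auto
  next
    case False
    obtain Q R where QR: "pseudo_divmod F G = (Q, R)" by (metis surj_pair)
    define c where "c = coeff G (degree G) ^ (Suc (degree F) - degree G)"
    have c: "c \<noteq> 0" "smult c F = G * Q + R" and R: "R = 0 \<or> degree R < degree G"
      using pseudo_divmod[OF False QR] False by (auto simp: c_def)
    have "\<exists>H u v A B s. s \<noteq> 0 \<and> u * G + v * R = H \<and> smult s G = A * H \<and> smult s R = B * H"
      by (rule less) (use R False in auto)
    then obtain H u v A B s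
      where *: "s \<noteq> 0" "u * G + v * R = H" "smult s G = A * H" "smult s R = B * H" by blast
    \<comment> \<open>The remainder \<open>R\<close> is replaced by \<open>smult c F - G * Q\<close>
      in the Bezout identity for \<open>G\<close> and \<open>R\<close>.\<close>
    have "(smult c v) * F + (u - v * Q) * G = v * smult c F + (u - v * Q) * G" by simp
    also have "\<dots> = H" unfolding c(2) *(2)[symmetric] by (simp add: algebra_simps)
    finally have 1: "(smult c v) * F + (u - v * Q) * G = H" .
    have "smult (s * c) F = smult s (smult c F)" by simp
    also have "\<dots> = Q * smult s G + smult s R" unfolding c(2) by (simp add: smult_add_right mult.commute)
    finally have "smult (s * c) F = (Q * A + B) * H" by (simp add: * algebra_simps)
    moreover have "smult (s * c) G = smult c A * H"
      by (simp add: *(3) mult.commute[of s] flip: smult_smult)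
    moreover have "s * c \<noteq> 0" using * c by simp
    ultimately show ?thesis using 1 by blast
  qed
qed

lemma poly2_add: "poly2 (F + G) t = poly2 F t + poly2 G t"
  by (rule poly_eqI) (simp add: coeff_map_poly)

lemma poly2_mult: "poly2 (F * G) t = poly2 F t * poly2 G t"
  by (rule poly_eqI) (simp add: coeff_map_poly coeff_mult poly_sum)

lemma poly2_smult: "poly2 (smult s F) t = smult (poly s t) (poly2 F t)"
  by (rule poly_eqI) (simp add: coeff_map_poly)

lemma poly2_pderiv: "poly2 (pderiv F) t = pderiv (poly2 F t)"
  by (rule poly_eqI) (simp add: coeff_map_poly coeff_pderiv)

text \<open>A specialisation can vanish only at a root of the leading coefficient, which is a
  nonzero polynomial in t.\<close>

lemma finite_poly2_eq_0: "F \<noteq> 0 \<Longrightarrow> finite {t. poly2 F t = 0}"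
proof -
  assume "F \<noteq> 0"
  then have "finite {t. poly (lead_coeff F) t = 0}" by (intro poly_roots_finite) simp
  moreover have "poly (lead_coeff F) t = coeff (poly2 F t) (degree F)" for t
    by (simp add: coeff_map_poly)
  ultimately show ?thesis by (elim finite_subset[rotated]) auto
qed

text \<open>Up to units \<open>H\<close> is the gcd of \<open>f\<close> and its derivative, so \<open>A\<close> is the squarefree part of \<open>f\<close>.\<close>

lemma order_quotient_derivative:
  fixes f :: "'a::field_char_0 poly"
  assumes f: "f \<noteq> 0" "poly f y = 0" and s: "s \<noteq> 0"
    and H: "u * f + v * pderiv f = H" "smult s f = A * H" "smult s (pderiv f) = B * H"
  shows "order y A = 1"
proof -
  have "A * H \<noteq> 0" using f s H(2) by (metis smult_eq_0_iff)
  then have nz: "A \<noteq> 0" "H \<noteq> 0" by auto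
  have "pderiv f \<noteq> 0"
  proof
    assume "pderiv f = 0"
    then have "degree f = 0" by (simp add: pderiv_eq_0_iff)
    then show False using f by (metis degree_eq_zeroE poly_const_conv pCons_0_0)
  qed
  have o: "order y f = Suc (order y (pderiv f))" by (rule order_pderiv[OF f])
  have "order y f = order y A + order y H"
    using order_mult[OF \<open>A * H \<noteq> 0\<close>, of y] s unfolding H(2)[symmetric] by (simp add: order_smult)
  moreover have "order y H \<le> order y (pderiv f)"
  proof -
    have "B * H \<noteq> 0" using s \<open>pderiv f \<noteq> 0\<close> unfolding H(3)[symmetric] by simp
    from order_mult[OF this, of y] s show ?thesis unfolding H(3)[symmetric] by (simp add: order_smult)
  qed
  \<comment> \<open>The power of the linear factor occurring in \<open>pderiv f\<close> also divides
    \<open>f\<close>, hence their combination \<open>H\<close>.\<close>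
  moreover have "order y (pderiv f) \<le> order y H"
  proof -
    let ?q = "[:- y, 1:] ^ order y (pderiv f)"
    have "?q dvd [:- y, 1:] ^ order y f" unfolding o by (rule le_imp_power_dvd) simp
    then have "?q dvd f" using order_1 dvd_trans by blast
    then have "?q dvd H" unfolding H(1)[symmetric] by (intro dvd_add dvd_mult order_1)
    then show ?thesis using nz by (simp add: order_divides)
  qed
  ultimately show ?thesis using o by simp
qed

lemma simple_root:
  fixes A :: "'a::field_char_0 poly"
  assumes "A \<noteq> 0" "order y A = 1"
  shows "poly A y = 0" "poly (pderiv A) y \<noteq> 0"
proof -
  show root: "poly A y = 0" using assms(2) by (simp add: order_root)
  have "pderiv A \<noteq> 0"
  proof
    assume "pderiv A = 0"
    then have "degree A = 0" by (simp add: pderiv_eq_0_iff)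
    then show False using \<open>A \<noteq> 0\<close> root by (metis degree_eq_zeroE poly_const_conv pCons_0_0)
  qed
  moreover have "order y (pderiv A) = 0" using order_pderiv[OF \<open>A \<noteq> 0\<close> root] assms by simp
  ultimately show "poly (pderiv A) y \<noteq> 0" by (simp add: order_root)
qed

text \<open>The pseudo-gcd of \<open>F\<close> and its derivative is computed once over
  \<complex>[t]. Its identities are polynomial, so they specialise to every t, and off
  \<open>S\<close> they exhibit \<open>poly2 A t\<close> as the squarefree part of
  \<open>poly2 F t\<close>, up to units.\<close>

theorem generically_simple_roots:
  fixes F :: "complex poly poly"
  assumes "F \<noteq> 0"
  obtains A S where "finite S" "\<And>t. t \<notin> S \<Longrightarrow> poly2 A t \<noteq> 0"
    "\<And>t y. t \<notin> S \<Longrightarrow> poly (poly2 F t) y = 0 \<Longrightarrow>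
       poly (poly2 A t) y = 0 \<and> poly (pderiv (poly2 A t)) y \<noteq> 0"
proof -
  obtain H u v A B s where *: "s \<noteq> 0" "u * F + v * pderiv F = H" "smult s F = A * H"
    "smult s (pderiv F) = B * H" using pseudo_gcd[of F "pderiv F"] by blast
  define S where "S = {t. poly s t = 0} \<union> {t. poly2 F t = 0} \<union> {t. poly2 A t = 0}"
  have "A \<noteq> 0" using * assms by auto
  then have "finite S" unfolding S_def
    using assms *(1) finite_poly2_eq_0 poly_roots_finite by blast
  moreover have "poly2 A t \<noteq> 0" if "t \<notin> S" for t using that by (simp add: S_def)
  moreover have "order y (poly2 A t) = 1" if "t \<notin> S" "poly (poly2 F t) y = 0" for t y
  proof (rule order_quotient_derivative)
    show "poly2 F t \<noteq> 0" "poly s t \<noteq> 0" using that by (auto simp: S_def)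
    show "poly2 u t * poly2 F t + poly2 v t * pderiv (poly2 F t) = poly2 H t"
      by (simp add: poly2_add poly2_mult *(2)[symmetric] flip: poly2_pderiv)
    show "smult (poly s t) (poly2 F t) = poly2 A t * poly2 H t"
      by (simp add: *(3) flip: poly2_mult poly2_smult)
    show "smult (poly s t) (pderiv (poly2 F t)) = poly2 B t * poly2 H t"
      by (simp add: *(4) flip: poly2_mult poly2_smult poly2_pderiv)
  qed fact
  ultimately show thesis using that[of S A] simple_root by blast
qed

section \<open>Ideals of polynomial functions\<close>

text \<open>Gaussian elimination by induction on the equations in \<open>M\<close>: an equation
  \<open>e0\<close> with a nonzero coefficient at \<open>k0\<close> is solved for that unknown,
  which costs one equation and one unknown.\<close>

lemma linear_dependence:
  fixes c :: "'s \<Rightarrow> 'e \<Rightarrow> 'f::field"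
  assumes "finite M" "finite T" "card M < card T"
  shows "\<exists>b. (\<exists>k\<in>T. b k \<noteq> 0) \<and> (\<forall>e\<in>M. (\<Sum>k\<in>T. b k * c k e) = 0)"
  using assms
proof (induction M arbitrary: T c rule: finite_induct)
  case empty
  then obtain k where "k \<in> T" by (metis card.empty equals0I less_numeral_extra(3))
  then show ?case by (intro exI[of _ "\<lambda>_. 1"]) auto
next
  case (insert e0 M)
  show ?case
  proof (cases "\<forall>k\<in>T. c k e0 = 0")
    case True
    have "card M < card T" using insert by simp
    then obtain b where "\<exists>k\<in>T. b k \<noteq> 0" "\<forall>e\<in>M. (\<Sum>k\<in>T. b k * c k e) = 0"
      using insert.IH[OF insert.prems(1)] by blast
    with True show ?thesis by (intro exI[of _ b]) auto
  next
    case False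
    then obtain k0 where k0: "k0 \<in> T" "c k0 e0 \<noteq> 0" by blast
    define T' where "T' = T - {k0}"
    \<comment> \<open>Subtracting the multiple of column \<open>k0\<close> that clears row
      \<open>e0\<close> leaves a system in the unknowns \<open>T'\<close>.\<close>
    define c' where "c' = (\<lambda>k e. c k e - c k e0 / c k0 e0 * c k0 e)"
    have T': "finite T'" "card M < card T'" using insert k0 by (auto simp: T'_def)
    from insert.IH[OF T', of c'] obtain b where
      b: "\<exists>k\<in>T'. b k \<noteq> 0" "\<And>e. e \<in> M \<Longrightarrow> (\<Sum>k\<in>T'. b k * c' k e) = 0" by blast
    define S where "S = (\<Sum>k\<in>T'. b k * c k e0)"
    \<comment> \<open>The value at \<open>k0\<close> is dictated by the equation
      \<open>e0\<close>.\<close>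
    define b' where "b' = b(k0 := - S / c k0 e0)"
    have sum_T: "(\<Sum>k\<in>T. b' k * c k e) = - S / c k0 e0 * c k0 e + (\<Sum>k\<in>T'. b k * c k e)" for e
    proof -
      have "(\<Sum>k\<in>T. b' k * c k e) = b' k0 * c k0 e + (\<Sum>k\<in>T'. b' k * c k e)"
        unfolding T'_def using k0 insert.prems by (simp add: sum.remove)
      also have "(\<Sum>k\<in>T'. b' k * c k e) = (\<Sum>k\<in>T'. b k * c k e)"
        by (rule sum.cong) (auto simp: b'_def T'_def)
      finally show ?thesis by (simp add: b'_def)
    qed
    have "(\<Sum>k\<in>T'. b k * c' k e) = (\<Sum>k\<in>T'. b k * c k e) - S / c k0 e0 * c k0 e" for e
      by (simp add: c'_def S_def right_diff_distrib sum_subtractf sum_distrib_right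
          sum_divide_distrib mult.assoc)
    with b sum_T have "\<forall>e\<in>M. (\<Sum>k\<in>T. b' k * c k e) = 0" by auto
    moreover have "(\<Sum>k\<in>T. b' k * c k e0) = 0"
      using k0 by (simp add: sum_T flip: S_def)
    moreover have "\<exists>k\<in>T. b' k \<noteq> 0" using b(1) by (auto simp: b'_def T'_def)
    ultimately show ?thesis by (intro exI[of _ b']) auto
  qed
qed

text \<open>Functions instead of formal polynomials: substitution, continuity and derivatives then
  follow by induction on the construction, and over the infinite field \<complex> the two notions
  give the same ring.\<close>

inductive_set polyfuns :: "(complex ^ 'k::finite \<Rightarrow> complex) set" where
  const: "(\<lambda>x. c) \<in> polyfuns"
| coord: "(\<lambda>x. x $ i) \<in> polyfuns"
| add: "f \<in> polyfuns \<Longrightarrow> g \<in> polyfuns \<Longrightarrow> (\<lambda>x. f x + g x) \<in> polyfuns"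
| mult: "f \<in> polyfuns \<Longrightarrow> g \<in> polyfuns \<Longrightarrow> (\<lambda>x. f x * g x) \<in> polyfuns"

lemma polyfuns_sum:
  "(\<And>i. i \<in> I \<Longrightarrow> f i \<in> polyfuns) \<Longrightarrow> (\<lambda>x. \<Sum>i\<in>I. f i x) \<in> polyfuns"
  by (induction I rule: infinite_finite_induct) (auto intro: polyfuns.intros)

lemma polyfuns_prod:
  "(\<And>i. i \<in> I \<Longrightarrow> f i \<in> polyfuns) \<Longrightarrow> (\<lambda>x. \<Prod>i\<in>I. f i x) \<in> polyfuns"
  by (induction I rule: infinite_finite_induct) (auto intro: polyfuns.intros)

lemma polyfuns_power: "f \<in> polyfuns \<Longrightarrow> (\<lambda>x. f x ^ n) \<in> polyfuns"
  by (induction n) (auto intro: polyfuns.intros)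

lemma polyfuns_diff:
  assumes "f \<in> polyfuns" "g \<in> polyfuns" shows "(\<lambda>x. f x - g x) \<in> polyfuns"
  using polyfuns.add[OF assms(1) polyfuns.mult[OF polyfuns.const[of "-1"] assms(2)]] by simp

lemma polyfuns_poly:
  assumes "f \<in> polyfuns" shows "(\<lambda>x. poly p (f x)) \<in> polyfuns"
  by (induction p) (auto intro!: polyfuns.intros assms)

lemma polyfuns_compose:
  assumes "f \<in> polyfuns" "\<And>i. (\<lambda>x. T x $ i) \<in> polyfuns"
  shows "(\<lambda>x. f (T x)) \<in> polyfuns"
  using assms(1) by induction (auto intro: polyfuns.intros assms(2))

lemmas polyfuns_intros = polyfuns.intros polyfuns_sum polyfuns_prod polyfuns_power polyfuns_diff
  polyfuns_poly

lemma poly_eval_polyfuns: "poly_eval P \<in> polyfuns"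
  unfolding poly_eval_def[abs_def] by (intro polyfuns_intros)

lemma polyfuns_continuous: "f \<in> polyfuns \<Longrightarrow> continuous_on A f"
  by (induction rule: polyfuns.induct) (auto intro!: continuous_intros)

abbreviation (input) monom_fun :: "('k::finite \<Rightarrow> nat) \<Rightarrow> complex ^ 'k \<Rightarrow> complex" where
  "monom_fun e x \<equiv> \<Prod>i\<in>UNIV. x $ i ^ e i"

text \<open>The exponents form a countable set, so finite combinations of monomials are the source
  of the countable dimension used below.\<close>

lemma polyfuns_expansion:
  assumes "f \<in> polyfuns"
  shows "\<exists>M c. finite M \<and> f = (\<lambda>x. \<Sum>e\<in>M. c e * monom_fun e x)"
  using assms
proof induction
  case (const c)
  show ?case by (rule exI[of _ "{\<lambda>_. 0}"], rule exI[of _ "\<lambda>_. c"]) simp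
next
  case (coord i)
  define e where "e = (\<lambda>k. if k = i then 1 else 0 :: nat)"
  have "monom_fun e x = x $ i" for x
  proof -
    have "monom_fun e x = (\<Prod>k\<in>UNIV. if k = i then x $ i else 1)"
      by (rule prod.cong) (auto simp: e_def)
    then show ?thesis by simp
  qed
  then show ?case by (intro exI[of _ "{e}"] exI[of _ "\<lambda>_. 1"]) simp
next
  case (add f g)
  from add.IH(1) obtain M c where M: "finite M" "f = (\<lambda>x. \<Sum>e\<in>M. c e * monom_fun e x)"
    by blast
  from add.IH(2) obtain N d where N: "finite N" "g = (\<lambda>x. \<Sum>e\<in>N. d e * monom_fun e x)"
    by blast
  let ?c = "\<lambda>e. (if e \<in> M then c e else 0) + (if e \<in> N then d e else 0)"
  have "f x + g x = (\<Sum>e\<in>M \<union> N. ?c e * monom_fun e x)" for x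
  proof -
    have "f x = (\<Sum>e\<in>M \<union> N. (if e \<in> M then c e else 0) * monom_fun e x)"
      unfolding M(2) by (rule sum.mono_neutral_cong_left) (use M N in auto)
    moreover have "g x = (\<Sum>e\<in>M \<union> N. (if e \<in> N then d e else 0) * monom_fun e x)"
      unfolding N(2) by (rule sum.mono_neutral_cong_left) (use M N in auto)
    ultimately show ?thesis by (simp only: sum.distrib distrib_right)
  qed
  then have "(\<lambda>x. f x + g x) = (\<lambda>x. \<Sum>e\<in>M \<union> N. ?c e * monom_fun e x)" by (rule ext)
  then show ?case by (intro exI[of _ "M \<union> N"] exI[of _ ?c] conjI) (use M N in auto)
next
  case (mult f g)
  from mult.IH(1) obtain M c where M: "finite M" "f = (\<lambda>x. \<Sum>e\<in>M. c e * monom_fun e x)"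
    by blast
  from mult.IH(2) obtain N d where N: "finite N" "g = (\<lambda>x. \<Sum>e\<in>N. d e * monom_fun e x)"
    by blast
  \<comment> \<open>Products of monomials add exponents; terms with the same sum are collected,
    hence the sums over the fibres of \<open>s\<close>.\<close>
  define s :: "('a \<Rightarrow> nat) \<times> ('a \<Rightarrow> nat) \<Rightarrow> 'a \<Rightarrow> nat" where "s = (\<lambda>(e, e') i. e i + e' i)"
  let ?a = "\<lambda>k. \<Sum>p\<in>{p \<in> M \<times> N. s p = k}. c (fst p) * d (snd p)"
  have "f x * g x = (\<Sum>k\<in>s ` (M \<times> N). ?a k * monom_fun k x)" for x
  proof -
    have "f x * g x = (\<Sum>p\<in>M \<times> N. (c (fst p) * d (snd p)) * monom_fun (s p) x)"
      unfolding M(2) N(2) sum_product sum.cartesian_product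
      by (rule sum.cong) (auto simp: s_def power_add prod.distrib)
    also have "\<dots> = (\<Sum>k\<in>s ` (M \<times> N). \<Sum>p\<in>{p \<in> M \<times> N. s p = k}.
        (c (fst p) * d (snd p)) * monom_fun (s p) x)"
      by (rule sum.image_gen) (use M N in auto)
    also have "\<dots> = (\<Sum>k\<in>s ` (M \<times> N). ?a k * monom_fun k x)"
      unfolding sum_distrib_right by (intro sum.cong) auto
    finally show ?thesis .
  qed
  then have "(\<lambda>x. f x * g x) = (\<lambda>x. \<Sum>k\<in>s ` (M \<times> N). ?a k * monom_fun k x)" by (rule ext)
  then show ?case by (intro exI[of _ "s ` (M \<times> N)"] exI[of _ ?a] conjI) (use M N in auto)
qed

definition polyfun_ideal :: "(complex ^ 'k::finite \<Rightarrow> complex) set \<Rightarrow> bool" where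
  "polyfun_ideal J \<longleftrightarrow> J \<subseteq> polyfuns \<and> (\<lambda>_. 0) \<in> J \<and>
     (\<forall>f\<in>J. \<forall>g\<in>J. (\<lambda>x. f x + g x) \<in> J) \<and> (\<forall>f\<in>polyfuns. \<forall>g\<in>J. (\<lambda>x. f x * g x) \<in> J)"

lemma polyfun_idealD:
  assumes "polyfun_ideal J"
  shows "f \<in> J \<Longrightarrow> f \<in> polyfuns" "(\<lambda>_. 0) \<in> J"
    "f \<in> J \<Longrightarrow> g \<in> J \<Longrightarrow> (\<lambda>x. f x + g x) \<in> J"
    "f \<in> polyfuns \<Longrightarrow> g \<in> J \<Longrightarrow> (\<lambda>x. f x * g x) \<in> J"
  using assms unfolding polyfun_ideal_def by auto

lemma polyfun_ideal_sum:
  assumes "polyfun_ideal J" "\<And>i. i \<in> I \<Longrightarrow> f i \<in> J"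
  shows "(\<lambda>x. \<Sum>i\<in>I. f i x) \<in> J"
  using assms(2)
  by (induction I rule: infinite_finite_induct) (auto intro: polyfun_idealD[OF assms(1)])

text \<open>The ideal J + (g), kept in a form that displays the cofactor of
  \<open>g\<close>.\<close>

definition adjoin :: "(complex ^ 'k::finite \<Rightarrow> complex) set \<Rightarrow> (complex ^ 'k \<Rightarrow> complex)
    \<Rightarrow> (complex ^ 'k \<Rightarrow> complex) set" where
  "adjoin J g = {(\<lambda>x. j x + u x * g x) | j u. j \<in> J \<and> u \<in> polyfuns}"

lemma adjoinI: "j \<in> J \<Longrightarrow> u \<in> polyfuns \<Longrightarrow> (\<lambda>x. j x + u x * g x) \<in> adjoin J g"
  unfolding adjoin_def by blast

lemma polyfun_ideal_adjoin:
  assumes J: "polyfun_ideal J" and g: "g \<in> polyfuns"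
  shows "polyfun_ideal (adjoin J g)"
  unfolding polyfun_ideal_def
proof (intro conjI ballI)
  show "adjoin J g \<subseteq> polyfuns"
    using polyfun_idealD(1)[OF J] g by (auto simp: adjoin_def intro!: polyfuns_intros)
  show "(\<lambda>_. 0) \<in> adjoin J g"
    using adjoinI[OF polyfun_idealD(2)[OF J] polyfuns.const[of 0], of g] by simp
next
  fix f h assume "f \<in> adjoin J g" "h \<in> adjoin J g"
  then obtain j u j' u' where *: "j \<in> J" "u \<in> polyfuns" "j' \<in> J" "u' \<in> polyfuns"
    "f = (\<lambda>x. j x + u x * g x)" "h = (\<lambda>x. j' x + u' x * g x)" unfolding adjoin_def by blast
  have "(\<lambda>x. (j x + j' x) + (u x + u' x) * g x) \<in> adjoin J g"
    by (intro adjoinI polyfun_idealD(3)[OF J] * polyfuns.add)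
  then show "(\<lambda>x. f x + h x) \<in> adjoin J g" by (simp add: * algebra_simps)
next
  fix f h :: "complex ^ 'a \<Rightarrow> complex" assume f: "f \<in> polyfuns" and "h \<in> adjoin J g"
  then obtain j u where *: "j \<in> J" "u \<in> polyfuns" "h = (\<lambda>x. j x + u x * g x)"
    unfolding adjoin_def by blast
  have "(\<lambda>x. (f x * j x) + (f x * u x) * g x) \<in> adjoin J g"
    by (intro adjoinI polyfun_idealD(4)[OF J] * f polyfuns.mult)
  then show "(\<lambda>x. f x * h x) \<in> adjoin J g" by (simp add: * algebra_simps)
qed

lemma adjoin_superset:
  shows "J \<subseteq> adjoin J g"
proof
  fix j assume "j \<in> J"
  from adjoinI[OF this polyfuns.const[of 0], of g] show "j \<in> adjoin J g" by simp
qed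

lemma adjoin_self:
  assumes "polyfun_ideal J" shows "g \<in> adjoin J g"
  using adjoinI[OF polyfun_idealD(2)[OF assms] polyfuns.const[of 1], of g] by simp

section \<open>The weak Nullstellensatz over an uncountable field\<close>

lemma uncountable_pigeonhole:
  fixes f :: "'s \<Rightarrow> 't"
  assumes "uncountable D" "countable (f ` D)"
  obtains y where "uncountable {x \<in> D. f x = y}"
proof -
  have "D = (\<Union>y\<in>f ` D. {x \<in> D. f x = y})" by blast
  moreover have "countable (\<Union>y\<in>f ` D. {x \<in> D. f x = y})" if "\<And>y. countable {x \<in> D. f x = y}"
    by (intro countable_UN assms(2) that)
  ultimately show thesis using that assms(1) by metis
qed

text \<open>The polynomial functions have countable dimension over the uncountable field of scalars, so
  uncountably many inverses \<open>u \<kappa>\<close> of \<open>y - \<kappa>\<close> modulo \<open>J\<close> satisfy a linear relation; clearing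
  denominators in it gives an element of \<open>J\<close>.\<close>

lemma uncountable_inverses_relation:
  assumes J: "polyfun_ideal J" and y: "y \<in> polyfuns" and D: "uncountable D"
    and u: "\<And>\<kappa>. \<kappa> \<in> D \<Longrightarrow> u \<kappa> \<in> polyfuns"
    and rel: "\<And>\<kappa>. \<kappa> \<in> D \<Longrightarrow> (\<lambda>x. u \<kappa> x * (y x - \<kappa>) - s \<kappa> x) \<in> J"
  obtains E a where "finite E" "E \<noteq> {}" "E \<subseteq> D" "\<And>\<kappa>. \<kappa> \<in> E \<Longrightarrow> a \<kappa> \<noteq> 0"
    "(\<lambda>x. \<Sum>\<kappa>\<in>E. a \<kappa> * s \<kappa> x * (\<Prod>\<kappa>'\<in>E - {\<kappa>}. y x - \<kappa>')) \<in> J"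
proof -
  have "\<forall>\<kappa>\<in>D. \<exists>M c. finite M \<and> u \<kappa> = (\<lambda>x. \<Sum>e\<in>M. c e * monom_fun e x)"
    using u polyfuns_expansion by blast
  then obtain M c where Mc: "\<And>\<kappa>. \<kappa> \<in> D \<Longrightarrow> finite (M \<kappa>)"
    "\<And>\<kappa>. \<kappa> \<in> D \<Longrightarrow> u \<kappa> = (\<lambda>x. \<Sum>e\<in>M \<kappa>. c \<kappa> e * monom_fun e x)"
    unfolding bchoice_iff by blast
  \<comment> \<open>There are only countably many finite sets of exponents, so uncountably many of
    the \<open>u \<kappa>\<close> use the monomials of one finite set \<open>N\<close>; then
    \<open>card N + 1\<close> of them are linearly dependent.\<close>
  have "countable (M ` D)"
  proof (rule countable_subset[OF _ countable_Collect_finite])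
    show "M ` D \<subseteq> {A. finite A}" using Mc(1) by blast
  qed
  from uncountable_pigeonhole[OF D this]
  obtain N where N: "uncountable {\<kappa> \<in> D. M \<kappa> = N}" (is "uncountable ?D") .
  then have "infinite ?D" using countable_finite by blast
  then obtain T where T: "finite T" "card T = Suc (card N)" "T \<subseteq> ?D"
    using infinite_arbitrarily_large by blast
  moreover have "finite N"
  proof -
    obtain k where "k \<in> ?D" using \<open>infinite ?D\<close> by (metis ex_in_conv finite.emptyI)
    then show ?thesis using Mc(1) by blast
  qed
  ultimately obtain b where b: "\<exists>k\<in>T. b k \<noteq> 0" "\<And>e. e \<in> N \<Longrightarrow> (\<Sum>k\<in>T. b k * c k e) = 0"
    using linear_dependence[of N T c] by auto
  \<comment> \<open>Discarding the zero coefficients makes every \<open>a \<kappa>\<close> nonzero,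
    as needed to see later that the resulting polynomial is nonzero.\<close>
  define E where "E = {k \<in> T. b k \<noteq> 0}"
  have E: "finite E" "E \<noteq> {}" "E \<subseteq> D" using T b(1) by (auto simp: E_def)
  have rel0: "(\<Sum>k\<in>E. b k * u k x) = 0" for x
  proof -
    have "(\<Sum>k\<in>E. b k * u k x) = (\<Sum>k\<in>T. b k * u k x)"
      by (rule sum.mono_neutral_left) (auto simp: E_def T)
    also have "\<dots> = (\<Sum>k\<in>T. \<Sum>e\<in>N. b k * c k e * monom_fun e x)"
      using T Mc by (intro sum.cong) (auto simp: sum_distrib_left mult.assoc)
    also have "\<dots> = (\<Sum>e\<in>N. (\<Sum>k\<in>T. b k * c k e) * monom_fun e x)"
      unfolding sum_distrib_right by (rule sum.swap)
    finally show ?thesis using b by simp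
  qed
  \<comment> \<open>Multiplying the relation for \<open>k\<close> by the factors of all other
    \<open>k'\<close> makes the denominators common; the terms with \<open>u k\<close> cancel by
    linear dependence and those with \<open>s k\<close> remain.\<close>
  define Q where "Q = (\<lambda>x. \<Sum>k\<in>E. - b k * (\<Prod>k'\<in>E - {k}. y x - k') * (u k x * (y x - k) - s k x))"
  have QJ: "Q \<in> J" unfolding Q_def
    by (intro polyfun_ideal_sum[OF J] polyfun_idealD(4)[OF J] polyfuns_intros y)
       (use rel E in auto)
  have "Q x = (\<Sum>k\<in>E. b k * s k x * (\<Prod>k'\<in>E - {k}. y x - k'))" for x
  proof -
    have "(\<Sum>k\<in>E. b k * (\<Prod>k'\<in>E - {k}. y x - k') * (u k x * (y x - k)))
      = (\<Sum>k\<in>E. b k * u k x * (\<Prod>k'\<in>E. y x - k'))"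
      using E by (intro sum.cong) (auto simp: prod.remove)
    also have "\<dots> = 0" using rel0 by (simp flip: sum_distrib_right)
    finally have "(\<Sum>k\<in>E. b k * (\<Prod>k'\<in>E - {k}. y x - k') * (u k x * (y x - k))) = 0" .
    moreover have "Q x = (\<Sum>k\<in>E. b k * s k x * (\<Prod>k'\<in>E - {k}. y x - k'))
        - (\<Sum>k\<in>E. b k * (\<Prod>k'\<in>E - {k}. y x - k') * (u k x * (y x - k)))"
      unfolding Q_def sum_subtractf[symmetric] by (intro sum.cong) (auto simp: algebra_simps)
    ultimately show ?thesis by simp
  qed
  then have "Q = (\<lambda>x. \<Sum>k\<in>E. b k * s k x * (\<Prod>k'\<in>E - {k}. y x - k'))" by (rule ext)
  with QJ have "(\<lambda>x. \<Sum>k\<in>E. b k * s k x * (\<Prod>k'\<in>E - {k}. y x - k')) \<in> J" by simp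
  moreover have "b k \<noteq> 0" if "k \<in> E" for k using that by (simp add: E_def)
  ultimately show thesis using that[OF E] by blast
qed

text \<open>With \<open>s = 1\<close> the relation is the numerator of the partial fraction sum of
  a_\<kappa> / (y - \<kappa>). At each \<kappa> in \<open>E\<close> only its own term survives, so
  it is a nonzero polynomial in y.\<close>

lemma uncountable_inverses_polynomial:
  assumes J: "polyfun_ideal J" and y: "y \<in> polyfuns" and D: "uncountable D"
    and inv: "\<And>c. c \<in> D \<Longrightarrow> \<exists>u\<in>polyfuns. (\<lambda>x. u x * (y x - c) - 1) \<in> J"
  shows "\<exists>p. p \<noteq> 0 \<and> (\<lambda>x. poly p (y x)) \<in> J"
proof -
  have "\<forall>c\<in>D. \<exists>u. u \<in> polyfuns \<and> (\<lambda>x. u x * (y x - c) - 1) \<in> J" using inv by blast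
  then obtain u where u: "\<And>c. c \<in> D \<Longrightarrow> u c \<in> polyfuns"
    "\<And>c. c \<in> D \<Longrightarrow> (\<lambda>x. u c x * (y x - c) - 1) \<in> J"
    unfolding bchoice_iff by blast
  obtain E a where E: "finite E" "E \<noteq> {}" "\<And>k. k \<in> E \<Longrightarrow> a k \<noteq> 0"
    "(\<lambda>x. \<Sum>k\<in>E. a k * 1 * (\<Prod>k'\<in>E - {k}. y x - k')) \<in> J"
    by (rule uncountable_inverses_relation[OF J y D, of u "\<lambda>_ _. 1"]) (use u in auto)
  define p where "p = (\<Sum>k\<in>E. smult (a k) (\<Prod>k'\<in>E - {k}. [:- k', 1:]))"
  have polyp: "poly p z = (\<Sum>k\<in>E. a k * (\<Prod>k'\<in>E - {k}. z - k'))" for z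
    by (simp add: p_def poly_sum poly_prod)
  obtain k0 where k0: "k0 \<in> E" using E by blast
  have "poly p k0 = (\<Sum>k\<in>{k0}. a k * (\<Prod>k'\<in>E - {k}. k0 - k'))"
    unfolding polyp by (rule sum.mono_neutral_right) (use E(1) k0 in \<open>auto intro!: prod_zero\<close>)
  then have "poly p k0 \<noteq> 0" using E k0 by simp
  then have "p \<noteq> 0" by auto
  moreover have "(\<lambda>x. poly p (y x)) \<in> J" using E(4) by (simp add: polyp)
  ultimately show ?thesis by blast
qed

text \<open>Over \<complex> a nonzero polynomial splits into linear factors, and the product of
  their inverses inverts it.\<close>

lemma poly_invertible_mod:
  assumes J: "polyfun_ideal J" and y: "y \<in> polyfuns"
    and inv: "\<And>c. \<exists>u\<in>polyfuns. (\<lambda>x. u x * (y x - c) - 1) \<in> J"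
    and "p \<noteq> 0"
  shows "\<exists>v\<in>polyfuns. (\<lambda>x. v x * poly p (y x) - 1) \<in> J"
  using \<open>p \<noteq> 0\<close>
proof (induction "degree p" arbitrary: p)
  case 0
  then obtain c where "p = [:c:]" "c \<noteq> 0" by (metis degree_eq_zeroE pCons_0_0)
  then show ?case
    using polyfun_idealD(2)[OF J] by (intro bexI[of _ "\<lambda>_. 1 / c"]) (auto intro: polyfuns.intros)
next
  case (Suc n)
  then have "\<not> constant (poly p)" by (simp add: constant_degree)
  then obtain c where "poly p c = 0" using fundamental_theorem_of_algebra by blast
  then obtain q where q: "p = [:- c, 1:] * q" by (metis dvdE poly_eq_0_iff_dvd)
  with \<open>p \<noteq> 0\<close> have "q \<noteq> 0" by auto
  then have "degree p = Suc (degree q)" unfolding q by (subst degree_mult_eq) auto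
  then have "n = degree q" using Suc.hyps(2) by simp
  from Suc.hyps(1)[OF this \<open>q \<noteq> 0\<close>]
  obtain v where v: "v \<in> polyfuns" "(\<lambda>x. v x * poly q (y x) - 1) \<in> J" by blast
  obtain u where u: "u \<in> polyfuns" "(\<lambda>x. u x * (y x - c) - 1) \<in> J" using inv by blast
  \<comment> \<open>Uses v q u (y - c) - 1 = v q (u (y - c) - 1) + (v q - 1).\<close>
  have "(\<lambda>x. (v x * poly q (y x)) * (u x * (y x - c) - 1) + (v x * poly q (y x) - 1)) \<in> J"
    by (intro polyfun_idealD(3,4)[OF J] polyfuns_intros u v y)
  then have "(\<lambda>x. (v x * u x) * poly p (y x) - 1) \<in> J" by (simp add: q algebra_simps)
  then show ?case by (intro bexI[of _ "\<lambda>x. v x * u x"] polyfuns.mult u v)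
qed

text \<open>Otherwise every \<open>y - c\<close> would be invertible modulo \<open>J\<close>.
  Uncountably many inverses put some nonzero polynomial \<open>G\<close> in \<open>y\<close> into
  \<open>J\<close>, whereas \<open>G\<close> in \<open>y\<close> is a product of invertible
  elements; so 1 would lie in \<open>J\<close>.\<close>

lemma ideal_add_coordinate:
  assumes J: "polyfun_ideal J" and "(\<lambda>_. 1) \<notin> J" and y: "y \<in> polyfuns"
  shows "\<exists>c. (\<lambda>_. 1) \<notin> adjoin J (\<lambda>x. y x - c)"
proof (rule ccontr)
  assume "\<not> ?thesis"
  then have all: "(\<lambda>_. 1) \<in> adjoin J (\<lambda>x. y x - c)" for c by blast
  have inv: "\<exists>u\<in>polyfuns. (\<lambda>x. u x * (y x - c) - 1) \<in> J" for c
  proof -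
    obtain j u where ju: "j \<in> J" "u \<in> polyfuns" "(\<lambda>_. 1) = (\<lambda>x. j x + u x * (y x - c))"
      using all[of c] unfolding adjoin_def by blast
    have "(\<lambda>x. -1 * j x) \<in> J" by (intro polyfun_idealD(4)[OF J] ju polyfuns.const)
    moreover have "(\<lambda>x. -1 * j x) = (\<lambda>x. u x * (y x - c) - 1)"
    proof
      fix x show "-1 * j x = u x * (y x - c) - 1" using fun_cong[OF ju(3), of x] by algebra
    qed
    ultimately show ?thesis using ju(2) by metis
  qed
  obtain G where G: "G \<noteq> 0" "(\<lambda>x. poly G (y x)) \<in> J"
    using uncountable_inverses_polynomial[OF J y uncountable_UNIV_complex inv] by blast
  from poly_invertible_mod[OF J y inv G(1)] obtain v
    where v: "v \<in> polyfuns" "(\<lambda>x. v x * poly G (y x) - 1) \<in> J" by blast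
  have "(\<lambda>x. v x * poly G (y x) + -1 * (v x * poly G (y x) - 1)) \<in> J"
    by (intro polyfun_idealD(3,4)[OF J] polyfuns.const v G)
  then show False using assms(2) by simp
qed

text \<open>Coordinates receive values one at a time while the ideal stays proper. Modulo the final
  ideal every polynomial function is the constant f(c), so an element of \<open>J\<close> nonzero at
  \<open>c\<close> would put 1 into it.\<close>

theorem nullstellensatz:
  fixes J :: "(complex ^ 'k::finite \<Rightarrow> complex) set"
  assumes J: "polyfun_ideal J" and "(\<lambda>_. 1) \<notin> J"
  shows "\<exists>c. \<forall>f\<in>J. f c = 0"
proof -
  have "\<exists>J' c. J \<subseteq> J' \<and> polyfun_ideal J' \<and> (\<lambda>_. 1) \<notin> J' \<and> (\<forall>i\<in>I. (\<lambda>x. x $ i - c $ i) \<in> J')"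
    for I :: "'k set"
    using finite[of I]
  proof (induction I rule: finite_induct)
    case empty
    then show ?case using assms by auto
  next
    case (insert i I)
    then obtain J' c where *: "J \<subseteq> J'" "polyfun_ideal J'" "(\<lambda>_. 1) \<notin> J'"
      "\<And>i. i \<in> I \<Longrightarrow> (\<lambda>x. x $ i - c $ i) \<in> J'" by blast
    obtain b where b: "(\<lambda>_. 1) \<notin> adjoin J' (\<lambda>x. x $ i - b)"
      using ideal_add_coordinate[OF *(2,3) polyfuns.coord] by blast
    let ?J = "adjoin J' (\<lambda>x. x $ i - b)" and ?c = "\<chi> j. if j = i then b else c $ j"
    have "J' \<subseteq> ?J" by (rule adjoin_superset)
    moreover have "(\<lambda>x. x $ i - b) \<in> ?J" by (rule adjoin_self[OF *(2)])
    moreover have "polyfun_ideal ?J"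
      by (intro polyfun_ideal_adjoin * polyfuns_intros)
    ultimately show ?case using * b insert.hyps
      by (intro exI[of _ ?J] exI[of _ ?c] conjI) auto
  qed
  from this[of UNIV] obtain J' c where *: "J \<subseteq> J'" "polyfun_ideal J'" "(\<lambda>_. 1) \<notin> J'"
    "\<And>i. (\<lambda>x. x $ i - c $ i) \<in> J'" by auto
  have taylor: "(\<lambda>x. f x - f c) \<in> J'" if "f \<in> polyfuns" for f
    using that
  proof induction
    case (add f g)
    show ?case using polyfun_idealD(3)[OF *(2) add.IH] by (simp add: algebra_simps)
  next
    case (mult f g)
    have "(\<lambda>x. f x * (g x - g c) + g c * (f x - f c)) \<in> J'"
      by (intro polyfun_idealD(3,4)[OF *(2)] mult polyfuns.const)
    then show ?case by (simp add: algebra_simps)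
  qed (use * polyfun_idealD(2)[OF *(2)] in auto)
  have "f c = 0" if "f \<in> J" for f
  proof (rule ccontr)
    assume "f c \<noteq> 0"
    have "f \<in> J'" "f \<in> polyfuns" using that * polyfun_idealD(1)[OF J] by auto
    then have "(\<lambda>x. (1 / f c) * (f x + -1 * (f x - f c))) \<in> J'"
      by (intro polyfun_idealD(3,4)[OF *(2)] polyfuns.const taylor)
    with \<open>f c \<noteq> 0\<close> * show False by simp
  qed
  then show ?thesis by blast
qed

section \<open>Elimination on algebraic sets with bounded fibres\<close>

definition vanishing_ideal :: "(complex ^ 'k::finite) set \<Rightarrow> (complex ^ 'k \<Rightarrow> complex) set" where
  "vanishing_ideal X = {f \<in> polyfuns. \<forall>x\<in>X. f x = 0}"

lemma polyfun_ideal_vanishing_ideal: "polyfun_ideal (vanishing_ideal X)"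
  unfolding polyfun_ideal_def vanishing_ideal_def by (auto intro: polyfuns_intros)

definition zeros :: "(complex ^ 'k::finite \<Rightarrow> complex) set \<Rightarrow> (complex ^ 'k) set" where
  "zeros Q = {x. \<forall>f\<in>Q. f x = 0}"

text \<open>For large \<kappa> the set x_l = \<kappa> misses the part of \<open>X\<close> over the
  unit disc. By the Nullstellensatz all x_i - t with |t| < 1 are then invertible modulo J + (x_l -
  \<kappa>), which therefore contains a nonzero polynomial in x_i. As this holds for uncountably
  many \<kappa>, a linear relation among the cofactors eliminates everything but x_i and
  x_l.\<close>

theorem bounded_fibres_algebraic_relation:
  fixes X :: "(complex ^ 'k::finite) set"
  assumes X: "X = zeros Q" "Q \<subseteq> polyfuns"
    and bound: "\<And>x. x \<in> X \<Longrightarrow> cmod (x $ l) \<le> C * (1 + cmod (x $ i))"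
  obtains F where "F \<noteq> 0" "\<And>x. x \<in> X \<Longrightarrow> poly (poly2 F (x $ i)) (x $ l) = 0"
proof -
  define J where "J = vanishing_ideal X"
  have J: "polyfun_ideal J" unfolding J_def by (rule polyfun_ideal_vanishing_ideal)
  have QJ: "Q \<subseteq> J" using X by (auto simp: J_def vanishing_ideal_def zeros_def)
  \<comment> \<open>Over |t| < 1 the bound gives |x_l| \<le> 2 |C|, so no point of \<open>X\<close>
    there has x_l in \<open>D\<close>.\<close>
  define D where "D = {\<kappa>. cmod \<kappa> > 2 * \<bar>C\<bar>}"
  have unc: "uncountable D"
  proof -
    define b where "b = complex_of_real (2 * \<bar>C\<bar> + 1)"
    have "ball b 1 \<subseteq> D"
    proof
      fix x assume "x \<in> ball b 1"
      then have "cmod (b - x) < 1" by (simp add: dist_norm)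
      moreover have "cmod b = 2 * \<bar>C\<bar> + 1" unfolding b_def norm_of_real by simp
      moreover have "cmod b \<le> cmod (b - x) + cmod x" by (metis diff_add_cancel norm_triangle_ineq)
      ultimately show "x \<in> D" by (simp add: D_def)
    qed
    moreover have "uncountable (ball b 1)" by (rule uncountable_ball) simp
    ultimately show ?thesis using countable_subset by blast
  qed
  have step: "\<exists>p u. p \<noteq> 0 \<and> u \<in> polyfuns \<and> (\<lambda>x. u x * (x $ l - \<kappa>) - poly p (x $ i)) \<in> J"
    if "\<kappa> \<in> D" for \<kappa>
  proof -
    let ?J = "adjoin J (\<lambda>x. x $ l - \<kappa>)"
    have J': "polyfun_ideal ?J" by (intro polyfun_ideal_adjoin J polyfuns_intros)
    have "\<exists>u\<in>polyfuns. (\<lambda>x. u x * (x $ i - t) - 1) \<in> ?J" if t: "t \<in> ball 0 1" for t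
    proof -
      let ?J' = "adjoin ?J (\<lambda>x. x $ i - t)"
      have J'': "polyfun_ideal ?J'" by (intro polyfun_ideal_adjoin J' polyfuns_intros)
      have "(\<lambda>_. 1) \<in> ?J'"
      proof (rule ccontr)
        assume "(\<lambda>_. 1) \<notin> ?J'"
        then obtain c where c: "\<And>f. f \<in> ?J' \<Longrightarrow> f c = 0" using nullstellensatz[OF J''] by blast
        have sub: "J \<subseteq> ?J'" "?J \<subseteq> ?J'" using adjoin_superset by (blast intro: order.trans)+
        with QJ c have "c \<in> X" by (auto simp: X zeros_def)
        moreover have "c $ i = t" using c[OF adjoin_self[OF J']] by simp
        moreover have "c $ l = \<kappa>" using c[of "\<lambda>x. x $ l - \<kappa>"] adjoin_self[OF J] sub by auto
        ultimately have "cmod \<kappa> \<le> C * (1 + cmod t)" using bound by blast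
        also have "\<dots> \<le> \<bar>C\<bar> * 2" using t by (intro mult_mono) auto
        finally show False using \<open>\<kappa> \<in> D\<close> by (simp add: D_def)
      qed
      then obtain j u where ju: "j \<in> ?J" "u \<in> polyfuns" "(\<lambda>_. 1) = (\<lambda>x. j x + u x * (x $ i - t))"
        unfolding adjoin_def[of ?J] by blast
      have "(\<lambda>x. -1 * j x) \<in> ?J" by (intro polyfun_idealD(4)[OF J'] ju polyfuns.const)
      moreover have "(\<lambda>x. -1 * j x) = (\<lambda>x. u x * (x $ i - t) - 1)"
      proof
        fix x show "-1 * j x = u x * (x $ i - t) - 1" using fun_cong[OF ju(3), of x] by algebra
      qed
      ultimately show ?thesis using ju(2) by metis
    qed
    from uncountable_inverses_polynomial[OF J' polyfuns.coord uncountable_ball[OF zero_less_one] this]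
    obtain p where p: "p \<noteq> 0" "(\<lambda>x. poly p (x $ i)) \<in> ?J" by blast
    from p(2) obtain j v where jv: "j \<in> J" "v \<in> polyfuns"
      "(\<lambda>x. poly p (x $ i)) = (\<lambda>x. j x + v x * (x $ l - \<kappa>))" unfolding adjoin_def by blast
    have "(\<lambda>x. -1 * j x) \<in> J" by (intro polyfun_idealD(4)[OF J] jv polyfuns.const)
    moreover have "(\<lambda>x. -1 * j x) = (\<lambda>x. v x * (x $ l - \<kappa>) - poly p (x $ i))"
    proof
      fix x show "-1 * j x = v x * (x $ l - \<kappa>) - poly p (x $ i)" using fun_cong[OF jv(3), of x] by algebra
    qed
    ultimately have "(\<lambda>x. v x * (x $ l - \<kappa>) - poly p (x $ i)) \<in> J" by metis
    with jv p(1) show ?thesis by blast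
  qed
  then have "\<forall>\<kappa>\<in>D. \<exists>p u. p \<noteq> 0 \<and> u \<in> polyfuns \<and> (\<lambda>x. u x * (x $ l - \<kappa>) - poly p (x $ i)) \<in> J"
    by blast
  then obtain p u where pu: "\<And>\<kappa>. \<kappa> \<in> D \<Longrightarrow> p \<kappa> \<noteq> 0" "\<And>\<kappa>. \<kappa> \<in> D \<Longrightarrow> u \<kappa> \<in> polyfuns"
    "\<And>\<kappa>. \<kappa> \<in> D \<Longrightarrow> (\<lambda>x. u \<kappa> x * (x $ l - \<kappa>) - poly (p \<kappa>) (x $ i)) \<in> J"
    unfolding bchoice_iff by blast
  obtain E a where E: "finite E" "E \<noteq> {}" "E \<subseteq> D" "\<And>k. k \<in> E \<Longrightarrow> a k \<noteq> 0"
    "(\<lambda>x. \<Sum>k\<in>E. a k * poly (p k) (x $ i) * (\<Prod>k'\<in>E - {k}. x $ l - k')) \<in> J"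
    by (rule uncountable_inverses_relation[OF J polyfuns.coord unc,
            of u l "\<lambda>k x. poly (p k) (x $ i)"]) (use pu in auto)
  \<comment> \<open>The numerator of the sum of a_k p_k(t) / (y - k). At y = k0 it is a nonzero
    multiple of \<open>p k0\<close>, so it does not vanish.\<close>
  define F where "F = (\<Sum>k\<in>E. smult (smult (a k) (p k)) (\<Prod>k'\<in>E - {k}. [:- [:k':], 1:]))"
  have polyF: "poly F [:z:] = (\<Sum>k\<in>E. smult (a k) (p k) * (\<Prod>k'\<in>E - {k}. [:z - k':]))" for z
    by (simp add: F_def poly_sum poly_prod)
  obtain k0 where k0: "k0 \<in> E" using E by blast
  have "poly F [:k0:] = (\<Sum>k\<in>{k0}. smult (a k) (p k) * (\<Prod>k'\<in>E - {k}. [:k0 - k':]))"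
    unfolding polyF by (rule sum.mono_neutral_right) (use E(1) k0 in \<open>auto intro!: prod_zero\<close>)
  moreover have "p k0 \<noteq> 0" using pu(1) E(3) k0 by blast
  ultimately have "poly F [:k0:] \<noteq> 0" using E k0 by simp
  then have "F \<noteq> 0" by auto
  moreover have "poly (poly2 F (x $ i)) (x $ l) = 0" if "x \<in> X" for x
  proof -
    have "poly (poly2 F (x $ i)) (x $ l)
        = (\<Sum>k\<in>E. a k * poly (p k) (x $ i) * (\<Prod>k'\<in>E - {k}. x $ l - k'))"
      by (simp add: poly2_eq polyF poly_sum poly_prod mult.assoc)
    then show ?thesis using E(5) that by (simp add: J_def vanishing_ideal_def)
  qed
  ultimately show thesis by (rule that)
qed

section \<open>The holomorphic inverse function theorem\<close>

lemma norm_axis: "norm (axis i x :: 'a::real_normed_vector ^ 'n::finite) = norm x"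
  by (simp add: axis_def norm_vec_def L2_set_def if_distrib[of "\<lambda>x. norm x ^ 2"] cong: if_cong)

lemma bounded_linear_axis: "bounded_linear (axis i :: 'a::real_normed_vector \<Rightarrow> 'a ^ 'n::finite)"
  by (rule bounded_linear_intro[where K = 1])
     (auto simp: vec_eq_iff axis_def norm_vec_def L2_set_def if_distrib[of "\<lambda>x. norm x ^ 2"] cong: if_cong)

lemma has_derivative_vecI:
  fixes f :: "'b::real_normed_vector \<Rightarrow> 'a::real_normed_vector ^ 'n::finite"
  assumes "\<And>i. ((\<lambda>x. f x $ i) has_derivative (\<lambda>h. D h $ i)) F"
  shows "(f has_derivative D) F"
proof -
  have expand: "v = (\<Sum>i\<in>UNIV. axis i (v $ i))" for v :: "'a ^ 'n"
    by (simp add: vec_eq_iff axis_def if_distrib cong: if_cong)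
  have "((\<lambda>x. \<Sum>i\<in>UNIV. axis i (f x $ i)) has_derivative (\<lambda>h. \<Sum>i\<in>UNIV. axis i (D h $ i))) F"
    by (intro has_derivative_sum bounded_linear.has_derivative[OF bounded_linear_axis] assms)
  then show ?thesis by (simp flip: expand)
qed

lemma norm_vector_smult: "norm (c *s v) = norm c * norm v" for v :: "complex ^ 'k::finite"
proof -
  have "norm (c *s v) = L2_set (\<lambda>i. norm c * norm (v $ i)) UNIV"
    by (simp add: norm_vec_def norm_mult)
  also have "\<dots> = norm c * norm v"
    by (simp add: norm_vec_def L2_set_right_distrib)
  finally show ?thesis .
qed

lemma bounded_linear_smult_left: "bounded_linear (\<lambda>c. c *s (v :: complex ^ 'k::finite))"
  by (rule bounded_linear_intro[where K = "norm v"])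
     (auto simp: vec_eq_iff algebra_simps norm_vector_smult)

lemma norm_vec_le_sum: "norm v \<le> (\<Sum>i\<in>UNIV. norm (v $ i))"
  for v :: "'a::real_normed_vector ^ 'k::finite"
  unfolding norm_vec_def by (rule L2_set_le_sum) simp

section \<open>Restriction to complex lines and continuity of the derivative\<close>

lemma holomorphic_severalD:
  assumes "holomorphic_several f S" "x \<in> S"
  obtains D where "(f has_derivative D) (at x)" "\<And>c v. D (c *s v) = c * D v"
  using assms unfolding holomorphic_several_def by blast

lemma holomorphic_several_open: "holomorphic_several f S \<Longrightarrow> open S"
  by (simp add: holomorphic_several_def)

text \<open>Complex homogeneity of \<open>D\<close> makes the restriction to a complex line complex
  differentiable; one-variable function theory enters through this lemma.\<close>

lemma holomorphic_several_line:
  fixes f :: "complex ^ 'k::finite \<Rightarrow> complex"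
  assumes D: "(f has_derivative D) (at (y + s *s v))" "\<And>c v. D (c *s v) = c * D v"
  shows "((\<lambda>s. f (y + s *s v)) has_field_derivative D v) (at s)"
proof -
  have "((\<lambda>s. y + s *s v) has_derivative (\<lambda>h. h *s v)) (at s)"
    using has_derivative_add[OF has_derivative_const[of y]
        bounded_linear_imp_has_derivative[OF bounded_linear_smult_left[of v]]] by simp
  from has_derivative_compose[OF this D(1)]
  have "((\<lambda>s. f (y + s *s v)) has_derivative (\<lambda>h. D (h *s v))) (at s)" .
  moreover have "(\<lambda>h. D (h *s v)) = (*) (D v)" by (simp add: D(2) fun_eq_iff mult.commute)
  ultimately show ?thesis by (simp add: has_field_derivative_def)
qed

text \<open>Cauchy's inequality on complex lines bounds the derivative of the remainder of the
  first-order expansion at \<open>x\<close> by the remainder itself.\<close>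

lemma holomorphic_several_derivative_continuous:
  fixes f :: "complex ^ 'k::finite \<Rightarrow> complex"
  assumes f: "holomorphic_several f S" and x: "x \<in> S" and D: "(f has_derivative D) (at x)"
    and hom: "\<And>c v. D (c *s v) = c * D v" and "0 < \<epsilon>"
  shows "\<exists>\<delta>>0. ball x \<delta> \<subseteq> S \<and> (\<forall>y\<in>ball x \<delta>. \<forall>D'. (f has_derivative D') (at y) \<longrightarrow>
    (\<forall>v. cmod (D' v - D v) \<le> \<epsilon> * norm v))"
proof -
  obtain \<rho>1 where \<rho>1: "\<rho>1 > 0" "ball x \<rho>1 \<subseteq> S"
    using holomorphic_several_open[OF f] x open_contains_ball by blast
  have "\<exists>d>0. \<forall>y. norm (y - x) < d \<longrightarrow> norm (f y - f x - D (y - x)) \<le> \<epsilon> / 2 * norm (y - x)"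
    using D \<open>0 < \<epsilon>\<close> unfolding has_derivative_at_alt by (meson half_gt_zero)
  then obtain \<rho>2 where \<rho>2: "\<rho>2 > 0"
    "\<And>y. norm (y - x) < \<rho>2 \<Longrightarrow> norm (f y - f x - D (y - x)) \<le> \<epsilon> / 2 * norm (y - x)" by blast
  define \<rho> where "\<rho> = min \<rho>1 \<rho>2"
  have \<rho>: "\<rho> > 0" "ball x \<rho> \<subseteq> S"
    "\<And>y. norm (y - x) < \<rho> \<Longrightarrow> norm (f y - f x - D (y - x)) \<le> \<epsilon> / 2 * norm (y - x)"
    using \<rho>1 \<rho>2 by (auto simp: \<rho>_def subset_iff)
  have blD: "bounded_linear D" using D by (rule has_derivative_bounded_linear)
  have "cmod (D' v - D v) \<le> \<epsilon> * norm v"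
    if y: "y \<in> ball x (\<rho> / 2)" and D': "(f has_derivative D') (at y)" for y D' v
  proof (cases "v = 0")
    case True
    then show ?thesis
      using linear_0[OF bounded_linear.linear[OF has_derivative_bounded_linear[OF D']]]
        linear_0[OF bounded_linear.linear[OF blD]] by simp
  next
    case False
    \<comment> \<open>From y within \<rho>/2 of x the disc of radius \<open>r\<close> in direction
      \<open>v\<close> stays within \<rho> of x, and Cauchy's quotient of \<epsilon>/2 * \<rho> by r
      is exactly \<epsilon> times the norm of \<open>v\<close>.\<close>
    define r where "r = \<rho> / (2 * norm v)"
    have r: "r > 0" "r * norm v = \<rho> / 2" using \<rho>(1) False by (auto simp: r_def)
    have near: "norm (y + s *s v - x) < \<rho>" if "s \<in> cball 0 r" for s
    proof -
      have "norm (y + s *s v - x) \<le> norm (y - x) + norm s * norm v"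
        using norm_triangle_ineq[of "y - x" "s *s v"] by (simp add: norm_vector_smult algebra_simps)
      also have "norm s * norm v \<le> \<rho> / 2"
        unfolding r(2)[symmetric] using that by (intro mult_right_mono) auto
      also have "norm (y - x) < \<rho> / 2" using y by (simp add: dist_norm norm_minus_commute)
      finally show ?thesis by simp
    qed
    define g where "g = (\<lambda>s. f (y + s *s v) - f x - D (y + s *s v - x))"
    have g': "\<exists>c. (g has_field_derivative c - D v) (at s) \<and> (s = 0 \<longrightarrow> c = D' v)" if "s \<in> cball 0 r" for s
    proof -
      have "y + s *s v \<in> S" using near[OF that] \<rho>(2) by (auto simp: dist_norm norm_minus_commute)
      then obtain Ds where Ds: "(f has_derivative Ds) (at (y + s *s v))" "\<And>c v. Ds (c *s v) = c * Ds v"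
        using holomorphic_severalD[OF f] by blast
      have 1: "((\<lambda>s. f (y + s *s v)) has_field_derivative Ds v) (at s)"
        by (rule holomorphic_several_line[OF Ds])
      have "(D has_derivative D) (at ((y - x) + s *s v))"
        by (rule bounded_linear_imp_has_derivative[OF blD])
      from holomorphic_several_line[OF this hom]
      have "((\<lambda>s. D (y + s *s v - x)) has_field_derivative D v) (at s)" by (simp add: algebra_simps)
      from DERIV_diff[OF DERIV_diff[OF 1 DERIV_const[of "f x"]] this]
      have "(g has_field_derivative Ds v - D v) (at s)" unfolding g_def by simp
      moreover have "Ds = D'" if "s = 0" using Ds(1) D' that by (auto intro: has_derivative_unique)
      ultimately show ?thesis by blast
    qed
    have holg: "g holomorphic_on cball 0 r"
      unfolding holomorphic_on_def field_differentiable_def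
      using g' has_field_derivative_at_within by blast
    have "norm ((deriv ^^ 1) g 0) \<le> fact 1 * (\<epsilon> / 2 * \<rho>) / r ^ 1"
    proof (rule Cauchy_inequality)
      show "g holomorphic_on ball 0 r" using holg ball_subset_cball holomorphic_on_subset by blast
      show "continuous_on (cball 0 r) g" using holg by (rule holomorphic_on_imp_continuous_on)
      fix s :: complex assume "norm (0 - s) = r"
      then have *: "norm (y + s *s v - x) < \<rho>" by (intro near) simp
      then have "norm (g s) \<le> \<epsilon> / 2 * norm (y + s *s v - x)" unfolding g_def by (rule \<rho>(3))
      also have "\<dots> \<le> \<epsilon> / 2 * \<rho>" using * \<open>0 < \<epsilon>\<close> by (intro mult_left_mono) auto
      finally show "norm (g s) \<le> \<epsilon> / 2 * \<rho>" .
    qed fact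
    moreover have "deriv g 0 = D' v - D v" using g'[of 0] r(1) by (auto intro: DERIV_imp_deriv)
    moreover have "\<epsilon> / 2 * \<rho> / r = \<epsilon> * norm v" using \<rho>(1) False by (simp add: r_def)
    ultimately show ?thesis by simp
  qed
  moreover have "ball x (\<rho> / 2) \<subseteq> S" using \<rho>(1,2) by auto
  ultimately show ?thesis
    using \<rho>(1) by (intro exI[of _ "\<rho> / 2"]) auto
qed

lemma holomorphic_mapD:
  assumes "holomorphic_map G S" "x \<in> S"
  obtains D where "(G has_derivative D) (at x)" "\<And>c v. D (c *s v) = c *s D v"
proof -
  have "\<exists>D. ((\<lambda>x. G x $ j) has_derivative D) (at x) \<and> (\<forall>c v. D (c *s v) = c * D v)" for j
    using assms unfolding holomorphic_map_def holomorphic_several_def by blast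
  then obtain D where D: "\<And>j. ((\<lambda>x. G x $ j) has_derivative D j) (at x)"
    "\<And>j c v. D j (c *s v) = c * D j v" by metis
  show thesis
  proof
    show "(G has_derivative (\<lambda>h. \<chi> j. D j h)) (at x)"
      by (rule has_derivative_vecI) (simp add: D(1))
  qed (simp add: D(2) vec_eq_iff)
qed

lemma has_derivative_vecD:
  "(G has_derivative D) F \<Longrightarrow> ((\<lambda>x. G x $ j) has_derivative (\<lambda>h. D h $ j)) F"
  by (rule bounded_linear.has_derivative[OF bounded_linear_vec_nth])

lemma holomorphic_mapI:
  assumes "open S" "\<And>x. x \<in> S \<Longrightarrow> \<exists>D. (G has_derivative D) (at x) \<and> (\<forall>c v. D (c *s v) = c *s D v)"
  shows "holomorphic_map G S"
  unfolding holomorphic_map_def holomorphic_several_def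
proof (intro allI conjI ballI assms(1))
  fix j x assume "x \<in> S"
  then obtain D where "(G has_derivative D) (at x)" "\<forall>c v. D (c *s v) = c *s D v" using assms by blast
  then show "\<exists>D. ((\<lambda>x. G x $ j) has_derivative D) (at x) \<and> (\<forall>c v. D (c *s v) = c * D v)"
    by (intro exI[of _ "\<lambda>h. D h $ j"]) (simp add: has_derivative_vecD)
qed

text \<open>The real inverse function theorem asks for a continuous derivative, which for merely
  differentiable \<open>G\<close> comes from Cauchy's inequality; injectivity at \<open>x0\<close>
  suffices because source and target have equal dimension. The derivative of the inverse is complex
  linear as the inverse of a complex linear map. The last conclusion keeps the derivative injective
  near \<open>x0\<close>, which later yields transversality to nearby planes.\<close>

theorem holomorphic_inverse_function:
  fixes G :: "complex ^ 'k::finite \<Rightarrow> complex ^ 'k"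
  assumes G: "holomorphic_map G S" and "open S" and x0: "x0 \<in> S"
    and D0: "(G has_derivative D0) (at x0)" and inj: "\<And>v. D0 v = 0 \<Longrightarrow> v = 0"
  obtains U V \<Gamma> where "open U" "x0 \<in> U" "U \<subseteq> S" "open V" "homeomorphism U V G \<Gamma>"
    "holomorphic_map \<Gamma> V"
    "\<And>x D v. x \<in> U \<Longrightarrow> (G has_derivative D) (at x) \<Longrightarrow> D v = 0 \<Longrightarrow> v = 0"
proof -
  define D where "D = (\<lambda>x. frechet_derivative G (at x))"
  have D: "(G has_derivative D x) (at x)" if "x \<in> S" for x
    using holomorphic_mapD[OF G that] unfolding D_def
    by (metis differentiable_def frechet_derivative_works)
  have homD: "D x (c *s v) = c *s D x v" if "x \<in> S" for x c v
    using holomorphic_mapD[OF G that] D[OF that] has_derivative_unique by metis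
  define G' where "G' = (\<lambda>x. Blinfun (D x))"
  have G': "blinfun_apply (G' x) = D x" if "x \<in> S" for x
    unfolding G'_def by (rule bounded_linear_Blinfun_apply) (rule has_derivative_bounded_linear[OF D[OF that]])
  have cont: "continuous_on S G'"
  proof (rule continuous_at_imp_continuous_on, rule ballI)
    fix x assume x: "x \<in> S"
    show "isCont G' x" unfolding continuous_at_eps_delta
    proof (intro allI impI)
      fix e :: real assume "e > 0"
      define n where "n = real CARD('k)"
      \<comment> \<open>Each of the \<open>n\<close> components contributes at most \<epsilon>; the
        factor 2 makes the final inequality strict.\<close>
      define \<epsilon> where "\<epsilon> = e / (2 * n)"
      have "n > 0" by (simp add: n_def)
      then have "\<epsilon> > 0" using \<open>e > 0\<close> by (simp add: \<epsilon>_def)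
      have "\<exists>\<delta>>0. ball x \<delta> \<subseteq> S \<and> (\<forall>y\<in>ball x \<delta>. \<forall>v. cmod (D y v $ j - D x v $ j) \<le> \<epsilon> * norm v)" for j
      proof -
        have "\<exists>\<delta>>0. ball x \<delta> \<subseteq> S \<and> (\<forall>y\<in>ball x \<delta>. \<forall>D'. ((\<lambda>x. G x $ j) has_derivative D') (at y) \<longrightarrow>
            (\<forall>v. cmod (D' v - D x v $ j) \<le> \<epsilon> * norm v))"
          using G x \<open>\<epsilon> > 0\<close> homD[OF x] unfolding holomorphic_map_def
          by (intro holomorphic_several_derivative_continuous[of _ S] has_derivative_vecD D) auto
        then show ?thesis using has_derivative_vecD[OF D] by (meson subsetD)
      qed
      then obtain \<delta> where \<delta>: "\<And>j. \<delta> j > 0" "\<And>j. ball x (\<delta> j) \<subseteq> S"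
        "\<And>j y v. y \<in> ball x (\<delta> j) \<Longrightarrow> cmod (D y v $ j - D x v $ j) \<le> \<epsilon> * norm v" by metis
      define d where "d = Min (range \<delta>)"
      have "d > 0" using \<delta>(1) by (simp add: d_def)
      moreover have "dist (G' y) (G' x) < e" if "dist y x < d" for y
      proof -
        have y: "y \<in> ball x (\<delta> j)" for j
        proof -
          have "d \<le> \<delta> j" unfolding d_def by (rule Min_le) auto
          then show ?thesis using that by (simp add: dist_commute)
        qed
        then have "y \<in> S" using \<delta>(2) by blast
        have "norm (G' y - G' x) \<le> n * \<epsilon>"
        proof (rule norm_blinfun_bound)
          fix v
          have "norm (D y v - D x v) \<le> (\<Sum>j\<in>UNIV. norm ((D y v - D x v) $ j))" by (rule norm_vec_le_sum)
          also have "\<dots> \<le> (\<Sum>j\<in>(UNIV :: 'k set). \<epsilon> * norm v)" by (rule sum_mono) (simp add: \<delta>(3)[OF y])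
          finally show "norm (blinfun_apply (G' y - G' x) v) \<le> n * \<epsilon> * norm v"
            by (simp add: n_def blinfun.diff_left G' x \<open>y \<in> S\<close>)
        qed (use \<open>n > 0\<close> \<open>\<epsilon> > 0\<close> in simp)
        also have "n * \<epsilon> < e" using \<open>n > 0\<close> \<open>e > 0\<close> by (simp add: \<epsilon>_def)
        finally show ?thesis by (simp add: dist_norm)
      qed
      ultimately show "\<exists>d>0. \<forall>y. dist y x < d \<longrightarrow> dist (G' y) (G' x) < e" by blast
    qed
  qed
  have "D0 = D x0" using D0 D[OF x0] by (rule has_derivative_unique)
  have linD: "linear (D x0)" using D[OF x0] by (rule has_derivative_linear)
  then have "inj (D x0)" using inj \<open>D0 = D x0\<close> by (simp add: linear_injective_0)
  then obtain E where E: "linear E" "E \<circ> D x0 = id" using linear_injective_left_inverse[OF linD] by blast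
  have "blinfun_apply (Blinfun E) = E" using E(1)
    by (intro bounded_linear_Blinfun_apply) (simp add: linear_conv_bounded_linear)
  then have inv: "Blinfun E o\<^sub>L G' x0 = id_blinfun"
    using E(2) by (intro blinfun_eqI) (simp add: G'[OF x0] fun_eq_iff)
  obtain U V g g' where UV: "open U" "U \<subseteq> S" "x0 \<in> U" "open V" "G x0 \<in> V" "homeomorphism U V G g"
    "\<And>y. y \<in> V \<Longrightarrow> (g has_derivative (g' y)) (at y)"
    "\<And>y. y \<in> V \<Longrightarrow> g' y = inv (blinfun_apply (G' (g y)))"
    "\<And>y. y \<in> V \<Longrightarrow> bij (blinfun_apply (G' (g y)))"
    using inverse_function_theorem[OF \<open>open S\<close> _ cont x0 inv] D G' by metis
  have gV: "g y \<in> U" if "y \<in> V" for y using UV(6) that by (auto simp: homeomorphism_def)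
  have bij: "bij (D (g y))" "g' y = inv (D (g y))" if "y \<in> V" for y
    using UV(8,9)[OF that] G'[of "g y"] gV[OF that] UV(2) by auto
  show thesis
  proof
    show "holomorphic_map g V"
    proof (rule holomorphic_mapI[OF UV(4)])
      fix y assume y: "y \<in> V"
      have "g' y (c *s v) = c *s g' y v" for c v
      proof -
        have "D (g y) (c *s inv (D (g y)) v) = c *s v"
          using bij(1)[OF y] homD[of "g y"] gV[OF y] UV(2) by (auto simp: bij_is_surj surj_f_inv_f)
        then show ?thesis unfolding bij(2)[OF y] using bij(1)[OF y]
          by (metis bij_is_inj inv_f_f)
      qed
      then show "\<exists>D. (g has_derivative D) (at y) \<and> (\<forall>c v. D (c *s v) = c *s D v)" using UV(7)[OF y] by blast
    qed
    fix x Dx v assume x: "x \<in> U" and Dx: "(G has_derivative Dx) (at x)" "Dx v = 0"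
    have "Dx = D x" using Dx(1) D UV(2) x has_derivative_unique by blast
    moreover have "bij (D x)" using bij(1)[of "G x"] UV(6) x by (auto simp: homeomorphism_def)
    moreover have "D x 0 = 0" using D UV(2) x by (metis has_derivative_linear linear_0 subsetD)
    ultimately show "v = 0" using Dx(2) by (metis bij_is_inj injD)
  qed fact+
qed

section \<open>Sums of branches of an algebraic family over a line\<close>

lemma poly_poly2_polyfuns: "(\<lambda>x. poly (poly2 F (x $ i)) (x $ l)) \<in> polyfuns"
  by (induction F) (auto simp: map_poly_pCons intro!: polyfuns_intros)

lemma polyfuns_derivative:
  assumes "f \<in> polyfuns"
  shows "\<exists>D. (f has_derivative D) (at x) \<and> (\<forall>c v. D (c *s v) = c * D v)"
  using assms
proof induction
  case (const c)
  show ?case by (intro exI[of _ "\<lambda>_. 0"]) simp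
next
  case (coord i)
  show ?case
    by (intro exI[of _ "\<lambda>v. v $ i"]) (auto intro: bounded_linear_imp_has_derivative bounded_linear_vec_nth)
next
  case (add f g)
  then obtain D E where "(f has_derivative D) (at x)" "\<forall>c v. D (c *s v) = c * D v"
    "(g has_derivative E) (at x)" "\<forall>c v. E (c *s v) = c * E v" by blast
  then show ?case
    by (intro exI[of _ "\<lambda>h. D h + E h"]) (auto intro!: has_derivative_add simp: algebra_simps)
next
  case (mult f g)
  then obtain D E where *: "(f has_derivative D) (at x)" "\<forall>c v. D (c *s v) = c * D v"
    "(g has_derivative E) (at x)" "\<forall>c v. E (c *s v) = c * E v" by blast
  show ?case
    by (intro exI[of _ "\<lambda>h. f x * E h + D h * g x"] conjI has_derivative_mult *)
       (simp add: * algebra_simps)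
qed

lemma polyfuns_holomorphic: "f \<in> polyfuns \<Longrightarrow> open S \<Longrightarrow> holomorphic_several f S"
  unfolding holomorphic_several_def using polyfuns_derivative by blast

lemma polyfuns_holomorphic_compose:
  assumes "f \<in> polyfuns" "\<And>l. (\<lambda>t. \<rho> t $ l) holomorphic_on A"
  shows "(\<lambda>t. f (\<rho> t)) holomorphic_on A"
  using assms(1) by induction (auto intro!: holomorphic_intros assms(2))

lemma closed_zeros: "Q \<subseteq> polyfuns \<Longrightarrow> closed (zeros Q)"
proof -
  assume Q: "Q \<subseteq> polyfuns"
  have "zeros Q = (\<Inter>f\<in>Q. f -` {0})" by (auto simp: zeros_def)
  moreover have "closed (f -` {0})" if "f \<in> Q" for f
    using that Q polyfuns_continuous[of f UNIV] by (intro continuous_closed_vimage) (auto simp: continuous_on_eq_continuous_at)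
  ultimately show ?thesis by auto
qed

text \<open>The map \<open>\<Psi>\<close> below sends the family into the coordinate line of \<open>i\<close>, so its local inverse
  restricted to that line parametrises the family.\<close>

lemma local_parametrisation:
  fixes X :: "(complex ^ 'k::finite) set"
  assumes A: "\<And>x l. x \<in> X \<Longrightarrow> x $ i \<notin> S \<Longrightarrow> poly (poly2 (A l) (x $ i)) (x $ l) = 0 \<and>
      poly (pderiv (poly2 (A l) (x $ i))) (x $ l) \<noteq> 0"
    and S: "finite S" and x0: "x0 \<in> X" "x0 $ i \<notin> S"
  obtains U e \<rho> where "open U" "x0 \<in> U" "e > 0" "\<And>l. (\<lambda>t. \<rho> t $ l) holomorphic_on ball (x0 $ i) e"
    "\<And>t. t \<in> ball (x0 $ i) e \<Longrightarrow> \<rho> t $ i = t" "\<rho> (x0 $ i) = x0"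
    "\<And>x. x \<in> X \<inter> U \<Longrightarrow> x $ i \<in> ball (x0 $ i) e \<Longrightarrow> x = \<rho> (x $ i)"
proof -
  define f where "f = (\<lambda>l x. if l = i then x $ i else poly (poly2 (A l) (x $ i)) (x $ l))"
  define \<Psi> where "\<Psi> = (\<lambda>x. \<chi> l. f l x)"
  have f_poly: "f l \<in> polyfuns" for l
    by (cases "l = i") (auto simp: f_def poly_poly2_polyfuns intro: polyfuns_intros)
  have \<Psi>: "holomorphic_map \<Psi> UNIV"
    unfolding holomorphic_map_def by (simp add: \<Psi>_def polyfuns_holomorphic f_poly)
  obtain D0 where D0: "(\<Psi> has_derivative D0) (at x0)" "\<And>c v. D0 (c *s v) = c *s D0 v"
    using holomorphic_mapD[OF \<Psi>, of x0] by auto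
  \<comment> \<open>Row \<open>i\<close> of the derivative forces v_i = 0. Then row \<open>l\<close>
    reduces to v_l times the derivative of the polynomial from \<open>A l\<close> at a simple
    root.\<close>
  have "v = 0" if v: "D0 v = 0" for v
  proof -
    have line: "((\<lambda>s. f l (x0 + s *s v)) has_field_derivative 0) (at 0)" for l
    proof -
      have "((\<lambda>x. \<Psi> x $ l) has_derivative (\<lambda>h. D0 h $ l)) (at (x0 + 0 *s v))"
        using has_derivative_vecD[OF D0(1)] by simp
      from holomorphic_several_line[OF this] show ?thesis
        by (simp add: D0(2) v \<Psi>_def)
    qed
    have vi: "v $ i = 0"
    proof -
      have "((\<lambda>s. x0 $ i + s * v $ i) has_field_derivative v $ i) (at 0)"
        by (auto intro!: derivative_eq_intros)
      with line[of i] show ?thesis by (simp add: f_def) (metis DERIV_unique)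
    qed
    have "v $ l = 0" if "l \<noteq> i" for l
    proof -
      let ?p = "poly2 (A l) (x0 $ i)"
      have "((\<lambda>s. poly ?p (x0 $ l + s * v $ l)) has_field_derivative poly (pderiv ?p) (x0 $ l) * v $ l) (at 0)"
        by (rule DERIV_chain2[where f = "poly ?p"]) (auto intro!: derivative_eq_intros poly_DERIV)
      moreover have "((\<lambda>s. poly ?p (x0 $ l + s * v $ l)) has_field_derivative 0) (at 0)"
        using line[of l] that by (simp add: f_def vi)
      ultimately have "poly (pderiv ?p) (x0 $ l) * v $ l = 0" by (metis DERIV_unique)
      then show ?thesis using A[OF x0] by auto
    qed
    with vi show "v = 0" by (metis vec_eq_iff zero_index)
  qed
  from holomorphic_inverse_function[OF \<Psi> open_UNIV UNIV_I D0(1) this]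
  obtain U V \<Gamma> where UV: "open U" "x0 \<in> U" "open V" "homeomorphism U V \<Psi> \<Gamma>" "holomorphic_map \<Gamma> V"
    by metis
  \<comment> \<open>On \<open>X\<close> off \<open>S\<close> every component except the i-th is an
    equation satisfied there, so \<open>\<Psi> x\<close> records only x_i.\<close>
  have \<Psi>X: "\<Psi> x = axis i (x $ i)" if "x \<in> X" "x $ i \<notin> S" for x
    using A[OF that] by (simp add: \<Psi>_def f_def axis_def vec_eq_iff)
  define \<rho> where "\<rho> = (\<lambda>t. \<Gamma> (axis i t))"
  have cont: "continuous_on UNIV (axis i :: complex \<Rightarrow> complex ^ 'k)"
    by (intro linear_continuous_on bounded_linear_axis)
  have "open (axis i -` V \<inter> - S)"
    using UV(3) S by (intro open_Int open_vimage cont) (auto intro: finite_imp_closed)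
  moreover have "x0 $ i \<in> axis i -` V \<inter> - S"
  proof -
    have "\<Psi> x0 \<in> V" using UV(2,4) by (auto simp: homeomorphism_def)
    then show ?thesis using x0 \<Psi>X[OF x0] by simp
  qed
  ultimately obtain e where e: "e > 0" "ball (x0 $ i) e \<subseteq> axis i -` V \<inter> - S"
    using open_contains_ball by blast
  show thesis
  proof
    show "(\<lambda>t. \<rho> t $ l) holomorphic_on ball (x0 $ i) e" for l
    proof (rule holomorphic_onI)
      fix t assume "t \<in> ball (x0 $ i) e"
      then have "axis i t \<in> V" using e by blast
      define a where "a = (axis i 1 :: complex ^ 'k)"
      have ax: "axis i s = 0 + s *s a" for s by (simp add: a_def axis_def vec_eq_iff)
      have "holomorphic_several (\<lambda>x. \<Gamma> x $ l) V" using UV(5) by (simp add: holomorphic_map_def)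
      then obtain D where "((\<lambda>x. \<Gamma> x $ l) has_derivative D) (at (0 + t *s a))"
        "\<And>c v. D (c *s v) = c * D v"
        using holomorphic_severalD \<open>axis i t \<in> V\<close> unfolding ax[of t] by blast
      from holomorphic_several_line[OF this]
      have "((\<lambda>t. \<rho> t $ l) has_field_derivative D a) (at t)" unfolding \<rho>_def ax .
      then show "(\<lambda>t. \<rho> t $ l) field_differentiable at t within ball (x0 $ i) e"
        using field_differentiable_def field_differentiable_at_within by blast
    qed
    show "\<rho> t $ i = t" if "t \<in> ball (x0 $ i) e" for t
    proof -
      have "axis i t \<in> V" using e that by blast
      then have "\<Psi> (\<rho> t) = axis i t" using UV(4) by (simp add: homeomorphism_def \<rho>_def)
      then have "\<Psi> (\<rho> t) $ i = t" by (simp add: axis_def)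
      then show ?thesis by (simp add: \<Psi>_def f_def)
    qed
    show *: "x = \<rho> (x $ i)" if "x \<in> X \<inter> U" "x $ i \<in> ball (x0 $ i) e" for x
    proof -
      have "x $ i \<notin> S" using that e by blast
      then show ?thesis using UV(4) \<Psi>X[of x] that by (metis IntD1 IntD2 \<rho>_def homeomorphism_apply1)
    qed
    show "\<rho> (x0 $ i) = x0" using *[of x0] x0 UV(2) e(1) by simp
  qed fact+
qed

text \<open>Along a branch \<rho>, membership in \<open>X\<close> means that every f in
  \<open>Q\<close> vanishes. Either all f vanish identically along it, or some f does not and its
  zero at the centre is isolated: \<open>x0\<close> lies on a full branch, or is an isolated point
  of \<open>X\<close>.\<close>

lemma local_branch:
  fixes X :: "(complex ^ 'k::finite) set"
  assumes X: "X = zeros Q" "Q \<subseteq> polyfuns"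
    and A: "\<And>x l. x \<in> X \<Longrightarrow> x $ i \<notin> S \<Longrightarrow> poly (poly2 (A l) (x $ i)) (x $ l) = 0 \<and>
      poly (pderiv (poly2 (A l) (x $ i))) (x $ l) \<noteq> 0"
    and S: "finite S" and x0: "x0 \<in> X" "x0 $ i \<notin> S"
  obtains U e \<rho> where "open U" "x0 \<in> U" "e > 0" "\<And>l. (\<lambda>t. \<rho> t $ l) holomorphic_on ball (x0 $ i) e"
    "\<And>t. t \<in> ball (x0 $ i) e \<Longrightarrow> \<rho> t $ i = t" "\<rho> (x0 $ i) = x0"
    "\<And>x. x \<in> X \<inter> U \<Longrightarrow> x $ i \<in> ball (x0 $ i) e \<Longrightarrow> x = \<rho> (x $ i)"
    "(\<forall>t\<in>ball (x0 $ i) e. \<rho> t \<in> X) \<or> (\<forall>t\<in>ball (x0 $ i) e - {x0 $ i}. \<rho> t \<notin> X)"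
proof (rule local_parametrisation[OF A S x0])
  fix U e \<rho>
  assume *: "open U" "x0 \<in> U" "e > 0" "\<And>l. (\<lambda>t. \<rho> t $ l) holomorphic_on ball (x0 $ i) e"
    "\<And>t. t \<in> ball (x0 $ i) e \<Longrightarrow> \<rho> t $ i = t" "\<rho> (x0 $ i) = x0"
    "\<And>x. x \<in> X \<inter> U \<Longrightarrow> x $ i \<in> ball (x0 $ i) e \<Longrightarrow> x = \<rho> (x $ i)"
  show thesis
  proof (cases "\<forall>t\<in>ball (x0 $ i) e. \<rho> t \<in> X")
    case True
    then show thesis by (intro that[OF *]) blast+
  next
    case False
    then obtain f \<beta> where f: "f \<in> Q" "\<beta> \<in> ball (x0 $ i) e" "f (\<rho> \<beta>) \<noteq> 0"
      by (auto simp: X zeros_def)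
    have "f \<in> polyfuns" using f(1) X by blast
    have "f (\<rho> (x0 $ i)) = 0" using f(1) x0 by (simp add: *(6) X zeros_def)
    from isolated_zeros[OF polyfuns_holomorphic_compose[OF \<open>f \<in> polyfuns\<close> *(4)] open_ball connected_ball _ this f(2) f(3)]
    obtain r where r: "0 < r" "ball (x0 $ i) r \<subseteq> ball (x0 $ i) e"
      "\<And>t. t \<in> ball (x0 $ i) r - {x0 $ i} \<Longrightarrow> f (\<rho> t) \<noteq> 0" using *(3) centre_in_ball by metis
    have notX: "\<forall>t\<in>ball (x0 $ i) r - {x0 $ i}. \<rho> t \<notin> X"
      using r(3) f(1) unfolding X zeros_def by blast
    have hol: "(\<lambda>t. \<rho> t $ l) holomorphic_on ball (x0 $ i) r" for l
      using *(4) r(2) by (rule holomorphic_on_subset)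
    have uniq: "x = \<rho> (x $ i)" if "x \<in> X \<inter> U" "x $ i \<in> ball (x0 $ i) r" for x
      using *(7) that r(2) by blast
    have co: "\<rho> t $ i = t" if "t \<in> ball (x0 $ i) r" for t using *(5) that r(2) by blast
    show thesis by (rule that[OF *(1,2) r(1) hol co *(6) uniq]) (use notX in blast)+
  qed
qed

text \<open>The coordinates embed the fibre into the product of the root sets. Since the degree of
  \<open>poly2 (A l) t\<close> does not exceed that of \<open>A l\<close>, this later bounds the
  fibres uniformly in t.\<close>

lemma card_fibre_le:
  fixes T :: "(complex ^ 'k::finite) set"
  assumes A: "\<And>l. p l \<noteq> 0" "\<And>x l. x \<in> T \<Longrightarrow> poly (p l) (x $ l) = 0"
  shows "finite T" "card T \<le> (\<Prod>l\<in>UNIV. degree (p l))"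
proof -
  define R where "R = (\<lambda>l. {y. poly (p l) y = 0})"
  have fin: "finite (R l)" for l unfolding R_def by (rule poly_roots_finite[OF A(1)])
  have sub: "vec_nth ` T \<subseteq> PiE UNIV R" using A(2) by (auto simp: R_def PiE_def)
  have inj: "inj_on vec_nth T" by (simp add: inj_on_def vec_nth_inject)
  have finP: "finite (PiE UNIV R)" by (intro finite_PiE fin) simp
  then show "finite T" using sub inj by (meson finite_imageD finite_subset)
  have "card T = card (vec_nth ` T)" using inj by (simp add: card_image)
  also have "\<dots> \<le> card (PiE UNIV R)" using finP sub by (rule card_mono)
  also have "\<dots> = (\<Prod>l\<in>UNIV. card (R l))" by (simp add: card_PiE)
  also have "\<dots> \<le> (\<Prod>l\<in>UNIV. degree (p l))"
    unfolding R_def by (intro prod_mono) (simp add: card_poly_roots_bound A(1))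
  finally show "card T \<le> (\<Prod>l\<in>UNIV. degree (p l))" .
qed

text \<open>No point comes in from infinity: the part of \<open>X\<close> over the closed unit disc
  about \<open>t0\<close> that lies outside \<open>W\<close> is compact by the linear bound, so its
  projection is a compact set missing \<open>t0\<close>.\<close>

lemma fibres_upper_semicontinuous:
  fixes X :: "(complex ^ 'k::finite) set"
  assumes "closed X" and bound: "\<And>x l. x \<in> X \<Longrightarrow> cmod (x $ l) \<le> C * (1 + cmod (x $ i))"
    and "open W" and W: "\<And>x. x \<in> X \<Longrightarrow> x $ i = t0 \<Longrightarrow> x \<in> W"
  shows "\<forall>\<^sub>F t in nhds t0. \<forall>x\<in>X. x $ i = t \<longrightarrow> x \<in> W"
proof -
  define K where "K = X \<inter> {x. x $ i \<in> cball t0 1} - W"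
  have "closed K" unfolding K_def
    by (intro closed_Diff closed_Int assms(1,3) closed_vimage[of _ "\<lambda>x. x $ i", unfolded vimage_def]
        continuous_intros) auto
  moreover have "bounded K"
    unfolding bounded_iff
  proof (intro exI ballI)
    fix x assume x: "x \<in> K"
    have "norm x \<le> (\<Sum>l\<in>UNIV. norm (x $ l))" by (rule norm_vec_le_sum)
    also have "\<dots> \<le> (\<Sum>l\<in>(UNIV :: 'k set). \<bar>C\<bar> * (2 + cmod t0))"
    proof (rule sum_mono)
      fix l
      have "cmod (x $ l) \<le> C * (1 + cmod (x $ i))" using x bound by (simp add: K_def)
      also have "\<dots> \<le> \<bar>C\<bar> * (1 + cmod (x $ i))" by (intro mult_right_mono) auto
      also have "cmod (x $ i) \<le> cmod t0 + 1"
        using x norm_triangle_ineq2[of "x $ i" t0] by (simp add: K_def dist_norm norm_minus_commute)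
      finally show "cmod (x $ l) \<le> \<bar>C\<bar> * (2 + cmod t0)" by (simp add: mult_left_mono)
    qed
    finally show "norm x \<le> (\<Sum>l\<in>(UNIV :: 'k set). \<bar>C\<bar> * (2 + cmod t0))" .
  qed
  ultimately have "compact K" by (simp add: compact_eq_bounded_closed)
  then have "compact ((\<lambda>x. x $ i) ` K)" by (intro compact_continuous_image continuous_intros)
  then have "open (- (\<lambda>x. x $ i) ` K \<inter> ball t0 1)"
    by (intro open_Int open_Compl compact_imp_closed) auto
  moreover have "t0 \<in> - (\<lambda>x. x $ i) ` K \<inter> ball t0 1" using W by (auto simp: K_def)
  ultimately have "\<forall>\<^sub>F t in nhds t0. t \<in> - (\<lambda>x. x $ i) ` K \<inter> ball t0 1" by (rule eventually_nhds_in_open)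
  then show ?thesis by eventually_elim (auto simp: K_def)
qed

text \<open>Isolated points of \<open>X\<close> may occur in sporadic fibres and would spoil the continuity of the
  trace, hence the restriction to limit points.\<close>

definition trace_support :: "(complex ^ 'k::finite) set \<Rightarrow> 'k \<Rightarrow> complex \<Rightarrow> (complex ^ 'k) set" where
  "trace_support X i t = {x \<in> X. x $ i = t \<and> x islimpt X}"

text \<open>The i-th coordinate of \<rho>(s) is s, so points of the branch at other parameters are
  different and tend to \<rho>(t).\<close>

lemma branch_islimpt:
  fixes \<rho> :: "complex \<Rightarrow> complex ^ 'k::finite"
  assumes \<rho>: "\<And>l. (\<lambda>t. \<rho> t $ l) holomorphic_on ball t0 e" and i: "\<And>t. t \<in> ball t0 e \<Longrightarrow> \<rho> t $ i = t"
    and X: "\<And>t. t \<in> ball t0 e \<Longrightarrow> \<rho> t \<in> X" and t: "t \<in> ball t0 e"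
  shows "\<rho> t islimpt X"
proof -
  have cont: "continuous_on (ball t0 e) \<rho>"
  proof -
    have "continuous_on (ball t0 e) (\<lambda>t. \<chi> l. \<rho> t $ l)"
      by (intro continuous_on_vec_lambda holomorphic_on_imp_continuous_on \<rho>)
    then show ?thesis by simp
  qed
  show ?thesis unfolding islimpt_def
  proof (intro allI impI)
    fix T assume "\<rho> t \<in> T" "open T"
    define N where "N = \<rho> -` T \<inter> ball t0 e"
    have "open N" unfolding N_def using cont \<open>open T\<close> by (simp add: continuous_on_open_vimage Int_commute)
    moreover have "t \<in> N" using \<open>\<rho> t \<in> T\<close> t by (simp add: N_def)
    ultimately have "t islimpt N" by (intro interior_limit_point) (simp add: interior_open)
    then obtain s where "s \<in> N" "s \<noteq> t" unfolding islimpt_def by (metis UNIV_I open_UNIV)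
    then have "\<rho> s \<in> T" "s \<in> ball t0 e" "s \<noteq> t" by (auto simp: N_def)
    moreover from this have "\<rho> s \<noteq> \<rho> t" using i[of s] i[OF t] by metis
    ultimately show "\<exists>y\<in>X. y \<in> T \<and> y \<noteq> \<rho> t" using X i t by (intro bexI[of _ "\<rho> s"]) auto
  qed
qed

text \<open>Near \<open>t0\<close> no point of \<open>X\<close> escapes the neighbourhoods of the
  finitely many points over \<open>t0\<close>, so the trace is the sum of the full branches through
  them, a finite sum of holomorphic functions.\<close>

lemma trace_field_differentiable:
  fixes X :: "(complex ^ 'k::finite) set"
  assumes X: "X = zeros Q" "Q \<subseteq> polyfuns"
    and bound: "\<And>x l. x \<in> X \<Longrightarrow> cmod (x $ l) \<le> C * (1 + cmod (x $ i))"
    and A: "\<And>x l. x \<in> X \<Longrightarrow> x $ i \<notin> S \<Longrightarrow> poly (poly2 (A l) (x $ i)) (x $ l) = 0 \<and>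
      poly (pderiv (poly2 (A l) (x $ i))) (x $ l) \<noteq> 0"
    and A0: "\<And>l t. t \<notin> S \<Longrightarrow> poly2 (A l) t \<noteq> 0"
    and S: "finite S" and t0: "t0 \<notin> S"
  shows "(\<lambda>t. \<Sum>x\<in>trace_support X i t. x $ l) field_differentiable at t0"
proof -
  define F where "F = {x \<in> X. x $ i = t0}"
  have "finite F"
    by (rule card_fibre_le(1)[of "\<lambda>l. poly2 (A l) t0"]) (use A A0 t0 in \<open>auto simp: F_def\<close>)
  have "\<exists>U e \<rho>. open U \<and> x0 \<in> U \<and> e > 0 \<and> (\<forall>l. (\<lambda>t. \<rho> t $ l) holomorphic_on ball t0 e) \<and>
      (\<forall>t\<in>ball t0 e. \<rho> t $ i = t) \<and> \<rho> t0 = x0 \<and>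
      (\<forall>x\<in>X \<inter> U. x $ i \<in> ball t0 e \<longrightarrow> x = \<rho> (x $ i)) \<and>
      ((\<forall>t\<in>ball t0 e. \<rho> t \<in> X) \<or> (\<forall>t\<in>ball t0 e - {t0}. \<rho> t \<notin> X))" if "x0 \<in> F" for x0
  proof -
    have x0: "x0 \<in> X" "x0 $ i \<notin> S" "x0 $ i = t0" using that t0 by (auto simp: F_def)
    show ?thesis
    proof (rule local_branch[OF X A S x0(1,2)], unfold x0(3))
      fix U e \<rho>
      assume "open U" "x0 \<in> U" "e > 0" "\<And>l. (\<lambda>t. \<rho> t $ l) holomorphic_on ball t0 e"
        "\<And>t. t \<in> ball t0 e \<Longrightarrow> \<rho> t $ i = t" "\<rho> t0 = x0"
        "\<And>x. x \<in> X \<inter> U \<Longrightarrow> x $ i \<in> ball t0 e \<Longrightarrow> x = \<rho> (x $ i)"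
        "(\<forall>t\<in>ball t0 e. \<rho> t \<in> X) \<or> (\<forall>t\<in>ball t0 e - {t0}. \<rho> t \<notin> X)"
      then show ?thesis by (intro exI[of _ U] exI[of _ e] exI[of _ \<rho>] conjI) blast+
    qed
  qed
  then have "\<forall>x0\<in>F. \<exists>U e \<rho>. open U \<and> x0 \<in> U \<and> e > 0 \<and> (\<forall>l. (\<lambda>t. \<rho> t $ l) holomorphic_on ball t0 e) \<and>
      (\<forall>t\<in>ball t0 e. \<rho> t $ i = t) \<and> \<rho> t0 = x0 \<and>
      (\<forall>x\<in>X \<inter> U. x $ i \<in> ball t0 e \<longrightarrow> x = \<rho> (x $ i)) \<and>
      ((\<forall>t\<in>ball t0 e. \<rho> t \<in> X) \<or> (\<forall>t\<in>ball t0 e - {t0}. \<rho> t \<notin> X))" by blast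
  then obtain U e \<rho> where U: "\<And>x0. x0 \<in> F \<Longrightarrow> open (U x0)" "\<And>x0. x0 \<in> F \<Longrightarrow> x0 \<in> U x0"
    and e: "\<And>x0. x0 \<in> F \<Longrightarrow> e x0 > 0"
    and \<rho>: "\<And>x0 l. x0 \<in> F \<Longrightarrow> (\<lambda>t. \<rho> x0 t $ l) holomorphic_on ball t0 (e x0)"
      "\<And>x0 t. x0 \<in> F \<Longrightarrow> t \<in> ball t0 (e x0) \<Longrightarrow> \<rho> x0 t $ i = t" "\<And>x0. x0 \<in> F \<Longrightarrow> \<rho> x0 t0 = x0"
      "\<And>x0 x. x0 \<in> F \<Longrightarrow> x \<in> X \<inter> U x0 \<Longrightarrow> x $ i \<in> ball t0 (e x0) \<Longrightarrow> x = \<rho> x0 (x $ i)"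
    and dich: "\<And>x0. x0 \<in> F \<Longrightarrow> (\<forall>t\<in>ball t0 (e x0). \<rho> x0 t \<in> X) \<or> (\<forall>t\<in>ball t0 (e x0) - {t0}. \<rho> x0 t \<notin> X)"
    unfolding bchoice_iff by blast
  \<comment> \<open>The fibre points carrying a full branch; the others are isolated in
    \<open>X\<close> and drop out of the trace.\<close>
  define Full where "Full = {x0 \<in> F. \<forall>t\<in>ball t0 (e x0). \<rho> x0 t \<in> X}"
  have cover: "\<forall>\<^sub>F t in nhds t0. \<forall>x\<in>X. x $ i = t \<longrightarrow> x \<in> (\<Union>x0\<in>F. U x0)"
    by (rule fibres_upper_semicontinuous[OF _ bound]) (use U X closed_zeros in \<open>auto simp: F_def\<close>)
  have balls: "\<forall>\<^sub>F t in nhds t0. \<forall>x0\<in>F. t \<in> ball t0 (e x0)"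
    using \<open>finite F\<close> by (intro eventually_ball_finite ballI eventually_nhds_in_open) (auto simp: e)
  have diffs: "(\<lambda>t. \<rho> x0 t $ l) field_differentiable at t0" if "x0 \<in> F" for x0 l
    using \<rho>(1)[OF that, of l] e[OF that] by (auto intro: holomorphic_on_imp_differentiable_at)
  \<comment> \<open>Branches with distinct centres stay apart for t near \<open>t0\<close>, so that
    summing over the set of points counts each branch once.\<close>
  have "\<forall>\<^sub>F t in nhds t0. \<rho> x t \<noteq> \<rho> y t" if xy: "x \<in> F" "y \<in> F" "x \<noteq> y" for x y
  proof -
    obtain k where "x $ k \<noteq> y $ k" using xy(3) by (auto simp: vec_eq_iff)
    have "isCont (\<lambda>t. \<rho> x t $ k - \<rho> y t $ k) t0"
      by (intro continuous_intros field_differentiable_imp_continuous_at diffs xy)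
    then have "(\<lambda>t. \<rho> x t $ k - \<rho> y t $ k) \<midarrow>t0\<rightarrow> \<rho> x t0 $ k - \<rho> y t0 $ k" by (simp add: isCont_def)
    moreover have ne: "\<rho> x t0 $ k - \<rho> y t0 $ k \<noteq> 0" using \<open>x $ k \<noteq> y $ k\<close> by (simp add: \<rho>(3) xy)
    ultimately have "\<forall>\<^sub>F t in at t0. \<rho> x t $ k - \<rho> y t $ k \<noteq> 0"
      by (rule tendsto_imp_eventually_ne)
    with ne have "\<forall>\<^sub>F t in nhds t0. \<rho> x t $ k - \<rho> y t $ k \<noteq> 0"
      unfolding eventually_nhds_conv_at by blast
    then show ?thesis by eventually_elim auto
  qed
  then have "\<forall>\<^sub>F t in nhds t0. \<forall>x\<in>F. \<forall>y\<in>F. x \<noteq> y \<longrightarrow> \<rho> x t \<noteq> \<rho> y t"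
    using \<open>finite F\<close> by (intro eventually_ball_finite ballI) (auto intro: eventually_mono)
  with cover balls
  have ev: "\<forall>\<^sub>F t in nhds t0. (\<Sum>x\<in>trace_support X i t. x $ l) = (\<Sum>x0\<in>Full. \<rho> x0 t $ l)"
  proof eventually_elim
    case (elim t)
    have "trace_support X i t = (\<lambda>x0. \<rho> x0 t) ` Full"
    proof (intro equalityI subsetI)
      fix x assume "x \<in> trace_support X i t"
      then have x: "x \<in> X" "x $ i = t" "x islimpt X" by (auto simp: trace_support_def)
      then obtain x0 where x0: "x0 \<in> F" "x \<in> U x0" using elim(1) by blast
      have tb: "t \<in> ball t0 (e x0)" using elim(2) x0 by blast
      have x_eq: "x = \<rho> x0 t" using \<rho>(4)[of x0 x] x0 x tb by blast
      \<comment> \<open>Otherwise \<open>x\<close> would be the point over \<open>t0\<close> itself,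
        and any further point of \<open>X\<close> close to it would lie on the branch at a parameter
        other than \<open>t0\<close>, where the branch avoids \<open>X\<close>.\<close>
      have "x0 \<in> Full"
      proof (rule ccontr)
        assume "x0 \<notin> Full"
        then have notX: "\<rho> x0 s \<notin> X" if "s \<in> ball t0 (e x0)" "s \<noteq> t0" for s
          using dich[OF x0(1)] x0(1) that by (auto simp: Full_def)
        then have "t = t0" using x(1) x_eq tb by blast
        have op: "open (U x0 \<inter> {y. y $ i \<in> ball t0 (e x0)})"
          by (intro open_Int U x0(1) open_vimage[of _ "\<lambda>y. y $ i", unfolded vimage_def] continuous_intros) auto
        have mem: "x \<in> U x0 \<inter> {y. y $ i \<in> ball t0 (e x0)}" using x0 x tb by auto
        obtain y where "y \<in> X" "y \<in> U x0 \<inter> {y. y $ i \<in> ball t0 (e x0)}" "y \<noteq> x"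
          by (rule islimptE[OF x(3) mem op])
        then have y: "y \<in> X" "y \<in> U x0" "y $ i \<in> ball t0 (e x0)" "y \<noteq> x" by auto
        then have "y = \<rho> x0 (y $ i)" using \<rho>(4)[of x0 y] x0 by blast
        then show False using y notX[of "y $ i"] x_eq \<open>t = t0\<close> by metis
      qed
      with x_eq show "x \<in> (\<lambda>x0. \<rho> x0 t) ` Full" by blast
    next
      fix x assume "x \<in> (\<lambda>x0. \<rho> x0 t) ` Full"
      then obtain x0 where x0: "x0 \<in> F" "\<And>t. t \<in> ball t0 (e x0) \<Longrightarrow> \<rho> x0 t \<in> X" "x = \<rho> x0 t"
        by (auto simp: Full_def)
      have tb: "t \<in> ball t0 (e x0)" using elim(2) x0 by blast
      have "\<rho> x0 t islimpt X" by (rule branch_islimpt[OF \<rho>(1,2)[OF x0(1)] x0(2) tb])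
      then show "x \<in> trace_support X i t"
        using x0 tb \<rho>(2)[OF x0(1) tb] by (simp add: trace_support_def)
    qed
    moreover have "inj_on (\<lambda>x0. \<rho> x0 t) Full" using elim(3) by (auto simp: inj_on_def Full_def)
    ultimately show ?case by (simp add: sum.reindex)
  qed
  have "(\<lambda>t. \<Sum>x0\<in>Full. \<rho> x0 t $ l) field_differentiable at t0"
    by (intro field_differentiable_sum diffs) (auto simp: Full_def)
  then show ?thesis
    unfolding field_differentiable_def DERIV_cong_ev[OF refl ev refl] .
qed

text \<open>\<open>S\<close> may contain points of the ball, even 0, so the comparison with the
  \<open>g j\<close> is made off \<open>S\<close> and extended by continuity. The hypothesis
  \<open>fibre\<close> makes every point over the ball part of a branch, so none is lost by
  restricting to limit points.\<close>

theorem sum_of_branches_affine: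
  fixes X :: "(complex ^ 'k::finite) set" and g :: "'j \<Rightarrow> complex \<Rightarrow> complex ^ 'k"
  assumes X: "X = zeros Q" "Q \<subseteq> polyfuns"
    and bound: "\<And>x l. x \<in> X \<Longrightarrow> cmod (x $ l) \<le> C * (1 + cmod (x $ i))"
    and g: "\<And>j l. j \<in> J \<Longrightarrow> (\<lambda>t. g j t $ l) holomorphic_on ball 0 r"
    and fibre: "\<And>t. t \<in> ball 0 r \<Longrightarrow> {x \<in> X. x $ i = t} = (\<lambda>j. g j t) ` J"
    and inj: "\<And>t. t \<in> ball 0 r \<Longrightarrow> inj_on (\<lambda>j. g j t) J"
  obtains a b where "\<And>t. t \<in> ball 0 r \<Longrightarrow> (\<Sum>j\<in>J. g j t $ l) = a + b * t"
proof -
  have "\<exists>A S. finite S \<and> (\<forall>t. t \<notin> S \<longrightarrow> poly2 A t \<noteq> 0) \<and> (\<forall>x\<in>X. x $ i \<notin> S \<longrightarrow>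
      poly (poly2 A (x $ i)) (x $ k) = 0 \<and> poly (pderiv (poly2 A (x $ i))) (x $ k) \<noteq> 0)" for k
  proof -
    obtain F where F: "F \<noteq> 0" "\<And>x. x \<in> X \<Longrightarrow> poly (poly2 F (x $ i)) (x $ k) = 0"
      using bounded_fibres_algebraic_relation[OF X bound, of k] by blast
    show ?thesis
    proof (rule generically_simple_roots[OF F(1)])
      fix A S
      assume "finite S" "\<And>t. t \<notin> S \<Longrightarrow> poly2 A t \<noteq> 0"
        "\<And>t y. t \<notin> S \<Longrightarrow> poly (poly2 F t) y = 0 \<Longrightarrow>
           poly (poly2 A t) y = 0 \<and> poly (pderiv (poly2 A t)) y \<noteq> 0"
      then show ?thesis using F(2) by (intro exI[of _ A] exI[of _ S]) simp
    qed
  qed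
  then obtain A S' where A': "\<And>k. finite (S' k)" "\<And>k t. t \<notin> S' k \<Longrightarrow> poly2 (A k) t \<noteq> 0"
    "\<And>x k. x \<in> X \<Longrightarrow> x $ i \<notin> S' k \<Longrightarrow>
      poly (poly2 (A k) (x $ i)) (x $ k) = 0 \<and> poly (pderiv (poly2 (A k) (x $ i))) (x $ k) \<noteq> 0"
    by metis
  define S where "S = (\<Union>k. S' k)"
  have S: "finite S" using A'(1) by (simp add: S_def)
  have A: "poly (poly2 (A k) (x $ i)) (x $ k) = 0 \<and> poly (pderiv (poly2 (A k) (x $ i))) (x $ k) \<noteq> 0"
    if "x \<in> X" "x $ i \<notin> S" for x k using A'(3) that by (auto simp: S_def)
  have A0: "poly2 (A k) t \<noteq> 0" if "t \<notin> S" for k t using A'(2) that by (auto simp: S_def)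
  define f where "f = (\<lambda>t. \<Sum>x\<in>trace_support X i t. x $ l)"
  have holf: "f holomorphic_on (UNIV - S)"
    unfolding holomorphic_on_def f_def
    using trace_field_differentiable[OF X bound A A0 S] field_differentiable_at_within by blast
  \<comment> \<open>A bound for the number of fibre points that does not depend on t: specialising
    cannot raise degrees.\<close>
  define N where "N = real (\<Prod>k\<in>UNIV. degree (A k))"
  have f_le: "cmod (f t) \<le> N * \<bar>C\<bar> * (1 + cmod t)" if "t \<notin> S" for t
  proof -
    have card: "card (trace_support X i t) \<le> (\<Prod>k\<in>UNIV. degree (poly2 (A k) t))"
      by (rule card_fibre_le(2)) (use A A0 that in \<open>auto simp: trace_support_def\<close>)
    also have "\<dots> \<le> (\<Prod>k\<in>UNIV. degree (A k))"
      by (intro prod_mono) (auto intro!: degree_le simp: coeff_map_poly coeff_eq_0)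
    finally have card: "real (card (trace_support X i t)) \<le> N" unfolding N_def by linarith
    have "cmod (f t) \<le> (\<Sum>x\<in>trace_support X i t. \<bar>C\<bar> * (1 + cmod t))"
      unfolding f_def
    proof (rule sum_norm_le)
      fix x assume "x \<in> trace_support X i t"
      then have "cmod (x $ l) \<le> C * (1 + cmod t)" using bound by (auto simp: trace_support_def)
      also have "\<dots> \<le> \<bar>C\<bar> * (1 + cmod t)" by (intro mult_right_mono) auto
      finally show "cmod (x $ l) \<le> \<bar>C\<bar> * (1 + cmod t)" .
    qed
    also have "\<dots> = real (card (trace_support X i t)) * (\<bar>C\<bar> * (1 + cmod t))" by simp
    also have "\<dots> \<le> N * (\<bar>C\<bar> * (1 + cmod t))" using card by (intro mult_right_mono) auto
    finally show ?thesis by (simp add: mult.assoc)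
  qed
  have "N \<ge> 0" by (simp add: N_def prod_nonneg)
  have "\<exists>h. h holomorphic_on UNIV \<and> (\<forall>z\<in>UNIV - S. h z = f z)"
  proof (rule removable_singularities[OF S _ holf])
    fix s assume "s \<in> S"
    have "open (- (S - {s}) \<inter> ball s 1)" using S by (intro open_Int open_Compl finite_imp_closed) auto
    then have "\<forall>\<^sub>F t in nhds s. t \<in> - (S - {s}) \<inter> ball s 1" by (rule eventually_nhds_in_open) simp
    then have "\<forall>\<^sub>F t in at s. t \<in> - (S - {s}) \<inter> ball s 1 \<and> t \<noteq> s"
      unfolding eventually_at_filter by eventually_elim auto
    then have "\<forall>\<^sub>F t in at s. norm (f t) \<le> (N * \<bar>C\<bar> * (2 + cmod s)) * norm (1 :: complex)"
    proof eventually_elim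
      case (elim t)
      then have "cmod (f t) \<le> N * \<bar>C\<bar> * (1 + cmod t)" by (intro f_le) auto
      also have "\<dots> \<le> N * \<bar>C\<bar> * (2 + cmod s)"
      proof (intro mult_left_mono)
        show "1 + cmod t \<le> 2 + cmod s"
          using elim norm_triangle_ineq2[of t s] by (auto simp: dist_norm norm_minus_commute)
      qed (use \<open>N \<ge> 0\<close> in simp)
      finally show ?case by simp
    qed
    then show "f \<in> O[at s](\<lambda>_. 1)" by (rule bigoI)
  qed auto
  then obtain h where h: "h holomorphic_on UNIV" "\<And>z. z \<notin> S \<Longrightarrow> h z = f z" by blast
  obtain R where R: "\<And>s. s \<in> S \<Longrightarrow> cmod s \<le> R"
    using finite_imp_bounded[OF S] unfolding bounded_iff by blast
  \<comment> \<open>The radius |R| + 1 keeps z off \<open>S\<close> and ensures 1 \<le> |z|, which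
    bounds 1 + |z| by 2 |z|.\<close>
  have "cmod (h z) \<le> (2 * N * \<bar>C\<bar>) * cmod z ^ 1" if z: "\<bar>R\<bar> + 1 \<le> cmod z" for z
  proof -
    have "z \<notin> S" using R z by force
    then have "cmod (h z) \<le> N * \<bar>C\<bar> * (1 + cmod z)" using h f_le by simp
    also have "\<dots> \<le> N * \<bar>C\<bar> * (2 * cmod z)" using z \<open>N \<ge> 0\<close> by (intro mult_left_mono) auto
    finally show ?thesis by (simp add: mult_ac)
  qed
  then have Liou: "h z = (\<Sum>k\<le>1. (deriv ^^ k) h 0 / fact k * z ^ k)" for z
    by (rule Liouville_polynomial[OF h(1)])
  have h_eq: "h z = h 0 + deriv h 0 * z" for z
    by (subst Liou) simp
  have eq_off: "(\<Sum>j\<in>J. g j t $ l) = h t" if t: "t \<in> ball 0 r - S" for t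
  proof -
    have "{x \<in> X. x $ i = t} \<subseteq> {x. x islimpt X}"
    proof
      fix x assume "x \<in> {x \<in> X. x $ i = t}"
      then obtain j where j: "j \<in> J" "x = g j t" using fibre[of t] t by auto
      obtain e where e: "e > 0" "ball t e \<subseteq> ball 0 r" using t openE[OF open_ball, of t 0 r] by auto
      have gX: "g j s \<in> X \<and> g j s $ i = s" if "s \<in> ball 0 r" for s using fibre[OF that] j by blast
      have "g j t islimpt X"
      proof (rule branch_islimpt[of "g j" t e i])
        show "(\<lambda>s. g j s $ k) holomorphic_on ball t e" for k
          using g[OF j(1)] e(2) by (rule holomorphic_on_subset)
      qed (use e gX in auto)
      then show "x \<in> {x. x islimpt X}" using j by simp
    qed
    then have "trace_support X i t = (\<lambda>j. g j t) ` J" using fibre[of t] t by (auto simp: trace_support_def)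
    then have "f t = (\<Sum>j\<in>J. g j t $ l)" using inj[of t] t by (simp add: f_def sum.reindex)
    then show ?thesis using h(2) t by simp
  qed
  have "(\<Sum>j\<in>J. g j t $ l) = h t" if t: "t \<in> ball 0 r" for t
  proof -
    define u where "u = (\<lambda>t. (\<Sum>j\<in>J. g j t $ l) - h t)"
    have "u holomorphic_on ball 0 r" unfolding u_def
      by (intro holomorphic_intros g holomorphic_on_subset[OF h(1)]) auto
    then have "isCont u t" using t by (meson continuous_on_eq_continuous_at holomorphic_on_imp_continuous_on open_ball)
    then have "u \<midarrow>t\<rightarrow> u t" by (simp add: isCont_def)
    moreover have "\<forall>\<^sub>F s in at t. u s = 0"
    proof -
      have "open (ball 0 r - (S - {t}))" using S by (intro open_Diff finite_imp_closed) auto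
      then have "\<forall>\<^sub>F s in nhds t. s \<in> ball 0 r - (S - {t})" by (rule eventually_nhds_in_open) (use t in simp)
      then show ?thesis unfolding eventually_at_filter
        by eventually_elim (use eq_off in \<open>auto simp: u_def\<close>)
    qed
    ultimately have "u t = 0"
      using tendsto_unique[OF trivial_limit_at[of t] _ tendsto_eventually[of u 0 "at t"]] by blast
    then show ?thesis by (simp add: u_def)
  qed
  then have "(\<Sum>j\<in>J. g j t $ l) = h 0 + deriv h 0 * t" if "t \<in> ball 0 r" for t
    using that by (simp flip: h_eq)
  then show thesis by (rule that)
qed

section \<open>Transversal sections of submanifolds by planes\<close>

lemma holomorphic_several_compose:
  assumes f: "holomorphic_several f T" and g: "holomorphic_map g S" "open S" "g ` S \<subseteq> T"
  shows "holomorphic_several (\<lambda>x. f (g x)) S"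
  unfolding holomorphic_several_def
proof (intro conjI ballI g(2))
  fix x assume x: "x \<in> S"
  obtain D where D: "(g has_derivative D) (at x)" "\<And>c v. D (c *s v) = c *s D v"
    using holomorphic_mapD[OF g(1) x] by blast
  have "g x \<in> T" using x g(3) by blast
  then obtain E where E: "(f has_derivative E) (at (g x))" "\<And>c v. E (c *s v) = c * E v"
    using holomorphic_severalD[OF f] by blast
  show "\<exists>D. ((\<lambda>x. f (g x)) has_derivative D) (at x) \<and> (\<forall>c v. D (c *s v) = c * D v)"
    using has_derivative_compose[OF D(1) E(1)] D(2) E(2) by (intro exI[of _ "\<lambda>h. E (D h)"]) simp
qed

lemma holomorphic_map_compose:
  assumes "holomorphic_map f T" "holomorphic_map g S" "open S" "g ` S \<subseteq> T"
  shows "holomorphic_map (\<lambda>x. f (g x)) S"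
  using assms holomorphic_several_compose unfolding holomorphic_map_def by blast

lemma holomorphic_several_coord: "open S \<Longrightarrow> holomorphic_several (\<lambda>x. x $ i) S"
  unfolding holomorphic_several_def
  by (auto intro!: exI[of _ "\<lambda>v. v $ i"] bounded_linear_imp_has_derivative bounded_linear_vec_nth)

lemma holomorphic_several_add:
  assumes "holomorphic_several f S" "holomorphic_several g S"
  shows "holomorphic_several (\<lambda>x. f x + g x) S"
  unfolding holomorphic_several_def
proof (intro conjI ballI)
  show "open S" using assms(1) by (rule holomorphic_several_open)
  fix x assume x: "x \<in> S"
  obtain D where D: "(f has_derivative D) (at x)" "\<And>c v. D (c *s v) = c * D v"
    using holomorphic_severalD[OF assms(1) x] by blast
  obtain E where E: "(g has_derivative E) (at x)" "\<And>c v. E (c *s v) = c * E v"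
    using holomorphic_severalD[OF assms(2) x] by blast
  show "\<exists>D. ((\<lambda>x. f x + g x) has_derivative D) (at x) \<and> (\<forall>c v. D (c *s v) = c * D v)"
    using has_derivative_add[OF D(1) E(1)] D(2) E(2)
    by (intro exI[of _ "\<lambda>h. D h + E h"]) (simp add: algebra_simps)
qed

lemma holomorphic_several_mult:
  assumes "holomorphic_several f S" "holomorphic_several g S"
  shows "holomorphic_several (\<lambda>x. f x * g x) S"
  unfolding holomorphic_several_def
proof (intro conjI ballI)
  show "open S" using assms(1) by (rule holomorphic_several_open)
  fix x assume x: "x \<in> S"
  obtain D where D: "(f has_derivative D) (at x)" "\<And>c v. D (c *s v) = c * D v"
    using holomorphic_severalD[OF assms(1) x] by blast
  obtain E where E: "(g has_derivative E) (at x)" "\<And>c v. E (c *s v) = c * E v"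
    using holomorphic_severalD[OF assms(2) x] by blast
  show "\<exists>D. ((\<lambda>x. f x * g x) has_derivative D) (at x) \<and> (\<forall>c v. D (c *s v) = c * D v)"
  proof (intro exI conjI allI)
    show "((\<lambda>x. f x * g x) has_derivative (\<lambda>h. f x * E h + D h * g x)) (at x)"
      by (rule has_derivative_mult[OF D(1) E(1)])
  qed (simp add: D E algebra_simps)
qed

lemma holomorphic_several_const: "open S \<Longrightarrow> holomorphic_several (\<lambda>x. c) S"
  unfolding holomorphic_several_def by (auto intro!: exI[of _ "\<lambda>_. 0"])

lemma holomorphic_several_diff:
  assumes "holomorphic_several f S" "holomorphic_several g S"
  shows "holomorphic_several (\<lambda>x. f x - g x) S"
  using holomorphic_several_add[OF assms(1) holomorphic_several_mult[OF
      holomorphic_several_const[OF holomorphic_several_open[OF assms(2)], of "-1"] assms(2)]] by simp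

lemma holomorphic_several_sum:
  "open S \<Longrightarrow> (\<And>i. i \<in> I \<Longrightarrow> holomorphic_several (f i) S) \<Longrightarrow> holomorphic_several (\<lambda>x. \<Sum>i\<in>I. f i x) S"
  by (induction I rule: infinite_finite_induct)
     (auto intro: holomorphic_several_const holomorphic_several_add)

lemma holomorphic_several_subset:
  "holomorphic_several f S \<Longrightarrow> open T \<Longrightarrow> T \<subseteq> S \<Longrightarrow> holomorphic_several f T"
  unfolding holomorphic_several_def by blast

lemma holomorphic_map_subset:
  "holomorphic_map f S \<Longrightarrow> open T \<Longrightarrow> T \<subseteq> S \<Longrightarrow> holomorphic_map f T"
  unfolding holomorphic_map_def using holomorphic_several_subset by blast

lemma holomorphic_map_open: "holomorphic_map f S \<Longrightarrow> open S"
  unfolding holomorphic_map_def using holomorphic_several_open by blast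

lemma holomorphic_map_continuous_at:
  assumes "holomorphic_map f S" "x \<in> S" shows "isCont f x"
  using holomorphic_mapD[OF assms] has_derivative_continuous by metis

lemma holomorphic_map_linear:
  assumes "bounded_linear L" "\<And>c v. L (c *s v) = c *s L v" "open S"
  shows "holomorphic_map L S"
  using assms by (intro holomorphic_mapI) (auto intro: bounded_linear_imp_has_derivative)

lemma bounded_linear_vecI:
  fixes L :: "'n::euclidean_space \<Rightarrow> complex ^ 'm::finite"
  assumes "\<And>x y. L (x + y) = L x + L y" "\<And>c x. L (c *\<^sub>R x) = c *\<^sub>R L x"
  shows "bounded_linear L"
  unfolding linear_conv_bounded_linear[symmetric] by (rule linearI) (rule assms)+

text \<open>Planes become fibres of a linear map, with direction its kernel; transversality of a
  submanifold to the plane is then surjectivity of this map on the tangent space.\<close>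

definition plane_map ::
  "complex ^ ('a \<times> 'b) \<Rightarrow> complex ^ ('a::finite + 'b::finite) \<Rightarrow> complex ^ 'a" where
  "plane_map \<alpha> \<zeta> = (\<chi> k. \<zeta> $ Inl k - (\<Sum>r\<in>UNIV. \<alpha> $ (k, r) * \<zeta> $ Inr r))"

lemma affine_plane_eq: "affine_plane \<alpha> \<beta> = {\<zeta>. plane_map \<alpha> \<zeta> = \<beta>}"
  by (auto simp: affine_plane_def plane_map_def vec_eq_iff algebra_simps)

lemma bounded_linear_plane_map: "bounded_linear (plane_map \<alpha>)"
  by (rule bounded_linear_vecI)
     (auto simp: plane_map_def vec_eq_iff algebra_simps sum.distrib scaleR_right_diff_distrib
       scaleR_sum_right)

text \<open>Holomorphy is defined on spaces \<open>complex ^ 'i\<close>, so a pair (\<alpha>,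
  \<beta>) of parameters is stored as one vector over the sum of the index types.\<close>

definition join :: "complex ^ 'c \<Rightarrow> complex ^ 'd \<Rightarrow> complex ^ ('c::finite + 'd::finite)" where
  "join x y = (\<chi> i. case i of Inl u \<Rightarrow> x $ u | Inr k \<Rightarrow> y $ k)"

definition part_l :: "complex ^ ('c::finite + 'd::finite) \<Rightarrow> complex ^ 'c" where
  "part_l z = (\<chi> u. z $ Inl u)"

definition part_r :: "complex ^ ('c::finite + 'd::finite) \<Rightarrow> complex ^ 'd" where
  "part_r z = (\<chi> u. z $ Inr u)"

lemma part_join [simp]: "part_l (join x y) = x" "part_r (join x y) = y" "join (part_l z) (part_r z) = z"
  by (auto simp: part_l_def part_r_def join_def vec_eq_iff split: sum.split)

lemma join_nth [simp]: "join x y $ Inl u = x $ u" "join x y $ Inr k = y $ k"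
  by (simp_all add: join_def)

lemma join_eq_iff [simp]: "join x y = join x' y' \<longleftrightarrow> x = x' \<and> y = y'"
  by (metis part_join(1,2))

lemma join_0 [simp]: "join 0 0 = 0"
  by (simp add: join_def vec_eq_iff split: sum.split)

lemma join_add: "join x y + join x' y' = join (x + x') (y + y')"
  by (simp add: join_def vec_eq_iff split: sum.split)

lemma join_diff: "join x y - join x' y' = join (x - x') (y - y')"
  by (simp add: join_def vec_eq_iff split: sum.split)

lemma scaleR_join: "c *\<^sub>R join x y = join (c *\<^sub>R x) (c *\<^sub>R y)"
  by (simp add: join_def vec_eq_iff split: sum.split)

lemma smult_join: "c *s join x y = join (c *s x) (c *s y)"
  by (simp add: join_def vec_eq_iff split: sum.split)

lemma bounded_linear_part: "bounded_linear part_l" "bounded_linear part_r"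
  by (auto intro!: bounded_linear_vecI simp: part_l_def part_r_def vec_eq_iff)

lemma bounded_linear_join: "bounded_linear (\<lambda>y. join 0 y)" "bounded_linear (\<lambda>x. join x 0)"
  by (auto intro!: bounded_linear_vecI simp: join_def vec_eq_iff split: sum.split)

lemma sum_UNIV_Plus:
  fixes f :: "'c::finite + 'd::finite \<Rightarrow> 'e::comm_monoid_add"
  shows "(\<Sum>i\<in>UNIV. f i) = (\<Sum>u\<in>UNIV. f (Inl u)) + (\<Sum>k\<in>UNIV. f (Inr k))"
  by (simp add: UNIV_Plus_UNIV[symmetric] sum.Plus o_def del: UNIV_Plus_UNIV)

lemma norm_join_left: "norm (join x 0) = norm x"
  by (simp add: norm_vec_def L2_set_def sum_UNIV_Plus)

lemma norm_join_right: "norm (join 0 y) = norm y"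
  by (simp add: norm_vec_def L2_set_def sum_UNIV_Plus)

lemma norm_join_le: "norm (join x y) \<le> norm x + norm y"
  using norm_triangle_ineq[of "join x 0" "join 0 y"]
  by (simp add: join_add norm_join_left norm_join_right)

section \<open>Tangent spaces of planes and of submanifolds\<close>

lemma tangent_vectors_affine_plane:
  assumes "p \<in> affine_plane \<alpha> \<beta>"
  shows "tangent_vectors (affine_plane \<alpha> \<beta>) p = {v. plane_map \<alpha> v = 0}"
proof (intro equalityI subsetI)
  fix v assume "v \<in> tangent_vectors (affine_plane \<alpha> \<beta>) p"
  then obtain c :: "real \<Rightarrow> _" where c: "\<forall>\<^sub>F t in nhds 0. plane_map \<alpha> (c t) = \<beta>"
    "(c has_vector_derivative v) (at 0)" by (auto simp: tangent_vectors_def affine_plane_eq)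
  have "((\<lambda>t. plane_map \<alpha> (c t)) has_vector_derivative plane_map \<alpha> v) (at 0)"
    by (rule bounded_linear.has_vector_derivative[OF bounded_linear_plane_map c(2)])
  moreover have "((\<lambda>t. plane_map \<alpha> (c t)) has_vector_derivative 0) (at 0)"
    by (subst has_vector_derivative_cong_ev[where g = "\<lambda>_. \<beta>"])
       (use c(1) eventually_nhds_x_imp_x[OF c(1)] in \<open>auto elim: eventually_mono\<close>)
  ultimately show "v \<in> {v. plane_map \<alpha> v = 0}" using vector_derivative_unique_at by blast
next
  fix v assume "v \<in> {v. plane_map \<alpha> v = 0}"
  interpret bounded_linear "plane_map \<alpha>" by (rule bounded_linear_plane_map)
  have "((\<lambda>t. p + t *\<^sub>R v) has_vector_derivative v) (at 0)"
    by (auto intro!: derivative_eq_intros)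
  then show "v \<in> tangent_vectors (affine_plane \<alpha> \<beta>) p"
    using assms \<open>v \<in> _\<close> unfolding tangent_vectors_def affine_plane_eq
    by (auto intro!: exI[of _ "\<lambda>t. p + t *\<^sub>R v"] simp: add scaleR)
qed

lemma has_vector_derivative_chain:
  assumes c: "(c has_vector_derivative v) (at t)" and f: "(f has_derivative D) (at (c t))"
  shows "((\<lambda>t. f (c t)) has_vector_derivative D v) (at t)"
proof -
  have "((\<lambda>t. f (c t)) has_derivative (\<lambda>h. D (h *\<^sub>R v))) (at t)"
    using has_derivative_compose[OF c[unfolded has_vector_derivative_def] f] .
  then show ?thesis
    using linear_cmul[OF has_derivative_linear[OF f]] by (simp add: has_vector_derivative_def)
qed

lemma holomorphic_map_has_derivative:
  assumes "holomorphic_map G S" "x \<in> S"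
  shows "\<exists>D. (G has_derivative D) (at x)"
  by (rule holomorphic_mapD[OF assms]) blast

text \<open>The chart is composed with a bijection between \<open>'a\<close> and its index set
  \<open>I\<close>. The inverse \<open>\<theta>\<close> is holomorphic on the ambient open set
  \<open>U\<close>, not only on \<open>M\<close>, so it can be differentiated along any
  curve.\<close>

lemma submanifold_parametrisation:
  fixes M :: "(complex ^ 'n::finite) set"
  assumes M: "complex_submanifold CARD('a::finite) M" and p: "p \<in> M"
  obtains U V and \<psi> :: "complex ^ 'a \<Rightarrow> complex ^ 'n" and \<theta>
  where "p \<in> U" "holomorphic_map \<psi> V" "holomorphic_map \<theta> U" "\<And>w. w \<in> V \<Longrightarrow> \<psi> w \<in> M \<inter> U"
    "\<And>w. w \<in> V \<Longrightarrow> \<theta> (\<psi> w) = w" "\<And>\<zeta>. \<zeta> \<in> M \<inter> U \<Longrightarrow> \<theta> \<zeta> \<in> V" "\<And>\<zeta>. \<zeta> \<in> M \<inter> U \<Longrightarrow> \<psi> (\<theta> \<zeta>) = \<zeta>"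
proof -
  from M[unfolded complex_submanifold_def, rule_format, OF p]
  obtain U V and \<phi> \<psi> :: "complex ^ 'n \<Rightarrow> complex ^ 'n" and I where *: "p \<in> U" "homeomorphism U V \<phi> \<psi>"
    "holomorphic_map \<phi> U" "holomorphic_map \<psi> V" "card I = CARD('a)"
    "\<phi> ` (M \<inter> U) = V \<inter> {z. \<forall>i. i \<notin> I \<longrightarrow> z $ i = 0}"
    by (elim exE conjE) (rule that)
  obtain \<sigma> :: "'a \<Rightarrow> 'n" where \<sigma>: "bij_betw \<sigma> UNIV I"
    using *(5) by (metis finite finite_same_card_bij)
  define \<iota> :: "complex ^ 'a \<Rightarrow> complex ^ 'n"
    where "\<iota> = (\<lambda>w. \<chi> i. if i \<in> I then w $ inv_into UNIV \<sigma> i else 0)"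
  define \<pi> :: "complex ^ 'n \<Rightarrow> complex ^ 'a" where "\<pi> = (\<lambda>z. \<chi> u. z $ \<sigma> u)"
  have \<pi>\<iota>: "\<pi> (\<iota> w) = w" for w
    using \<sigma> by (auto simp: \<pi>_def \<iota>_def vec_eq_iff bij_betw_def inv_into_f_f)
  have \<iota>\<pi>: "\<iota> (\<pi> z) = z" if "\<forall>i. i \<notin> I \<longrightarrow> z $ i = 0" for z
    using \<sigma> that by (auto simp: \<pi>_def \<iota>_def vec_eq_iff bij_betw_def f_inv_into_f)
  have \<iota>_supp: "\<forall>i. i \<notin> I \<longrightarrow> \<iota> w $ i = 0" for w by (simp add: \<iota>_def)
  have bl\<iota>: "bounded_linear \<iota>" by (rule bounded_linear_vecI) (auto simp: \<iota>_def vec_eq_iff)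
  have bl\<pi>: "bounded_linear \<pi>" by (rule bounded_linear_vecI) (auto simp: \<pi>_def vec_eq_iff)
  have sm: "\<iota> (c *s w) = c *s \<iota> w" "\<pi> (c *s z) = c *s \<pi> z" for c w z
    by (auto simp: \<iota>_def \<pi>_def vec_eq_iff)
  have opU: "open U" and opV: "open V" using *(3,4) holomorphic_map_open by blast+
  have opi: "open (\<iota> -` V)"
    using opV linear_continuous_on[OF bl\<iota>] by (intro open_vimage) auto
  have inv: "\<And>x. x \<in> U \<Longrightarrow> \<psi> (\<phi> x) = x" "\<And>y. y \<in> V \<Longrightarrow> \<phi> (\<psi> y) = y" "\<And>y. y \<in> V \<Longrightarrow> \<psi> y \<in> U"
    using *(2) by (auto simp: homeomorphism_def)
  show thesis
  proof (rule that[of U "\<lambda>w. \<psi> (\<iota> w)" "\<iota> -` V" "\<lambda>\<zeta>. \<pi> (\<phi> \<zeta>)"])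
    show "holomorphic_map (\<lambda>w. \<psi> (\<iota> w)) (\<iota> -` V)"
      by (rule holomorphic_map_compose[OF *(4) holomorphic_map_linear[OF bl\<iota> sm(1) opi] opi]) auto
    show "holomorphic_map (\<lambda>\<zeta>. \<pi> (\<phi> \<zeta>)) U"
      by (rule holomorphic_map_compose[OF holomorphic_map_linear[OF bl\<pi> sm(2) open_UNIV] *(3) opU]) auto
    fix w assume w: "w \<in> \<iota> -` V"
    have "\<iota> w \<in> \<phi> ` (M \<inter> U)" unfolding *(6) using w \<iota>_supp by auto
    then obtain \<zeta> where "\<zeta> \<in> M \<inter> U" "\<iota> w = \<phi> \<zeta>" by blast
    then show "\<psi> (\<iota> w) \<in> M \<inter> U" using inv(1) by simp
    show "\<pi> (\<phi> (\<psi> (\<iota> w))) = w" using w inv(2) \<pi>\<iota> by simp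
  next
    fix \<zeta> assume \<zeta>: "\<zeta> \<in> M \<inter> U"
    then have "\<phi> \<zeta> \<in> V \<inter> {z. \<forall>i. i \<notin> I \<longrightarrow> z $ i = 0}" using *(6) by blast
    then have "\<iota> (\<pi> (\<phi> \<zeta>)) = \<phi> \<zeta>" "\<phi> \<zeta> \<in> V" using \<iota>\<pi> by auto
    then show "\<pi> (\<phi> \<zeta>) \<in> \<iota> -` V" "\<psi> (\<iota> (\<pi> (\<phi> \<zeta>))) = \<zeta>" using inv(1) \<zeta> by auto
  qed fact
qed

text \<open>Applying \<theta> and then \<psi> leaves a curve in \<open>M\<close> unchanged near
  parameter 0, so its velocity v equals D (E v) with E the derivative of \<theta>; conversely \<psi>
  maps straight lines to curves in \<open>M\<close>.\<close>

lemma tangent_vectors_parametrised: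
  assumes \<psi>: "holomorphic_map \<psi> V" and \<theta>: "holomorphic_map \<theta> U" and M: "\<And>w. w \<in> V \<Longrightarrow> \<psi> w \<in> M \<inter> U"
    and \<theta>\<psi>: "\<And>w. w \<in> V \<Longrightarrow> \<theta> (\<psi> w) = w" and \<psi>\<theta>: "\<And>\<zeta>. \<zeta> \<in> M \<inter> U \<Longrightarrow> \<psi> (\<theta> \<zeta>) = \<zeta>"
    and w: "w \<in> V" and D: "(\<psi> has_derivative D) (at w)"
  shows "tangent_vectors M (\<psi> w) = range D"
proof (intro equalityI subsetI)
  fix v assume "v \<in> tangent_vectors M (\<psi> w)"
  then obtain c :: "real \<Rightarrow> _" where c: "c 0 = \<psi> w" "\<forall>\<^sub>F t in nhds 0. c t \<in> M"
    "(c has_vector_derivative v) (at 0)" by (auto simp: tangent_vectors_def)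
  have pU: "\<psi> w \<in> U" using M w by blast
  obtain E where E: "(\<theta> has_derivative E) (at (\<psi> w))" using holomorphic_map_has_derivative[OF \<theta> pU] ..
  have "((\<lambda>t. \<theta> (c t)) has_vector_derivative E v) (at 0)"
    by (rule has_vector_derivative_chain[OF c(3)]) (simp add: c(1) E)
  from has_vector_derivative_chain[OF this, of \<psi> D]
  have 1: "((\<lambda>t. \<psi> (\<theta> (c t))) has_vector_derivative D (E v)) (at 0)"
    using D \<theta>\<psi> w by (simp add: c(1))
  have "isCont c 0" using c(3) has_vector_derivative_continuous by blast
  then have "c \<midarrow>0\<rightarrow> \<psi> w" by (simp add: isCont_def c(1))
  then have "\<forall>\<^sub>F t in at 0. c t \<in> U"
    using holomorphic_map_open[OF \<theta>] pU by (rule topological_tendstoD)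
  then have "\<forall>\<^sub>F t in nhds 0. c t \<in> U" using pU c(1) by (simp add: eventually_nhds_conv_at)
  with c(2) have "\<forall>\<^sub>F t in nhds 0. \<psi> (\<theta> (c t)) = c t" by eventually_elim (simp add: \<psi>\<theta>)
  then have "(c has_vector_derivative D (E v)) (at 0)"
    using 1 \<psi>\<theta> M w c(1)
    by (subst has_vector_derivative_cong_ev[where g = "\<lambda>t. \<psi> (\<theta> (c t))"]) (auto elim: eventually_mono)
  then have "v = D (E v)" using c(3) vector_derivative_unique_at by blast
  then show "v \<in> range D" by blast
next
  fix v assume "v \<in> range D"
  then obtain u where u: "v = D u" by blast
  let ?c = "\<lambda>t :: real. w + t *\<^sub>R u"
  have c': "(?c has_vector_derivative u) (at 0)" by (auto intro!: derivative_eq_intros)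
  have "((\<lambda>t. \<psi> (?c t)) has_vector_derivative v) (at 0)"
    unfolding u by (rule has_vector_derivative_chain[OF c']) (simp add: D)
  moreover have "\<forall>\<^sub>F t in nhds 0. \<psi> (?c t) \<in> M"
  proof -
    have "open (?c -` V)" using holomorphic_map_open[OF \<psi>] by (intro open_vimage continuous_intros)
    then have "\<forall>\<^sub>F t in nhds 0. t \<in> ?c -` V" by (rule eventually_nhds_in_open) (simp add: w)
    then show ?thesis by eventually_elim (use M in auto)
  qed
  ultimately show "v \<in> tangent_vectors M (\<psi> w)"
    unfolding tangent_vectors_def by (auto intro!: exI[of _ "\<lambda>t. \<psi> (?c t)"])
qed

text \<open>In the parametrisation \<psi> of \<open>M\<close> near \<open>p0\<close> the section is
  the solution w of \<open>plane_map \<alpha> (\<psi> w) = \<beta>\<close>. Transversality at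
  \<open>p0\<close> says that the derivative in w is surjective, hence bijective as both sides have
  dimension \<open>CARD('a)\<close>, so w can be solved for holomorphically in (\<alpha>,
  \<beta>).\<close>

lemma transversal_section:
  fixes M :: "(complex ^ ('a::finite + 'b::finite)) set"
  assumes M: "complex_submanifold CARD('a) M"
    and tr: "transversal_at M (affine_plane 0 0) p0" and W0: "open W0" "p0 \<in> W0"
  obtains B e P where "open B" "p0 \<in> B" "B \<subseteq> W0" "e > 0" "holomorphic_map P (ball 0 e)" "P 0 = p0"
    "\<And>\<alpha> \<beta>. join \<alpha> \<beta> \<in> ball 0 e \<Longrightarrow> M \<inter> B \<inter> affine_plane \<alpha> \<beta> = {P (join \<alpha> \<beta>)} \<and>
       transversal_at M (affine_plane \<alpha> \<beta>) (P (join \<alpha> \<beta>))"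
proof -
  have p0: "p0 \<in> M" "plane_map 0 p0 = 0" using tr by (auto simp: transversal_at_def affine_plane_eq)
  show thesis
  proof (rule submanifold_parametrisation[OF M p0(1)])
    fix U V and \<psi> :: "complex ^ 'a \<Rightarrow> complex ^ ('a + 'b)" and \<theta>
    assume U: "p0 \<in> U" and \<psi>: "holomorphic_map \<psi> V" and \<theta>: "holomorphic_map \<theta> U"
      and par: "\<And>w. w \<in> V \<Longrightarrow> \<psi> w \<in> M \<inter> U" "\<And>w. w \<in> V \<Longrightarrow> \<theta> (\<psi> w) = w"
        "\<And>\<zeta>. \<zeta> \<in> M \<inter> U \<Longrightarrow> \<theta> \<zeta> \<in> V" "\<And>\<zeta>. \<zeta> \<in> M \<inter> U \<Longrightarrow> \<psi> (\<theta> \<zeta>) = \<zeta>"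
    have opU: "open U" and opV: "open V" using \<psi> \<theta> holomorphic_map_open by blast+
    define S :: "(complex ^ (('a \<times> 'b) + 'a)) set" where "S = part_r -` V"
    have opS: "open S" unfolding S_def
      by (rule open_vimage[OF opV linear_continuous_on[OF bounded_linear_part(2)]])
    \<comment> \<open>Carrying \<alpha> along as a component lets the inverse function theorem serve
      as an implicit function theorem.\<close>
    define G where "G = (\<lambda>x :: complex ^ (('a \<times> 'b) + 'a).
      join (part_l x) (plane_map (part_l x) (\<psi> (part_r x))))"
    have hr: "holomorphic_map (part_r :: complex ^ (('a \<times> 'b) + 'a) \<Rightarrow> _) S"
      by (rule holomorphic_map_linear[OF bounded_linear_part(2) _ opS]) (simp add: part_r_def vec_eq_iff)
    have h\<psi>: "holomorphic_several (\<lambda>x. \<psi> (part_r x) $ i) S" for i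
      using \<psi> unfolding holomorphic_map_def
      by (intro holomorphic_several_compose[OF _ hr opS]) (auto simp: S_def)
    have G: "holomorphic_map G S"
      unfolding holomorphic_map_def
    proof
      fix i show "holomorphic_several (\<lambda>x. G x $ i) S"
      proof (cases i)
        case (Inl u)
        then show ?thesis by (simp add: G_def part_l_def holomorphic_several_coord opS)
      next
        case (Inr k)
        then show ?thesis
          by (simp add: G_def part_l_def plane_map_def)
             (intro holomorphic_several_diff h\<psi> holomorphic_several_sum holomorphic_several_mult
               holomorphic_several_coord opS)
      qed
    qed
    have derG: "D (join 0 w) = join 0 (plane_map (part_l x) (D' w))"
      if x: "x \<in> S" and D: "(G has_derivative D) (at x)" "(\<psi> has_derivative D') (at (part_r x))" for x D D' w
    proof -
      let ?c = "\<lambda>t :: real. x + t *\<^sub>R join 0 w" and ?d = "\<lambda>t :: real. part_r x + t *\<^sub>R w"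
      have "(?c has_vector_derivative join 0 w) (at 0)" by (auto intro!: derivative_eq_intros)
      from has_vector_derivative_chain[OF this, of G D]
      have 1: "((\<lambda>t. G (?c t)) has_vector_derivative D (join 0 w)) (at 0)" using D(1) by simp
      have "(?d has_vector_derivative w) (at 0)" by (auto intro!: derivative_eq_intros)
      from has_vector_derivative_chain[OF this, of \<psi> D']
      have "((\<lambda>t. \<psi> (?d t)) has_vector_derivative D' w) (at 0)" using D(2) by simp
      then have "((\<lambda>t. join (part_l x) 0 + join 0 (plane_map (part_l x) (\<psi> (?d t))))
          has_vector_derivative 0 + join 0 (plane_map (part_l x) (D' w))) (at 0)"
        by (intro has_vector_derivative_add has_vector_derivative_const
            bounded_linear.has_vector_derivative[OF bounded_linear_join(1)]
            bounded_linear.has_vector_derivative[OF bounded_linear_plane_map])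
      moreover have "G (?c t) = join (part_l x) 0 + join 0 (plane_map (part_l x) (\<psi> (?d t)))" for t
      proof -
        have "?c t = join (part_l x) (?d t)"
          by (subst (1) part_join(3)[of x, symmetric]) (simp only: scaleR_join join_add, simp)
        then show ?thesis by (simp add: G_def join_add)
      qed
      ultimately show ?thesis using 1 vector_derivative_unique_at by fastforce
    qed
    define w0 where "w0 = \<theta> p0"
    have w0: "w0 \<in> V" "\<psi> w0 = p0" using par(3,4) p0 U by (auto simp: w0_def)
    define x0 :: "complex ^ (('a \<times> 'b) + 'a)" where "x0 = join 0 w0"
    have x0: "x0 \<in> S" using w0 by (simp add: x0_def S_def)
    have Gx0: "G x0 = 0" using p0 w0 by (simp add: G_def x0_def)
    obtain D0 where D0: "(G has_derivative D0) (at x0)" using holomorphic_map_has_derivative[OF G x0] ..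
    obtain D\<psi> where D\<psi>: "(\<psi> has_derivative D\<psi>) (at w0)" using holomorphic_map_has_derivative[OF \<psi> w0(1)] ..
    have inj0: "v = 0" if v: "D0 v = 0" for v
    proof -
      have vl: "part_l v = 0"
      proof -
        have "((\<lambda>x. part_l (G x)) has_derivative (\<lambda>h. part_l (D0 h))) (at x0)"
          by (rule bounded_linear.has_derivative[OF bounded_linear_part(1) D0])
        moreover have "((\<lambda>x. part_l (G x)) has_derivative part_l) (at x0)"
          unfolding G_def by (simp add: bounded_linear_imp_has_derivative bounded_linear_part(1))
        ultimately have "(\<lambda>h. part_l (D0 h)) = part_l" by (rule has_derivative_unique)
        then show ?thesis using v by (metis part_join(1) join_0)
      qed
      then have v_eq: "v = join 0 (part_r v)" by (metis part_join(3))
      have lin: "linear (\<lambda>w. plane_map 0 (D\<psi> w))"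
        using linear_compose[OF has_derivative_linear[OF D\<psi>] bounded_linear.linear[OF bounded_linear_plane_map]]
        by (simp add: o_def)
      \<comment> \<open>The vector \<open>join y 0\<close> is the sum of a tangent vector of
        \<open>M\<close> and one of the plane; \<open>plane_map 0\<close> kills the latter and sends
        the sum to \<open>y\<close>.\<close>
      have "surj (\<lambda>w. plane_map 0 (D\<psi> w))"
        unfolding surj_def
      proof
        fix y :: "complex ^ 'a"
        have tan: "tangent_vectors M p0 = range D\<psi>"
          using tangent_vectors_parametrised[OF \<psi> \<theta> par(1,2,4) w0(1) D\<psi>] w0(2) by simp
        have "p0 \<in> affine_plane 0 0" using p0 by (simp add: affine_plane_eq)
        note tan' = tangent_vectors_affine_plane[OF this]
        have "join y 0 \<in> {u + v |u v. u \<in> tangent_vectors M p0 \<and> v \<in> tangent_vectors (affine_plane 0 0) p0}"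
          using tr unfolding transversal_at_def by blast
        then obtain u v where "join y 0 = D\<psi> u + v" "plane_map 0 v = 0" unfolding tan tan' by blast
        moreover have "plane_map 0 (join y 0) = y" by (simp add: plane_map_def vec_eq_iff)
        ultimately have "plane_map 0 (D\<psi> u) + 0 = y"
          using bounded_linear.linear[OF bounded_linear_plane_map, THEN linear_add, of 0 "D\<psi> u" v] by metis
        then show "\<exists>x. y = plane_map 0 (D\<psi> x)" by (intro exI[of _ u]) simp
      qed
      then have "inj (\<lambda>w. plane_map 0 (D\<psi> w))" by (rule linear_surjective_imp_injective[OF lin]) simp
      moreover have "plane_map 0 (D\<psi> (part_r v)) = 0"
      proof -
        have "D0 (join 0 (part_r v)) = join 0 (plane_map (part_l x0) (D\<psi> (part_r v)))"
          by (rule derG[OF x0 D0]) (simp add: x0_def D\<psi>)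
        then have "join 0 (plane_map 0 (D\<psi> (part_r v))) = (0 :: complex ^ (('a \<times> 'b) + 'a))"
          using v v_eq by (simp add: x0_def)
        then show ?thesis by (metis join_0 join_eq_iff)
      qed
      ultimately have "part_r v = 0" using lin by (simp add: linear_injective_0)
      then show "v = 0" using v_eq by simp
    qed
    show thesis
    proof (rule holomorphic_inverse_function[OF G opS x0 D0 inj0])
      fix U' V' \<Gamma>
      assume U': "open U'" "x0 \<in> U'" "U' \<subseteq> S" and V': "open V'" and hom: "homeomorphism U' V' G \<Gamma>"
        and \<Gamma>: "holomorphic_map \<Gamma> V'"
        and inj: "\<And>x D v. x \<in> U' \<Longrightarrow> (G has_derivative D) (at x) \<Longrightarrow> D v = 0 \<Longrightarrow> v = 0"
      have inv: "\<And>x. x \<in> U' \<Longrightarrow> \<Gamma> (G x) = x" "\<And>y. y \<in> V' \<Longrightarrow> G (\<Gamma> y) = y" "\<And>y. y \<in> V' \<Longrightarrow> \<Gamma> y \<in> U'"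
        "\<And>x. x \<in> U' \<Longrightarrow> G x \<in> V'"
        using hom by (auto simp: homeomorphism_def)
      define P where "P = (\<lambda>y. \<psi> (part_r (\<Gamma> y)))"
      have zV: "0 \<in> V'" using inv(4)[OF U'(2)] Gx0 by simp
      have "holomorphic_map (\<lambda>y. part_r (\<Gamma> y)) V'"
        by (rule holomorphic_map_compose[OF hr \<Gamma> V']) (use inv(3) U'(3) in blast)
      then have P: "holomorphic_map P V'" unfolding P_def
        by (rule holomorphic_map_compose[OF \<psi> _ V']) (use inv(3) U'(3) in \<open>auto simp: S_def\<close>)
      have P0: "P 0 = p0" using inv(1)[OF U'(2)] Gx0 w0 by (simp add: P_def x0_def)
      obtain e1 where e1: "e1 > 0" "ball x0 e1 \<subseteq> U'" using U' open_contains_ball by blast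
      \<comment> \<open>\<open>B\<close> and the later bound on (\<alpha>, \<beta>) each use half of
        \<open>e1\<close>, so that a point \<zeta> of \<open>M\<close> in \<open>B\<close> gives a
        pair (\<alpha>, \<theta> \<zeta>) in \<open>U'\<close>, where \<open>G\<close> is injective;
        hence the section is unique.\<close>
      define B where "B = {\<zeta> \<in> U. \<theta> \<zeta> \<in> ball w0 (e1 / 2)} \<inter> W0"
      have "continuous_on U \<theta>"
        using holomorphic_map_continuous_at[OF \<theta>] by (intro continuous_at_imp_continuous_on) blast
      then have "open (U \<inter> \<theta> -` ball w0 (e1 / 2))"
        by (intro continuous_open_preimage opU open_ball)
      moreover have "B = (U \<inter> \<theta> -` ball w0 (e1 / 2)) \<inter> W0" by (auto simp: B_def)
      ultimately have opB: "open B" using W0(1) by (simp add: open_Int)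
      have pB: "p0 \<in> B" using U W0(2) e1(1) by (simp add: B_def w0_def)
      have "isCont P 0" by (rule holomorphic_map_continuous_at[OF P zV])
      then obtain N where N: "open N" "0 \<in> N" "\<forall>y\<in>N. P y \<in> B"
        using opB pB unfolding continuous_at_open P0 by blast
      have "open (N \<inter> V' \<inter> ball 0 (e1 / 2))" "0 \<in> N \<inter> V' \<inter> ball 0 (e1 / 2)"
        using N V' zV e1 by (auto intro: open_Int)
      then obtain e where e: "e > 0" "ball 0 e \<subseteq> N \<inter> V' \<inter> ball 0 (e1 / 2)"
        using open_contains_ball by blast
      show thesis
      proof (rule that[of B e P])
        show "open B" "p0 \<in> B" "e > 0" "P 0 = p0" by fact+
        show "B \<subseteq> W0" by (auto simp: B_def)
        show "holomorphic_map P (ball 0 e)" by (rule holomorphic_map_subset[OF P]) (use e in auto)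
        fix \<alpha> :: "complex ^ ('a \<times> 'b)" and \<beta> :: "complex ^ 'a"
        let ?y = "join \<alpha> \<beta>"
        assume y: "?y \<in> ball 0 e"
        then have y': "?y \<in> N" "?y \<in> V'" "norm ?y < e1 / 2" using e(2) by auto
        define x where "x = \<Gamma> ?y"
        have x: "x \<in> U'" "x \<in> S" "G x = ?y" using inv y' U'(3) by (auto simp: x_def)
        have xl: "part_l x = \<alpha>" and xr: "plane_map \<alpha> (\<psi> (part_r x)) = \<beta>"
          using x(3) by (auto simp: G_def)
        have rV: "part_r x \<in> V" using x(2) by (simp add: S_def)
        have Py: "P ?y = \<psi> (part_r x)" by (simp add: P_def x_def)
        have PM: "P ?y \<in> M" using par(1)[OF rV] by (simp add: Py)
        have Pa: "P ?y \<in> affine_plane \<alpha> \<beta>" using xr by (simp add: affine_plane_eq Py)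
        have "M \<inter> B \<inter> affine_plane \<alpha> \<beta> = {P ?y}"
        proof (intro equalityI subsetI)
          fix \<zeta> assume \<zeta>: "\<zeta> \<in> M \<inter> B \<inter> affine_plane \<alpha> \<beta>"
          then have \<zeta>': "\<zeta> \<in> M \<inter> U" "norm (\<theta> \<zeta> - w0) < e1 / 2" "plane_map \<alpha> \<zeta> = \<beta>"
            by (auto simp: B_def affine_plane_eq dist_norm norm_minus_commute)
          have "norm \<alpha> \<le> norm ?y"
          proof -
            have "norm \<alpha> = norm (part_l ?y)" by simp
            also have "\<dots> \<le> norm ?y"
              by (simp add: norm_vec_def L2_set_def sum_UNIV_Plus part_l_def sum_nonneg)
            finally show ?thesis .
          qed
          then have "norm (join \<alpha> (\<theta> \<zeta>) - x0) < e1"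
            unfolding x0_def join_diff using norm_join_le[of "\<alpha> - 0" "\<theta> \<zeta> - w0"] \<zeta>'(2) y'(3) by simp
          then have "join \<alpha> (\<theta> \<zeta>) \<in> U'" using e1(2) by (auto simp: dist_norm norm_minus_commute)
          moreover have "G (join \<alpha> (\<theta> \<zeta>)) = ?y" using \<zeta>' par(4) by (simp add: G_def)
          ultimately have "x = join \<alpha> (\<theta> \<zeta>)" using inv(1) unfolding x_def by metis
          then have "P ?y = \<psi> (\<theta> \<zeta>)" by (simp add: Py)
          then show "\<zeta> \<in> {P ?y}" using \<zeta>' par(4) by simp
        qed (use PM Pa N y' in auto)
        moreover have "transversal_at M (affine_plane \<alpha> \<beta>) (P ?y)"
        proof -
          obtain D where D: "(\<psi> has_derivative D) (at (part_r x))" using holomorphic_map_has_derivative[OF \<psi> rV] ..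
          obtain DG where DG: "(G has_derivative DG) (at x)" using holomorphic_map_has_derivative[OF G x(2)] ..
          have lin: "linear (\<lambda>w. plane_map \<alpha> (D w))"
            using linear_compose[OF has_derivative_linear[OF D] bounded_linear.linear[OF bounded_linear_plane_map]]
            by (simp add: o_def)
          \<comment> \<open>Injectivity of the derivative of \<open>G\<close> on all of
            \<open>U'\<close> carries transversality from \<open>p0\<close> to the nearby
            sections.\<close>
          have "w = 0" if "plane_map \<alpha> (D w) = 0" for w
          proof -
            have "DG (join 0 w) = 0" using derG[OF x(2) DG D, of w] that xl by simp
            then have "join 0 w = (0 :: complex ^ (('a \<times> 'b) + 'a))" by (rule inj[OF x(1) DG])
            then show ?thesis by (metis join_0 join_eq_iff)
          qed
          then have "inj (\<lambda>w. plane_map \<alpha> (D w))" using lin by (simp add: linear_injective_0)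
          then have surj: "surj (\<lambda>w. plane_map \<alpha> (D w))" by (rule linear_injective_imp_surjective[OF lin]) simp
          have tan: "tangent_vectors M (P ?y) = range D"
            unfolding Py by (rule tangent_vectors_parametrised[OF \<psi> \<theta> par(1,2,4) rV D])
          note tan' = tangent_vectors_affine_plane[OF Pa]
          have "\<xi> \<in> {u + v |u v. u \<in> range D \<and> v \<in> {v. plane_map \<alpha> v = 0}}" for \<xi>
          proof -
            obtain w where "plane_map \<alpha> (D w) = plane_map \<alpha> \<xi>" using surj by (metis surjD)
            then have "plane_map \<alpha> (\<xi> - D w) = 0"
              using bounded_linear.linear[OF bounded_linear_plane_map, THEN linear_diff, of \<alpha> \<xi> "D w"] by simp
            moreover have "\<xi> = D w + (\<xi> - D w)" by simp
            ultimately show ?thesis by blast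
          qed
          then show ?thesis unfolding transversal_at_def tan tan' using PM Pa by blast
        qed
        ultimately show "M \<inter> B \<inter> affine_plane \<alpha> \<beta> = {P ?y} \<and> transversal_at M (affine_plane \<alpha> \<beta>) (P ?y)" ..
      qed
    qed
  qed
qed

section \<open>The trace is affine\<close>

text \<open>The coordinate \<open>None\<close> is the parameter \<open>t\<close> of the line \<open>\<beta> = t v\<close>.\<close>

definition lift_point ::
  "complex ^ ('a \<times> 'b) \<Rightarrow> complex ^ 'a \<Rightarrow> complex ^ ('b option) \<Rightarrow> complex ^ ('a::finite + 'b::finite)" where
  "lift_point \<alpha> v x = join (\<chi> k. (\<Sum>r\<in>UNIV. \<alpha> $ (k, r) * x $ Some r) + x $ None * v $ k) (\<chi> r. x $ Some r)"

lemma lift_point_in_plane: "lift_point \<alpha> v x \<in> affine_plane \<alpha> (x $ None *s v)"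
  by (simp add: lift_point_def affine_plane_def)

lemma lift_point_polyfuns: "(\<lambda>x. lift_point \<alpha> v x $ i) \<in> polyfuns"
proof (cases i)
  case (Inl k)
  have "(\<lambda>x. (\<Sum>r\<in>UNIV. \<alpha> $ (k, r) * x $ Some r) + x $ None * v $ k) \<in> polyfuns"
    by (intro polyfuns_intros)
  with Inl show ?thesis by (simp add: lift_point_def)
next
  case (Inr r)
  then show ?thesis by (simp add: lift_point_def polyfuns.coord)
qed

lemma lift_point_unique:
  assumes "\<zeta> \<in> affine_plane \<alpha> (t *s v)"
  shows "lift_point \<alpha> v (\<chi> i. case i of None \<Rightarrow> t | Some r \<Rightarrow> \<zeta> $ Inr r) = \<zeta>"
  using assms by (auto simp: lift_point_def affine_plane_def join_def vec_eq_iff split: sum.split)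

text \<open>\<open>lift_point \<alpha> v\<close> parametrises the planes over the line by t and the
  last coordinates. The preimage of \<open>V\<close> is therefore algebraic with linearly bounded
  fibres, and its branches \<open>g j\<close> consist of t and the last coordinates of the section
  points.\<close>

lemma trace_affine_on_lines:
  fixes V :: "(complex ^ ('a::finite + 'b::finite)) set"
    and P :: "'j \<Rightarrow> complex ^ (('a \<times> 'b) + 'a) \<Rightarrow> complex ^ ('a + 'b)"
  assumes V: "V = zeros Q" "Q \<subseteq> polyfuns"
    and bound: "\<And>\<beta> \<zeta>. \<zeta> \<in> V \<Longrightarrow> \<zeta> \<in> affine_plane \<alpha> \<beta> \<Longrightarrow> norm \<zeta> \<le> C * (1 + norm \<beta>)"
    and P: "\<And>j. j \<in> J \<Longrightarrow> holomorphic_map (P j) (ball 0 e)"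
    and sec: "\<And>\<beta>. norm \<beta> < \<epsilon> \<Longrightarrow> V \<inter> affine_plane \<alpha> \<beta> = (\<lambda>j. P j (join \<alpha> \<beta>)) ` J"
    and inj: "\<And>\<beta>. norm \<beta> < \<epsilon> \<Longrightarrow> inj_on (\<lambda>j. P j (join \<alpha> \<beta>)) J"
    and e: "norm \<alpha> + \<epsilon> \<le> e" and r: "r * norm v \<le> \<epsilon>" "0 < \<epsilon>"
  obtains a b where "\<And>t. t \<in> ball 0 r \<Longrightarrow> (\<Sum>j\<in>J. P j (join \<alpha> (t *s v)) $ Inr l) = a + b * t"
proof -
  define X where "X = {x. lift_point \<alpha> v x \<in> V}"
  define Q' where "Q' = (\<lambda>f x. f (lift_point \<alpha> v x)) ` Q"
  have X: "X = zeros Q'" by (auto simp: X_def Q'_def V zeros_def)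
  have Q': "Q' \<subseteq> polyfuns"
  proof
    fix h assume "h \<in> Q'"
    then obtain f where "f \<in> Q" and h: "h = (\<lambda>x. f (lift_point \<alpha> v x))" unfolding Q'_def by blast
    then have "f \<in> polyfuns" using V(2) by blast
    then show "h \<in> polyfuns" unfolding h by (rule polyfuns_compose) (rule lift_point_polyfuns)
  qed
  \<comment> \<open>The factor \<open>1 + norm v\<close> absorbs the norm of \<beta> = t v; the
    summand 1 covers the coordinate t itself.\<close>
  define C' where "C' = \<bar>C\<bar> * (1 + norm v) + 1"
  have "C' \<ge> 1" by (simp add: C'_def)
  have bound': "cmod (x $ i) \<le> C' * (1 + cmod (x $ None))" if x: "x \<in> X" for x i
  proof (cases i)
    case None
    then show ?thesis using mult_right_mono[OF \<open>C' \<ge> 1\<close>, of "1 + cmod (x $ None)"] by simp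
  next
    case (Some r)
    have "cmod (x $ i) = cmod (lift_point \<alpha> v x $ Inr r)" by (simp add: Some lift_point_def)
    also have "\<dots> \<le> norm (lift_point \<alpha> v x)" by (rule Finite_Cartesian_Product.norm_nth_le)
    also have "\<dots> \<le> C * (1 + norm (x $ None *s v))"
      using x by (intro bound lift_point_in_plane) (simp add: X_def)
    also have "\<dots> \<le> \<bar>C\<bar> * ((1 + norm v) * (1 + cmod (x $ None)))"
      by (intro mult_mono) (auto simp: norm_vector_smult algebra_simps)
    also have "\<dots> \<le> C' * (1 + cmod (x $ None))" by (simp add: C'_def algebra_simps)
    finally show ?thesis .
  qed
  define g where "g = (\<lambda>j t. \<chi> i. case i of None \<Rightarrow> t | Some r \<Rightarrow> P j (join \<alpha> (t *s v)) $ Inr r)"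
  have small: "norm (t *s v) < \<epsilon>" if "t \<in> ball 0 r" for t
  proof (cases "v = 0")
    case True
    then show ?thesis using r(2) by (simp add: norm_vector_smult)
  next
    case False
    then have "norm (t *s v) < r * norm v" using that by (simp add: norm_vector_smult)
    then show ?thesis using r(1) by simp
  qed
  have lift_g: "lift_point \<alpha> v (g j t) = P j (join \<alpha> (t *s v))" if "j \<in> J" "t \<in> ball 0 r" for j t
    unfolding g_def using sec[OF small[OF that(2)]] that(1) by (intro lift_point_unique) blast
  have holg: "(\<lambda>t. g j t $ i) holomorphic_on ball 0 r" if j: "j \<in> J" for j i
  proof (cases i)
    case None
    then show ?thesis by (simp add: g_def holomorphic_on_ident)
  next
    case (Some k)
    have "(\<lambda>t. P j (join \<alpha> (t *s v)) $ Inr k) holomorphic_on ball 0 r"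
    proof (rule holomorphic_onI)
      fix t :: complex assume t: "t \<in> ball 0 r"
      have eq: "join \<alpha> (s *s v) = join \<alpha> 0 + s *s join 0 v" for s by (simp add: smult_join join_add)
      have "norm (join \<alpha> (t *s v)) < e" using norm_join_le[of \<alpha> "t *s v"] small[OF t] e by linarith
      then have "join \<alpha> 0 + t *s join 0 v \<in> ball 0 e" by (simp flip: eq)
      moreover have "holomorphic_several (\<lambda>y. P j y $ Inr k) (ball 0 e)"
        using P[OF j] by (simp add: holomorphic_map_def)
      ultimately obtain D where D: "((\<lambda>y. P j y $ Inr k) has_derivative D) (at (join \<alpha> 0 + t *s join 0 v))"
        "\<And>c v. D (c *s v) = c * D v" unfolding holomorphic_several_def by blast
      from holomorphic_several_line[OF D]
      have "((\<lambda>t. P j (join \<alpha> (t *s v)) $ Inr k) has_field_derivative D (join 0 v)) (at t)"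
        by (simp only: eq)
      then show "(\<lambda>t. P j (join \<alpha> (t *s v)) $ Inr k) field_differentiable at t within ball 0 r"
        using field_differentiable_def field_differentiable_at_within by blast
    qed
    then show ?thesis by (simp add: g_def Some)
  qed
  have fibre: "{x \<in> X. x $ None = t} = (\<lambda>j. g j t) ` J" if t: "t \<in> ball 0 r" for t
  proof (intro equalityI subsetI)
    fix x assume "x \<in> {x \<in> X. x $ None = t}"
    then have x: "lift_point \<alpha> v x \<in> V" "x $ None = t" by (auto simp: X_def)
    then have "lift_point \<alpha> v x \<in> V \<inter> affine_plane \<alpha> (t *s v)" using lift_point_in_plane[of \<alpha> v x] by simp
    then obtain j where j: "j \<in> J" "lift_point \<alpha> v x = P j (join \<alpha> (t *s v))"
      unfolding sec[OF small[OF t]] by blast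
    have "x $ Some k = P j (join \<alpha> (t *s v)) $ Inr k" for k
      unfolding j(2)[symmetric] by (simp add: lift_point_def)
    then have "x = g j t" using x(2) by (auto simp: g_def vec_eq_iff split: option.split)
    then show "x \<in> (\<lambda>j. g j t) ` J" using j(1) by blast
  next
    fix x assume "x \<in> (\<lambda>j. g j t) ` J"
    then obtain j where j: "j \<in> J" "x = g j t" by blast
    have "P j (join \<alpha> (t *s v)) \<in> V" using sec[OF small[OF t]] j(1) by blast
    then show "x \<in> {x \<in> X. x $ None = t}" using lift_g[OF j(1) t] by (simp add: X_def j g_def)
  qed
  have injg: "inj_on (\<lambda>j. g j t) J" if t: "t \<in> ball 0 r" for t
    using inj[OF small[OF t]] lift_g[OF _ t] unfolding inj_on_def by metis
  show thesis
  proof (rule sum_of_branches_affine[OF X Q' bound' holg fibre injg, of "Some l"])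
    fix a b assume "\<And>t. t \<in> ball 0 r \<Longrightarrow> (\<Sum>j\<in>J. g j t $ Some l) = a + b * t"
    then show thesis by (intro that[of a b]) (simp add: g_def)
  qed
qed

text \<open>On each line through 0 the slope of the trace is its directional derivative at \<beta> =
  0. This is linear in the direction because the \<open>P j\<close> are differentiable there, so the
  trace is jointly affine in \<beta>. The slopes along the axes are written as difference quotients
  with a fixed \<open>s\<close>, exact for affine functions, so that their dependence on \<alpha> is
  visibly holomorphic.\<close>

lemma trace_affine:
  fixes V :: "(complex ^ ('a::finite + 'b::finite)) set"
    and P :: "'j \<Rightarrow> complex ^ (('a \<times> 'b) + 'a) \<Rightarrow> complex ^ ('a + 'b)" and l :: 'b
  assumes V: "V = zeros Q" "Q \<subseteq> polyfuns"
    and bound: "\<And>\<beta> \<zeta>. \<zeta> \<in> V \<Longrightarrow> \<zeta> \<in> affine_plane \<alpha> \<beta> \<Longrightarrow> norm \<zeta> \<le> C * (1 + norm \<beta>)"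
    and P: "\<And>j. j \<in> J \<Longrightarrow> holomorphic_map (P j) (ball 0 e)"
    and sec: "\<And>\<beta>. norm \<beta> < \<epsilon> \<Longrightarrow> V \<inter> affine_plane \<alpha> \<beta> = (\<lambda>j. P j (join \<alpha> \<beta>)) ` J"
    and inj: "\<And>\<beta>. norm \<beta> < \<epsilon> \<Longrightarrow> inj_on (\<lambda>j. P j (join \<alpha> \<beta>)) J"
    and e: "norm \<alpha> + \<epsilon> \<le> e" "0 < \<epsilon>" and s: "cmod s < \<epsilon>" "s \<noteq> 0" and \<beta>: "norm \<beta> < \<epsilon>"
  defines "f \<equiv> \<lambda>\<beta>. \<Sum>j\<in>J. P j (join \<alpha> \<beta>) $ Inr l"
  shows "f \<beta> = f 0 + (\<Sum>i\<in>UNIV. (f (s *s axis i 1) - f 0) / s * \<beta> $ i)"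
proof -
  have "\<exists>D. ((\<lambda>y. P j y $ Inr l) has_derivative D) (at (join \<alpha> 0)) \<and> (\<forall>c v. D (c *s v) = c * D v)"
    if "j \<in> J" for j
  proof -
    have "join \<alpha> 0 \<in> ball 0 e" using e by (simp add: norm_join_left)
    then show ?thesis using P[OF that] unfolding holomorphic_map_def holomorphic_several_def by blast
  qed
  then obtain D where D: "\<And>j. j \<in> J \<Longrightarrow> ((\<lambda>y. P j y $ Inr l) has_derivative D j) (at (join \<alpha> 0))"
    "\<And>j c v. j \<in> J \<Longrightarrow> D j (c *s v) = c * D j v" by metis
  define L where "L = (\<lambda>v. \<Sum>j\<in>J. D j (join 0 v))"
  have L_add: "L (v + w) = L v + L w" for v w
  proof -
    have "D j (join 0 (v + w)) = D j (join 0 v) + D j (join 0 w)" if "j \<in> J" for j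
      using linear_add[OF has_derivative_linear[OF D(1)[OF that]], of "join 0 v" "join 0 w"] by (simp add: join_add)
    then show ?thesis by (simp add: L_def sum.distrib)
  qed
  have L_smult: "L (c *s v) = c * L v" for c v
  proof -
    have "D j (join 0 (c *s v)) = c * D j (join 0 v)" if "j \<in> J" for j
      using D(2)[OF that, of c "join 0 v"] by (simp add: smult_join)
    then show ?thesis by (simp add: L_def sum_distrib_left)
  qed
  have f_eq: "f v = f 0 + L v" if v: "norm v < \<epsilon>" for v
  proof -
    \<comment> \<open>Any radius above 1 with \<open>r * norm v \<le> \<epsilon>\<close> serves: the
      point t = 1 recovers \<open>f v\<close>.\<close>
    define r where "r = (if v = 0 then 2 else \<epsilon> / norm v)"
    have r: "r * norm v \<le> \<epsilon>" "1 < r" using v e(2) by (auto simp: r_def)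
    show ?thesis
    proof (rule trace_affine_on_lines[OF V bound P sec inj e(1) r(1) e(2), where l = l])
      fix a b assume ab: "\<And>t. t \<in> ball 0 r \<Longrightarrow> (\<Sum>j\<in>J. P j (join \<alpha> (t *s v)) $ Inr l) = a + b * t"
      have f_line: "f (t *s v) = a + b * t" if "t \<in> ball 0 r" for t using ab[OF that] by (simp add: f_def)
      have "((\<lambda>t. f (t *s v)) has_field_derivative L v) (at 0)"
        unfolding f_def L_def
      proof (rule DERIV_sum)
        fix j assume j: "j \<in> J"
        have eq: "join \<alpha> (t *s v) = join \<alpha> 0 + t *s join 0 v" for t by (simp add: smult_join join_add)
        have "((\<lambda>y. P j y $ Inr l) has_derivative D j) (at (join \<alpha> 0 + 0 *s join 0 v))"
          using D(1)[OF j] by simp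
        from holomorphic_several_line[OF this D(2)[OF j]]
        show "((\<lambda>t. P j (join \<alpha> (t *s v)) $ Inr l) has_field_derivative D j (join 0 v)) (at 0)"
          by (simp only: eq)
      qed
      moreover have "((\<lambda>t. f (t *s v)) has_field_derivative b) (at 0)"
      proof (rule has_field_derivative_transform_within_open[of "\<lambda>t. a + b * t" _ _ "ball 0 r"])
        show "((\<lambda>t. a + b * t) has_field_derivative b) (at 0)" by (auto intro!: derivative_eq_intros)
      qed (use r f_line in auto)
      ultimately have "L v = b" by (rule DERIV_unique)
      moreover have "f v = a + b" using f_line[of 1] r by simp
      moreover have "f 0 = a" using f_line[of 0] r by simp
      ultimately show ?thesis by simp
    qed
  qed
  have "L \<beta> = (\<Sum>i\<in>UNIV. \<beta> $ i * L (axis i 1))"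
  proof -
    have L0: "L 0 = 0" using L_add[of 0 0] by simp
    have L_sum: "L (\<Sum>i\<in>I. w i) = (\<Sum>i\<in>I. L (w i))" for w and I :: "'a set"
      by (induction I rule: infinite_finite_induct) (simp_all add: L0 L_add)
    have "\<beta> = (\<Sum>i\<in>UNIV. \<beta> $ i *s axis i 1)"
      by (simp add: vec_eq_iff axis_def if_distrib cong: if_cong)
    then have "L \<beta> = L (\<Sum>i\<in>UNIV. \<beta> $ i *s axis i 1)" by simp
    then show ?thesis by (simp add: L_sum L_smult)
  qed
  moreover have "(f (s *s axis i 1) - f 0) / s = L (axis i 1)" for i
  proof -
    have "norm (s *s axis i 1 :: complex ^ 'a) < \<epsilon>" using s(1) by (simp add: norm_vector_smult norm_axis)
    then show ?thesis using f_eq s(2) by (simp add: L_smult)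
  qed
  ultimately show ?thesis using f_eq[OF \<beta>] by (simp add: mult.commute)
qed

section \<open>Uniform bounds for plane sections\<close>

lemma plane_component_le:
  fixes \<zeta> :: "complex ^ ('a::finite + 'b::finite)"
  assumes "\<zeta> \<in> affine_plane \<alpha> \<beta>"
  shows "(\<Sum>k\<in>UNIV. cmod (\<zeta> $ Inl k)) \<le> CARD('a) * (CARD('b) * norm \<alpha> * norm \<zeta> + norm \<beta>)"
proof -
  have "cmod (\<zeta> $ Inl k) \<le> CARD('b) * norm \<alpha> * norm \<zeta> + norm \<beta>" for k
  proof -
    have "\<zeta> $ Inl k = (\<Sum>r\<in>UNIV. \<alpha> $ (k, r) * \<zeta> $ Inr r) + \<beta> $ k"
      using assms by (simp add: affine_plane_def)
    then have "cmod (\<zeta> $ Inl k) \<le> cmod (\<Sum>r\<in>UNIV. \<alpha> $ (k, r) * \<zeta> $ Inr r) + cmod (\<beta> $ k)"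
      by (metis norm_triangle_ineq)
    also have "cmod (\<Sum>r\<in>UNIV. \<alpha> $ (k, r) * \<zeta> $ Inr r) \<le> (\<Sum>r\<in>(UNIV :: 'b set). norm \<alpha> * norm \<zeta>)"
      by (rule sum_norm_le) (auto simp: norm_mult intro!: mult_mono Finite_Cartesian_Product.norm_nth_le)
    finally show ?thesis using Finite_Cartesian_Product.norm_nth_le[of \<beta> k] by simp
  qed
  then have "(\<Sum>k\<in>UNIV. cmod (\<zeta> $ Inl k)) \<le> (\<Sum>k\<in>(UNIV :: 'a set). CARD('b) * norm \<alpha> * norm \<zeta> + norm \<beta>)"
    by (intro sum_mono)
  then show ?thesis by simp
qed

text \<open>On the plane the first coordinates are O(|\<alpha>| |\<zeta>| + |\<beta>|). For small
  \<alpha> the first term is absorbed into half of \<kappa> |\<zeta>|, leaving |\<zeta>| =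
  O(|\<beta>|) outside the ball of radius \<open>K\<close>.\<close>

lemma section_bound:
  fixes V :: "(complex ^ ('a::finite + 'b::finite)) set"
  assumes "0 < \<kappa>" "0 < K"
    and growth: "\<And>\<zeta>. \<zeta> \<in> V \<Longrightarrow> K \<le> norm \<zeta> \<Longrightarrow> \<kappa> * norm \<zeta> \<le> (\<Sum>k\<in>UNIV. cmod (\<zeta> $ Inl k))"
  obtains \<eta> C where "0 < \<eta>" "0 < C"
    "\<And>\<alpha> \<beta> \<zeta>. norm \<alpha> < \<eta> \<Longrightarrow> \<zeta> \<in> V \<Longrightarrow> \<zeta> \<in> affine_plane \<alpha> \<beta> \<Longrightarrow> norm \<zeta> \<le> C * (1 + norm \<beta>)"
proof -
  define a b where "a = real CARD('a)" and "b = real CARD('b)"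
  have ab: "a > 0" "b > 0" by (simp_all add: a_def b_def)
  define \<eta> where "\<eta> = \<kappa> / (2 * a * b)"
  \<comment> \<open>\<open>K\<close> covers the points inside the ball,
    \<open>2 * a / \<kappa>\<close> those outside.\<close>
  define C where "C = K + 2 * a / \<kappa>"
  have pos: "0 < \<eta>" "0 < C" using assms ab by (simp_all add: \<eta>_def C_def add_pos_pos)
  have "norm \<zeta> \<le> C * (1 + norm \<beta>)" if *: "norm \<alpha> < \<eta>" "\<zeta> \<in> V" "\<zeta> \<in> affine_plane \<alpha> \<beta>" for \<alpha> \<beta> \<zeta>
  proof (cases "norm \<zeta> < K")
    case True
    also have "K \<le> C * 1" using assms ab by (simp add: C_def)
    also have "C * 1 \<le> C * (1 + norm \<beta>)" using pos by (intro mult_left_mono) auto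
    finally show ?thesis by simp
  next
    case False
    then have "\<kappa> * norm \<zeta> \<le> a * (b * norm \<alpha> * norm \<zeta> + norm \<beta>)"
      using growth[OF *(2)] plane_component_le[OF *(3)] by (simp add: a_def b_def)
    also have "\<dots> = a * b * norm \<alpha> * norm \<zeta> + a * norm \<beta>" by (simp add: algebra_simps)
    also have "a * b * norm \<alpha> * norm \<zeta> \<le> \<kappa> / 2 * norm \<zeta>"
    proof (rule mult_right_mono)
      have "a * b * norm \<alpha> \<le> a * b * \<eta>" using *(1) ab by (intro mult_left_mono) auto
      then show "a * b * norm \<alpha> \<le> \<kappa> / 2" using ab by (simp add: \<eta>_def)
    qed simp
    finally have "\<kappa> * norm \<zeta> \<le> 2 * a * norm \<beta>" by simp
    then have "norm \<zeta> \<le> 2 * a / \<kappa> * norm \<beta>" using assms(1) by (simp add: field_simps)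
    also have "\<dots> \<le> C * (1 + norm \<beta>)" using assms ab by (intro mult_mono) (auto simp: C_def)
    finally show ?thesis .
  qed
  with pos show thesis by (rule that)
qed

text \<open>Sections with |\<beta>| < 1 lie in the ball of radius 2 C. The part of \<open>V\<close>
  in that ball outside \<open>W'\<close> is compact and off the plane with parameters (0, 0), so its
  first coordinates have norm at least some \<mu> > 0, whereas on planes with small parameters they
  are smaller.\<close>

lemma nearby_sections:
  fixes V :: "(complex ^ ('a::finite + 'b::finite)) set"
  assumes "closed V" "open W'" and W': "V \<inter> affine_plane 0 0 \<subseteq> W'" and "0 < \<eta>" "0 < C"
    and bound: "\<And>\<alpha> \<beta> \<zeta>. norm \<alpha> < \<eta> \<Longrightarrow> \<zeta> \<in> V \<Longrightarrow> \<zeta> \<in> affine_plane \<alpha> \<beta> \<Longrightarrow> norm \<zeta> \<le> C * (1 + norm \<beta>)"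
  obtains \<epsilon> where "0 < \<epsilon>" "\<And>\<alpha> \<beta>. norm \<alpha> < \<epsilon> \<Longrightarrow> norm \<beta> < \<epsilon> \<Longrightarrow> V \<inter> affine_plane \<alpha> \<beta> \<subseteq> W'"
proof -
  define a b where "a = real CARD('a)" and "b = real CARD('b)"
  have ab: "a > 0" "b > 0" by (simp_all add: a_def b_def)
  define K where "K = V \<inter> cball 0 (2 * C) - W'"
  have "compact K" unfolding K_def using assms(1,2) by (intro compact_diff closed_Int_compact) auto
  have "\<exists>\<mu>>0. \<forall>\<zeta>\<in>K. \<mu> \<le> norm (part_l \<zeta>)"
  proof (cases "K = {}")
    case False
    have "continuous_on K (\<lambda>\<zeta>. norm (part_l \<zeta>))"
      by (intro continuous_on_norm linear_continuous_on bounded_linear_part)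
    then obtain \<zeta>0 where \<zeta>0: "\<zeta>0 \<in> K" "\<forall>\<zeta>\<in>K. norm (part_l \<zeta>0) \<le> norm (part_l \<zeta>)"
      using continuous_attains_inf[OF \<open>compact K\<close> False] by blast
    have "part_l \<zeta>0 \<noteq> 0"
    proof
      assume "part_l \<zeta>0 = 0"
      then have "\<zeta>0 \<in> affine_plane 0 0" by (simp add: affine_plane_def part_l_def vec_eq_iff)
      then show False using \<zeta>0(1) W' by (auto simp: K_def)
    qed
    then show ?thesis using \<zeta>0 by (intro exI[of _ "norm (part_l \<zeta>0)"]) simp
  qed (auto intro: exI[of _ 1])
  then obtain \<mu> where \<mu>: "\<mu> > 0" "\<And>\<zeta>. \<zeta> \<in> K \<Longrightarrow> \<mu> \<le> norm (part_l \<zeta>)" by blast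
  \<comment> \<open>\<open>M * \<epsilon>\<close> bounds the first coordinates on a plane with
    parameters below \<epsilon>, whence the choice \<epsilon> \<le> \<mu> / M.\<close>
  define M where "M = a * (b * (2 * C) + 1)"
  have "M > 0" using ab assms(5) by (simp add: M_def add_pos_pos)
  define \<epsilon> where "\<epsilon> = min \<eta> (min 1 (\<mu> / M))"
  have "V \<inter> affine_plane \<alpha> \<beta> \<subseteq> W'" if *: "norm \<alpha> < \<epsilon>" "norm \<beta> < \<epsilon>" for \<alpha> \<beta>
  proof
    fix \<zeta> assume \<zeta>: "\<zeta> \<in> V \<inter> affine_plane \<alpha> \<beta>"
    have "norm \<zeta> \<le> C * (1 + norm \<beta>)" using \<zeta> * by (intro bound[of \<alpha>]) (auto simp: \<epsilon>_def)
    also have "\<dots> \<le> C * 2" using * assms(5) by (intro mult_left_mono) (auto simp: \<epsilon>_def)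
    finally have n: "norm \<zeta> \<le> 2 * C" by simp
    have "norm (part_l \<zeta>) \<le> (\<Sum>k\<in>UNIV. cmod (part_l \<zeta> $ k))" by (rule norm_vec_le_sum)
    also have "\<dots> \<le> a * (b * norm \<alpha> * norm \<zeta> + norm \<beta>)"
      using plane_component_le[of \<zeta> \<alpha> \<beta>] \<zeta> by (simp add: part_l_def a_def b_def)
    also have "\<dots> < a * (b * \<epsilon> * (2 * C) + \<epsilon>)"
    proof (rule mult_strict_left_mono[OF _ ab(1)])
      have "b * norm \<alpha> * norm \<zeta> \<le> b * \<epsilon> * (2 * C)"
        using n * ab order_le_less_trans[OF norm_ge_zero *(1)] by (intro mult_mono) auto
      then show "b * norm \<alpha> * norm \<zeta> + norm \<beta> < b * \<epsilon> * (2 * C) + \<epsilon>" using *(2) by linarith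
    qed
    also have "\<dots> = M * \<epsilon>" by (simp add: M_def algebra_simps)
    also have "\<dots> \<le> M * (\<mu> / M)" using \<open>M > 0\<close> by (intro mult_left_mono) (auto simp: \<epsilon>_def)
    also have "\<dots> = \<mu>" using \<open>M > 0\<close> by simp
    finally have "\<zeta> \<notin> K" using \<mu>(2) by force
    then show "\<zeta> \<in> W'" using n \<zeta> by (auto simp: K_def)
  qed
  moreover have "\<epsilon> > 0" using assms \<mu>(1) \<open>M > 0\<close> by (simp add: \<epsilon>_def)
  ultimately show thesis by (intro that)
qed

text \<open>An affine function in the prescribed form: only the multi-index 0 and the unit vectors
  carry coefficients, and \<rho> \<ge> 0 puts them in the range |k| \<le> \<rho> + 1.\<close>

lemma sum_affine_multiindex:
  fixes c :: "'a::finite \<Rightarrow> complex" and \<beta> :: "complex ^ 'a" and \<rho> :: rat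
  assumes "0 \<le> \<rho>"
  defines "unit \<equiv> \<lambda>i. (\<lambda>_. 0 :: nat)(i := 1)"
  shows "(\<Sum>k | of_nat (\<Sum>i\<in>UNIV. k i) \<le> \<rho> + 1.
      (if k = (\<lambda>_. 0) then c0 else if \<exists>i. k = unit i then c (THE i. k = unit i) else 0) *
      (\<Prod>i\<in>UNIV. \<beta> $ i ^ k i)) = c0 + (\<Sum>i\<in>UNIV. c i * \<beta> $ i)"
proof -
  let ?S = "{k :: 'a \<Rightarrow> nat. of_nat (\<Sum>i\<in>UNIV. k i) \<le> \<rho> + 1}"
  define h where "h = (\<lambda>k. if k = (\<lambda>_. 0) then c0 else if \<exists>i. k = unit i then c (THE i. k = unit i) else 0)"
  have unit_eq: "unit i j = (if j = i then 1 else 0)" for i j by (simp add: unit_def)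
  have unit_inj: "unit i = unit j \<longleftrightarrow> i = j" for i j by (metis unit_eq zero_neq_one)
  have unit_neq: "unit i \<noteq> (\<lambda>_. 0)" for i by (metis unit_eq zero_neq_one)
  \<comment> \<open>Sums over infinite sets are 0 by convention, so finiteness of the range
    matters.\<close>
  have fin: "finite ?S"
  proof (rule finite_subset)
    show "?S \<subseteq> PiE UNIV (\<lambda>_. {..nat \<lceil>\<rho> + 1\<rceil>})"
    proof
      fix k assume "k \<in> ?S"
      then have *: "of_nat (\<Sum>i\<in>UNIV. k i) \<le> \<rho> + 1" by simp
      have "k i \<le> nat \<lceil>\<rho> + 1\<rceil>" for i
      proof -
        have "k i \<le> (\<Sum>i\<in>UNIV. k i)" by (rule member_le_sum) auto
        also have "\<dots> \<le> nat \<lceil>\<rho> + 1\<rceil>" using * by linarith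
        finally show ?thesis .
      qed
      then show "k \<in> PiE UNIV (\<lambda>_. {..nat \<lceil>\<rho> + 1\<rceil>})" by (simp add: PiE_def)
    qed
  qed (intro finite_PiE; simp)
  let ?T = "insert (\<lambda>_. 0) (range unit)"
  have "(\<Sum>k\<in>?S. h k * (\<Prod>i\<in>UNIV. \<beta> $ i ^ k i)) = (\<Sum>k\<in>?T. h k * (\<Prod>i\<in>UNIV. \<beta> $ i ^ k i))"
  proof (rule sum.mono_neutral_right[OF fin])
    have unit_sum: "(\<Sum>j\<in>UNIV. unit i j) = 1" for i by (simp add: unit_eq)
    show "?T \<subseteq> ?S"
    proof
      fix k assume "k \<in> ?T"
      then have "(\<Sum>j\<in>UNIV. k j) \<le> 1" using unit_sum by auto
      then have "of_nat (\<Sum>j\<in>UNIV. k j) \<le> (1 :: rat)" by linarith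
      then show "k \<in> ?S" using assms(1) by (simp del: of_nat_sum)
    qed
  qed (auto simp: h_def)
  also have "\<dots> = h (\<lambda>_. 0) * (\<Prod>i\<in>UNIV. \<beta> $ i ^ 0) + (\<Sum>k\<in>range unit. h k * (\<Prod>i\<in>UNIV. \<beta> $ i ^ k i))"
  proof (rule sum.insert)
    show "(\<lambda>_. 0) \<notin> range unit" using unit_neq by (metis rangeE)
  qed simp
  also have "(\<Sum>k\<in>range unit. h k * (\<Prod>i\<in>UNIV. \<beta> $ i ^ k i)) = (\<Sum>i\<in>UNIV. h (unit i) * (\<Prod>j\<in>UNIV. \<beta> $ j ^ unit i j))"
    by (subst sum.reindex) (auto simp: inj_on_def unit_inj)
  also have "\<dots> = (\<Sum>i\<in>UNIV. c i * \<beta> $ i)"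
  proof (rule sum.cong[OF refl])
    fix i
    have "(\<Prod>j\<in>UNIV. \<beta> $ j ^ unit i j) = (\<Prod>j\<in>UNIV. if j = i then \<beta> $ i else 1)"
      by (rule prod.cong) (auto simp: unit_eq)
    also have "\<dots> = \<beta> $ i" by simp
    finally have "(\<Prod>j\<in>UNIV. \<beta> $ j ^ unit i j) = \<beta> $ i" .
    moreover have "h (unit i) = c i" using unit_neq by (auto simp: h_def unit_inj)
    ultimately show "h (unit i) * (\<Prod>j\<in>UNIV. \<beta> $ j ^ unit i j) = c i * \<beta> $ i" by simp
  qed
  also have "h (\<lambda>_. 0) = c0" by (simp add: h_def)
  finally show ?thesis unfolding h_def by simp
qed

theorem proposition5p1:
  fixes n q m d :: nat
    and W :: "(complex ^ ('a::finite + 'b::finite)) set"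
    and \<gamma> :: "nat \<Rightarrow> (complex ^ ('a + 'b)) set"
    and p0 :: "nat \<Rightarrow> complex ^ ('a + 'b)"
    and P :: "nat \<Rightarrow> ('a + 'b) cpoly"
    and \<delta> :: "nat \<Rightarrow> rat"
    and deg :: "nat \<Rightarrow> nat"
    and \<rho> :: rat
  assumes "2 \<le> q" and "q \<le> n" and "0 < m" and "m < q"
    and card_a: "CARD('a) = q - m" and card_b: "CARD('b) = n + m - q"
    and W: "irreducible_algebraic_set W" "algebraic_variety_of_dim q W"
    and \<gamma>_manifold: "\<And>j. j \<in> {1..d} \<Longrightarrow> complex_submanifold (q - m) (\<gamma> j)"
    and \<gamma>_disjoint: "\<And>i j. i \<in> {1..d} \<Longrightarrow> j \<in> {1..d} \<Longrightarrow> i \<noteq> j \<Longrightarrow> \<gamma> i \<inter> \<gamma> j = {}"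
    and \<gamma>_regular: "\<And>j. j \<in> {1..d} \<Longrightarrow> \<gamma> j \<subseteq> regular_points W"
    and L00: "\<And>j. j \<in> {1..d} \<Longrightarrow> \<gamma> j \<inter> affine_plane 0 0 = {p0 j}"
      "\<And>j. j \<in> {1..d} \<Longrightarrow> transversal_at (\<gamma> j) (affine_plane 0 0) (p0 j)"
    and \<delta>_pos: "\<And>j. j \<in> {1..m} \<Longrightarrow> 0 < \<delta> j"
    and deg: "\<And>j. j \<in> {1..m} \<Longrightarrow> total_degree (P j) = deg j"
      "\<And>j. j \<in> {1..m} \<Longrightarrow> \<delta> j \<le> of_nat (deg j)"
    and i_dim: "algebraic_variety_of_dim (q - m) (W \<inter> zero_locus (P ` {1..m}))"
    and i_contains: "\<And>j. j \<in> {1..d} \<Longrightarrow> \<gamma> j \<subseteq> W \<inter> zero_locus (P ` {1..m})"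
    and i_germ: "\<And>j. j \<in> {1..d} \<Longrightarrow>
      \<exists>U. open U \<and> p0 j \<in> U \<and> W \<inter> zero_locus (P ` {1..m}) \<inter> U = \<gamma> j \<inter> U"
    and i_section: "W \<inter> zero_locus (P ` {1..m}) \<inter> affine_plane 0 0 = p0 ` {1..d}"
    and ii: "\<exists>\<kappa>>0. \<exists>K>0. \<forall>\<zeta>\<in>W. norm \<zeta> \<ge> K \<longrightarrow>
      (\<Sum>j=1..m. cmod (poly_eval (P j) \<zeta>) / norm \<zeta> powr real_of_rat (\<delta> j))
        + (\<Sum>k\<in>UNIV. cmod (\<zeta> $ Inl k) / norm \<zeta>) \<ge> \<kappa>"
    and \<rho>: "\<rho> = (\<Sum>j=1..m. of_nat (deg j) - \<delta> j)"
  shows "\<exists>\<epsilon>>0.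
    \<exists>p :: nat \<Rightarrow> complex ^ ('a \<times> 'b) \<Rightarrow> complex ^ 'a \<Rightarrow> complex ^ ('a + 'b).
    \<exists>h :: 'b \<Rightarrow> ('a \<Rightarrow> nat) \<Rightarrow> complex ^ ('a \<times> 'b) \<Rightarrow> complex.
      (\<forall>j\<in>{1..d}. ((\<lambda>(\<alpha>, \<beta>). p j \<alpha> \<beta>) \<longlongrightarrow> p0 j) (at (0, 0))) \<and>
      (\<forall>l k. of_nat (\<Sum>i\<in>UNIV. k i) \<le> \<rho> + 1 \<longrightarrow> holomorphic_several (h l k) (ball 0 \<epsilon>)) \<and>
      (\<forall>\<alpha> \<beta>. norm \<alpha> < \<epsilon> \<longrightarrow> norm \<beta> < \<epsilon> \<longrightarrow>
        (\<forall>j\<in>{1..d}. \<gamma> j \<inter> affine_plane \<alpha> \<beta> = {p j \<alpha> \<beta>} \<and>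
           transversal_at (\<gamma> j) (affine_plane \<alpha> \<beta>) (p j \<alpha> \<beta>)) \<and>
        inj_on (\<lambda>j. p j \<alpha> \<beta>) {1..d} \<and>
        (\<forall>l. (\<Sum>j=1..d. p j \<alpha> \<beta> $ Inr l) =
           (\<Sum>k | of_nat (\<Sum>i\<in>UNIV. k i) \<le> \<rho> + 1. h l k \<alpha> * (\<Prod>i\<in>UNIV. \<beta> $ i ^ k i))))"
proof -
  define V where "V = W \<inter> zero_locus (P ` {1..m})"
  obtain F where F: "W = zero_locus F" using W(2) unfolding algebraic_variety_of_dim_def algebraic_set_def by blast
  define Q where "Q = poly_eval ` (F \<union> P ` {1..m})"
  have V: "V = zeros Q" by (auto simp: V_def F Q_def zeros_def zero_locus_def)
  have Q: "Q \<subseteq> polyfuns" by (auto simp: Q_def poly_eval_polyfuns)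
  have closedV: "closed V" unfolding V by (rule closed_zeros[OF Q])
  obtain \<kappa> K where \<kappa>: "\<kappa> > 0" "K > 0" "\<forall>\<zeta>\<in>W. norm \<zeta> \<ge> K \<longrightarrow>
      (\<Sum>j=1..m. cmod (poly_eval (P j) \<zeta>) / norm \<zeta> powr real_of_rat (\<delta> j))
        + (\<Sum>k\<in>UNIV. cmod (\<zeta> $ Inl k) / norm \<zeta>) \<ge> \<kappa>"
    using ii by blast
  \<comment> \<open>The \<open>P j\<close> vanish on \<open>V\<close>, so in (ii) only the sum over
    the first coordinates remains.\<close>
  have growth: "\<kappa> * norm \<zeta> \<le> (\<Sum>k\<in>UNIV. cmod (\<zeta> $ Inl k))" if "\<zeta> \<in> V" "K \<le> norm \<zeta>" for \<zeta>
  proof -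
    have "poly_eval (P j) \<zeta> = 0" if "j \<in> {1..m}" for j
      using \<open>\<zeta> \<in> V\<close> that by (auto simp: V_def zero_locus_def)
    then have "(\<Sum>j=1..m. cmod (poly_eval (P j) \<zeta>) / norm \<zeta> powr real_of_rat (\<delta> j)) = 0"
      by (intro sum.neutral) auto
    moreover have "\<zeta> \<in> W" using that by (simp add: V_def)
    ultimately have "\<kappa> \<le> (\<Sum>k\<in>UNIV. cmod (\<zeta> $ Inl k) / norm \<zeta>)"
      using \<kappa>(3) that(2) by fastforce
    also have "\<dots> = (\<Sum>k\<in>UNIV. cmod (\<zeta> $ Inl k)) / norm \<zeta>" by (simp add: sum_divide_distrib)
    finally have "\<kappa> \<le> (\<Sum>k\<in>UNIV. cmod (\<zeta> $ Inl k)) / norm \<zeta>" .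
    moreover have "0 < norm \<zeta>" using that(2) \<kappa>(2) by linarith
    ultimately show ?thesis by (metis pos_le_divide_eq)
  qed
  obtain \<eta> C where \<eta>: "0 < \<eta>" "0 < C" and bound:
    "\<And>\<alpha> \<beta> \<zeta>. norm \<alpha> < \<eta> \<Longrightarrow> \<zeta> \<in> V \<Longrightarrow> \<zeta> \<in> affine_plane \<alpha> \<beta> \<Longrightarrow> norm \<zeta> \<le> C * (1 + norm \<beta>)"
    using section_bound[OF \<kappa>(1,2) growth] by blast
  \<comment> \<open>Near \<open>p0 j\<close> the set \<open>V\<close> coincides with
    \<open>\<gamma> j\<close>; shrinking into such a neighbourhood gives
    \<open>V \<inter> B \<subseteq> \<gamma> j\<close>, which lets points of \<open>V\<close> be
    attributed to a piece.\<close>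
  have "\<exists>B e p. open B \<and> p0 j \<in> B \<and> V \<inter> B \<subseteq> \<gamma> j \<and> 0 < e \<and> holomorphic_map p (ball 0 e) \<and> p 0 = p0 j \<and>
      (\<forall>\<alpha> \<beta>. join \<alpha> \<beta> \<in> ball 0 e \<longrightarrow> \<gamma> j \<inter> B \<inter> affine_plane \<alpha> \<beta> = {p (join \<alpha> \<beta>)} \<and>
         transversal_at (\<gamma> j) (affine_plane \<alpha> \<beta>) (p (join \<alpha> \<beta>)))" if j: "j \<in> {1..d}" for j
  proof -
    obtain U where U: "open U" "p0 j \<in> U" "V \<inter> U = \<gamma> j \<inter> U" using i_germ[OF j] unfolding V_def by blast
    have M: "complex_submanifold CARD('a) (\<gamma> j)" using \<gamma>_manifold[OF j] by (simp add: card_a)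
    show ?thesis
    proof (rule transversal_section[OF M L00(2)[OF j] U(1,2)])
      fix B e p
      assume "open B" "p0 j \<in> B" "B \<subseteq> U" "0 < e" "holomorphic_map p (ball 0 e)" "p 0 = p0 j"
        "\<And>\<alpha> \<beta>. join \<alpha> \<beta> \<in> ball 0 e \<Longrightarrow> \<gamma> j \<inter> B \<inter> affine_plane \<alpha> \<beta> = {p (join \<alpha> \<beta>)} \<and>
           transversal_at (\<gamma> j) (affine_plane \<alpha> \<beta>) (p (join \<alpha> \<beta>))"
      moreover from this have "V \<inter> B \<subseteq> \<gamma> j" using U(3) by blast
      ultimately show ?thesis by (intro exI[of _ B] exI[of _ e] exI[of _ p] conjI allI impI) blast+
    qed
  qed
  then have "\<forall>j\<in>{1..d}. \<exists>B e p. open B \<and> p0 j \<in> B \<and> V \<inter> B \<subseteq> \<gamma> j \<and> 0 < e \<and>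
      holomorphic_map p (ball 0 e) \<and> p 0 = p0 j \<and>
      (\<forall>\<alpha> \<beta>. join \<alpha> \<beta> \<in> ball 0 e \<longrightarrow> \<gamma> j \<inter> B \<inter> affine_plane \<alpha> \<beta> = {p (join \<alpha> \<beta>)} \<and>
         transversal_at (\<gamma> j) (affine_plane \<alpha> \<beta>) (p (join \<alpha> \<beta>)))" by blast
  then obtain B e p where B: "\<And>j. j \<in> {1..d} \<Longrightarrow> open (B j)" "\<And>j. j \<in> {1..d} \<Longrightarrow> p0 j \<in> B j"
      "\<And>j. j \<in> {1..d} \<Longrightarrow> V \<inter> B j \<subseteq> \<gamma> j"
    and e: "\<And>j. j \<in> {1..d} \<Longrightarrow> 0 < e j" and p: "\<And>j. j \<in> {1..d} \<Longrightarrow> holomorphic_map (p j) (ball 0 (e j))"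
      "\<And>j. j \<in> {1..d} \<Longrightarrow> p j 0 = p0 j"
    and sec: "\<And>j \<alpha> \<beta>. j \<in> {1..d} \<Longrightarrow> join \<alpha> \<beta> \<in> ball 0 (e j) \<Longrightarrow>
      \<gamma> j \<inter> B j \<inter> affine_plane \<alpha> \<beta> = {p j (join \<alpha> \<beta>)} \<and>
      transversal_at (\<gamma> j) (affine_plane \<alpha> \<beta>) (p j (join \<alpha> \<beta>))"
    unfolding bchoice_iff by blast
  \<comment> \<open>The element 1 keeps the minimum defined for d = 0.\<close>
  define e0 where "e0 = Min (insert 1 (e ` {1..d}))"
  have e0: "0 < e0" using e by (auto simp: e0_def)
  have e0_le: "e0 \<le> e j" if "j \<in> {1..d}" for j unfolding e0_def by (rule Min_le) (use that in auto)
  \<comment> \<open>The neighbourhoods \<open>B j\<close> cover the section with the plane of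
    parameters (0, 0), hence also all sections nearby.\<close>
  have "\<exists>\<epsilon>1>0. \<forall>\<alpha> \<beta>. norm \<alpha> < \<epsilon>1 \<longrightarrow> norm \<beta> < \<epsilon>1 \<longrightarrow>
      V \<inter> affine_plane \<alpha> \<beta> \<subseteq> (\<Union>j\<in>{1..d}. B j)"
  proof (rule nearby_sections[OF closedV _ _ \<eta>])
    show "open (\<Union>j\<in>{1..d}. B j)" using B(1) by blast
    show "V \<inter> affine_plane 0 0 \<subseteq> (\<Union>j\<in>{1..d}. B j)" using i_section B(2) by (auto simp: V_def)
  qed (use bound in blast)+
  then obtain \<epsilon>1 where \<epsilon>1: "0 < \<epsilon>1" "\<And>\<alpha> \<beta>. norm \<alpha> < \<epsilon>1 \<Longrightarrow> norm \<beta> < \<epsilon>1 \<Longrightarrow>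
      V \<inter> affine_plane \<alpha> \<beta> \<subseteq> (\<Union>j\<in>{1..d}. B j)" by blast
  \<comment> \<open>The bound \<open>e0 / 2\<close> is chosen because the norm of
    \<open>join \<alpha> \<beta>\<close> is bounded by the sum of the two norms.\<close>
  define \<epsilon> where "\<epsilon> = min \<epsilon>1 (min \<eta> (e0 / 2))"
  have \<epsilon>: "0 < \<epsilon>" "\<epsilon> \<le> \<epsilon>1" "\<epsilon> \<le> \<eta>" "2 * \<epsilon> \<le> e0" using \<epsilon>1(1) \<eta>(1) e0 by (auto simp: \<epsilon>_def)
  have inball: "join \<alpha> \<beta> \<in> ball 0 (e j)" if "norm \<alpha> < \<epsilon>" "norm \<beta> < \<epsilon>" "j \<in> {1..d}" for \<alpha> \<beta> j
    using norm_join_le[of \<alpha> \<beta>] that \<epsilon>(4) e0_le[OF that(3)] by simp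
  have \<gamma>V: "\<gamma> j \<subseteq> V" if "j \<in> {1..d}" for j using i_contains[OF that] by (simp add: V_def)
  have \<gamma>_sec: "\<gamma> j \<inter> affine_plane \<alpha> \<beta> = {p j (join \<alpha> \<beta>)}"
    if "norm \<alpha> < \<epsilon>" "norm \<beta> < \<epsilon>" "j \<in> {1..d}" for \<alpha> \<beta> j
  proof -
    \<comment> \<open>A point of \<open>\<gamma> j\<close> on a nearby plane could a priori lie far
      from \<open>p0 j\<close>; but it lies in some \<open>B i\<close>, hence in
      \<open>\<gamma> i\<close>, and disjointness gives i = j.\<close>
    have "\<zeta> \<in> B j" if \<zeta>: "\<zeta> \<in> \<gamma> j \<inter> affine_plane \<alpha> \<beta>" for \<zeta>
    proof -
      have "\<zeta> \<in> V" using \<zeta> \<gamma>V \<open>j \<in> {1..d}\<close> by blast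
      then obtain i where i: "i \<in> {1..d}" "\<zeta> \<in> B i"
        using \<epsilon>1(2)[of \<alpha> \<beta>] \<open>norm \<alpha> < \<epsilon>\<close> \<open>norm \<beta> < \<epsilon>\<close> \<epsilon>(2) \<zeta> by fastforce
      then have "\<zeta> \<in> \<gamma> i" using B(3) \<open>\<zeta> \<in> V\<close> by blast
      then have "i = j" using \<gamma>_disjoint[OF i(1) \<open>j \<in> {1..d}\<close>] \<zeta> by blast
      then show ?thesis using i by simp
    qed
    then have "\<gamma> j \<inter> affine_plane \<alpha> \<beta> = \<gamma> j \<inter> B j \<inter> affine_plane \<alpha> \<beta>" by blast
    then show ?thesis using sec[OF that(3) inball[OF that]] by simp
  qed
  have V_sec: "V \<inter> affine_plane \<alpha> \<beta> = (\<lambda>j. p j (join \<alpha> \<beta>)) ` {1..d}"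
    if small: "norm \<alpha> < \<epsilon>" "norm \<beta> < \<epsilon>" for \<alpha> \<beta>
  proof (intro equalityI subsetI)
    fix \<zeta> assume \<zeta>: "\<zeta> \<in> V \<inter> affine_plane \<alpha> \<beta>"
    then obtain j where j: "j \<in> {1..d}" "\<zeta> \<in> B j" using \<epsilon>1(2)[of \<alpha> \<beta>] small \<epsilon>(2) by fastforce
    then have "\<zeta> \<in> \<gamma> j \<inter> affine_plane \<alpha> \<beta>" using B(3) \<zeta> by blast
    then show "\<zeta> \<in> (\<lambda>j. p j (join \<alpha> \<beta>)) ` {1..d}" using \<gamma>_sec[OF small j(1)] j(1) by blast
  next
    fix \<zeta> assume "\<zeta> \<in> (\<lambda>j. p j (join \<alpha> \<beta>)) ` {1..d}"
    then obtain j where "j \<in> {1..d}" "\<zeta> = p j (join \<alpha> \<beta>)" by blast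
    then show "\<zeta> \<in> V \<inter> affine_plane \<alpha> \<beta>" using \<gamma>_sec[OF small] \<gamma>V by blast
  qed
  have inj: "inj_on (\<lambda>j. p j (join \<alpha> \<beta>)) {1..d}" if "norm \<alpha> < \<epsilon>" "norm \<beta> < \<epsilon>" for \<alpha> \<beta>
  proof (rule inj_onI, rule ccontr)
    fix i j assume ij: "i \<in> {1..d}" "j \<in> {1..d}" "p i (join \<alpha> \<beta>) = p j (join \<alpha> \<beta>)" "i \<noteq> j"
    have "p i (join \<alpha> \<beta>) \<in> \<gamma> i" "p j (join \<alpha> \<beta>) \<in> \<gamma> j"
      using \<gamma>_sec[OF that ij(1)] \<gamma>_sec[OF that ij(2)] by blast+
    then show False using \<gamma>_disjoint[OF ij(1,2,4)] ij(3) by auto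
  qed
  define f where "f = (\<lambda>l \<alpha> \<beta>. \<Sum>j=1..d. p j (join \<alpha> \<beta>) $ Inr l)"
  \<comment> \<open>Any fixed nonzero increment within the domain works, as the difference quotient
    of an affine function is its slope.\<close>
  define s where "s = complex_of_real (\<epsilon> / 2)"
  have s: "cmod s < \<epsilon>" "s \<noteq> 0" using \<epsilon>(1) by (simp_all add: s_def)
  define c where "c = (\<lambda>l \<alpha> i. (f l \<alpha> (s *s axis i 1) - f l \<alpha> 0) / s)"
  have f_affine: "f l \<alpha> \<beta> = f l \<alpha> 0 + (\<Sum>i\<in>UNIV. c l \<alpha> i * \<beta> $ i)" if "norm \<alpha> < \<epsilon>" "norm \<beta> < \<epsilon>" for l \<alpha> \<beta>
    unfolding f_def c_def
  proof (rule trace_affine[OF V Q])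
    show "norm \<zeta> \<le> C * (1 + norm \<beta>)" if "\<zeta> \<in> V" "\<zeta> \<in> affine_plane \<alpha> \<beta>" for \<beta> \<zeta>
      using bound[of \<alpha>] that \<open>norm \<alpha> < \<epsilon>\<close> \<epsilon>(3) by simp
    show "holomorphic_map (p j) (ball 0 e0)" if "j \<in> {1..d}" for j
      by (rule holomorphic_map_subset[OF p(1)[OF that]]) (use e0_le[OF that] in auto)
    show "norm \<alpha> + \<epsilon> \<le> e0" using that(1) \<epsilon>(4) by simp
  qed (use V_sec inj that \<epsilon>(1) s in blast)+
  have f_hol: "holomorphic_several (\<lambda>\<alpha>. f l \<alpha> \<beta>) (ball 0 \<epsilon>)" if "norm \<beta> < \<epsilon>" for l \<beta>
    unfolding f_def
  proof (intro holomorphic_several_sum open_ball)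
    fix j assume j: "j \<in> {1..d}"
    have "holomorphic_several (\<lambda>y. p j y $ Inr l) (ball 0 (e j))"
      using p(1)[OF j] by (simp add: holomorphic_map_def)
    moreover have "holomorphic_map (\<lambda>\<alpha> :: complex ^ ('a \<times> 'b). join \<alpha> \<beta>) (ball 0 \<epsilon>)"
    proof (rule holomorphic_mapI[OF open_ball])
      fix \<alpha> :: "complex ^ ('a \<times> 'b)"
      have eq: "(\<lambda>\<alpha>. join \<alpha> \<beta>) = (\<lambda>\<alpha>. join \<alpha> 0 + join 0 \<beta>)" by (simp add: join_add)
      have "((\<lambda>\<alpha>. join \<alpha> \<beta>) has_derivative (\<lambda>h. join h 0 + 0)) (at \<alpha>)"
        unfolding eq by (intro has_derivative_add has_derivative_const
            bounded_linear_imp_has_derivative bounded_linear_join)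
      then show "\<exists>D. ((\<lambda>\<alpha>. join \<alpha> \<beta>) has_derivative D) (at \<alpha>) \<and> (\<forall>c v. D (c *s v) = c *s D v)"
        by (intro exI[of _ "\<lambda>h. join h 0"]) (simp add: smult_join)
    qed
    moreover have "(\<lambda>\<alpha> :: complex ^ ('a \<times> 'b). join \<alpha> \<beta>) ` ball 0 \<epsilon> \<subseteq> ball 0 (e j)"
      by (intro image_subsetI inball[OF _ that j]) simp
    ultimately show "holomorphic_several (\<lambda>\<alpha>. p j (join \<alpha> \<beta>) $ Inr l) (ball 0 \<epsilon>)"
      by (rule holomorphic_several_compose[OF _ _ open_ball])
  qed
  \<comment> \<open>The value at \<beta> = 0 for the zero multi-index, the slope along axis i for
    the i-th unit vector, and 0 for all other multi-indices.\<close>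
  define h where "h = (\<lambda>l k \<alpha>. if k = (\<lambda>_. 0) then f l \<alpha> 0
    else if \<exists>i. k = (\<lambda>_. 0 :: nat)(i := 1) then c l \<alpha> (THE i. k = (\<lambda>_. 0)(i := 1)) else 0)"
  have c_hol: "holomorphic_several (\<lambda>\<alpha>. c l \<alpha> i) (ball 0 \<epsilon>)" for l i
  proof -
    have "norm (s *s axis i 1 :: complex ^ 'a) < \<epsilon>" using s by (simp add: norm_vector_smult norm_axis)
    then have "holomorphic_several (\<lambda>\<alpha>. (f l \<alpha> (s *s axis i 1) - f l \<alpha> 0) * (1 / s)) (ball 0 \<epsilon>)"
      using \<epsilon>(1) by (intro holomorphic_several_mult holomorphic_several_diff holomorphic_several_const f_hol) auto
    then show ?thesis by (simp add: c_def)
  qed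
  have h_hol: "holomorphic_several (h l k) (ball 0 \<epsilon>)" for l k
    unfolding h_def using f_hol[of 0] c_hol \<epsilon>(1) holomorphic_several_const[OF open_ball]
    by (cases "k = (\<lambda>_. 0)"; cases "\<exists>i. k = (\<lambda>_. 0)(i := 1)") simp_all
  have "0 \<le> \<rho>" unfolding \<rho> using deg(2) by (intro sum_nonneg) simp
  then have sum_h: "(\<Sum>k | of_nat (\<Sum>i\<in>UNIV. k i) \<le> \<rho> + 1. h l k \<alpha> * (\<Prod>i\<in>UNIV. \<beta> $ i ^ k i)) =
      f l \<alpha> 0 + (\<Sum>i\<in>UNIV. c l \<alpha> i * \<beta> $ i)" for l \<alpha> \<beta>
    unfolding h_def by (rule sum_affine_multiindex)
  have lim: "((\<lambda>(\<alpha>, \<beta>). p j (join \<alpha> \<beta>)) \<longlongrightarrow> p0 j) (at (0, 0))" if j: "j \<in> {1..d}" for j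
  proof -
    have "isCont (p j) 0" by (rule holomorphic_map_continuous_at[OF p(1)[OF j]]) (simp add: e[OF j])
    moreover have "((\<lambda>(\<alpha> :: complex ^ ('a \<times> 'b), \<beta> :: complex ^ 'a). join \<alpha> \<beta>) \<longlongrightarrow> 0) (at (0, 0))"
    proof -
      let ?J = "\<lambda>(\<alpha> :: complex ^ ('a \<times> 'b), \<beta> :: complex ^ 'a). join \<alpha> \<beta>"
      let ?g = "\<lambda>x :: (complex ^ ('a \<times> 'b)) \<times> (complex ^ 'a). norm (fst x) + norm (snd x)"
      have "(?g \<longlongrightarrow> ?g (0, 0)) (at (0, 0))"
        by (intro tendsto_add tendsto_norm tendsto_fst[OF tendsto_ident_at] tendsto_snd[OF tendsto_ident_at])
      then have "(?g \<longlongrightarrow> 0) (at (0, 0))" by simp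
      moreover have "\<forall>\<^sub>F x in at (0, 0). norm (?J x) \<le> ?g x"
        by (intro always_eventually allI) (simp add: split_beta norm_join_le)
      ultimately show ?thesis by (rule Lim_null_comparison[rotated])
    qed
    ultimately have "((\<lambda>x. p j (case x of (\<alpha>, \<beta>) \<Rightarrow> join \<alpha> \<beta>)) \<longlongrightarrow> p j 0) (at (0, 0))"
      by (rule isCont_tendsto_compose)
    then show ?thesis by (simp add: case_prod_beta' p(2)[OF j])
  qed
  show ?thesis
  proof (intro exI[of _ \<epsilon>] exI[of _ "\<lambda>j \<alpha> \<beta>. p j (join \<alpha> \<beta>)"] exI[of _ h] conjI allI impI ballI)
    fix \<alpha> :: "complex ^ ('a \<times> 'b)" and \<beta> :: "complex ^ 'a"
    assume small: "norm \<alpha> < \<epsilon>" "norm \<beta> < \<epsilon>"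
    show "inj_on (\<lambda>j. p j (join \<alpha> \<beta>)) {1..d}" by (rule inj[OF small])
    fix j assume j: "j \<in> {1..d}"
    show "\<gamma> j \<inter> affine_plane \<alpha> \<beta> = {p j (join \<alpha> \<beta>)}" by (rule \<gamma>_sec[OF small j])
    show "transversal_at (\<gamma> j) (affine_plane \<alpha> \<beta>) (p j (join \<alpha> \<beta>))"
      using sec[OF j inball[OF small j]] by blast
  next
    fix \<alpha> :: "complex ^ ('a \<times> 'b)" and \<beta> :: "complex ^ 'a" and l
    assume small: "norm \<alpha> < \<epsilon>" "norm \<beta> < \<epsilon>"
    show "(\<Sum>j=1..d. p j (join \<alpha> \<beta>) $ Inr l) =
        (\<Sum>k | of_nat (\<Sum>i\<in>UNIV. k i) \<le> \<rho> + 1. h l k \<alpha> * (\<Prod>i\<in>UNIV. \<beta> $ i ^ k i))"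
      using f_affine[OF small, of l] unfolding sum_h by (simp only: f_def)
  qed (use \<epsilon>(1) lim h_hol in auto)
qed

end
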